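(* Under the standing assumptions listed in the context, assume moreover that $f$ and $g_0$ are strictly monotone and that $\psi$ is strictly monotone, i.e. $\langle\psi(y)-\psi(x),y-x\rangle>0$ for all $x\neq y$ in $\mathbb{R}^m$. Let $\eta_1,\eta_2\in\mathcal{P}_{m_0}(\Gamma\times\mathcal{U})$ be Lagrangian MFGC equilibria for $m_0$. Then $P^{\eta_1}=P^{\eta_2}$ and $J^{\eta_1}=J^{\eta_2}$.
   Context: **Notation and data.** Fix $T>0$ and dimensions $n,m,n_c,n_{g_1},n_{g_2}$ (the letter $m$ is the control dimension in $\mathbb{R}^m$; elsewhere it denotes a measure or a curve of measures). For a separable metric space $X$, $\mathcal{P}(X)$ is the set of Borel probability measures on $X$ and $\mathcal{P}_1(X)$ the subset of those with finite first moment, endowed with the narrow topology (convergence against bounded continuous functions). $\bar B(R)$ is the closed ball of radius $R$ centred at $0$; vector inequalities are componentwise; $\mathbf 1$ is the vector of ones; $\sharp$ denotes push-forward. Data: $a:\mathbb{R}^n\to\mathbb{R}^n$, $b:\mathbb{R}^n\to\mathbb{R}^{n\times m}$ (columns $b_i$), $c:\mathbb{R}^n\times\mathbb{R}^m\to\mathbb{R}^{n_c}$, $g_1:\mathbb{R}^n\to\mathbb{R}^{n_{g_1}}$, $g_2:\mathbb{R}^n\to\mathbb{R}^{n_{g_2}}$, $L:\mathbb{R}^n\times\mathbb{R}^m\to\mathbb{R}$, $f,g_0:\mathbb{R}^n\times\mathcal{P}_1(\mathbb{R}^n)\to\mathbb{R}$, $\psi:\mathbb{R}^m\to\mathbb{R}^m$,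 $m_0\in\mathcal{P}_1(\mathbb{R}^n)$ with support $K_0$. Let $\Gamma=H^1(0,T;\mathbb{R}^n)$ with the supremum norm and $\mathcal{U}=L^2(0,T;\mathbb{R}^m)$. For $x_0\in\mathbb{R}^n$, $\mathcal{K}[x_0]$ is the set of $(\gamma,v)\in\Gamma\times\mathcal{U}$ with $\dot\gamma(t)=a(\gamma(t))+b(\gamma(t))v(t)$ and $c(\gamma(t),v(t))\le0$ for a.e. $t\in(0,T)$, $\gamma(0)=x_0$, $g_1(\gamma(T))=0$, $g_2(\gamma(T))\le0$. For $m\in C([0,T];\mathcal{P}_1(\mathbb{R}^n))$, $P\in L^\infty(0,T;\mathbb{R}^m)$, $$J[m,P](\gamma,v)=\int_0^T\big(L(\gamma(t),v(t))+\langle P(t),v(t)\rangle+f(\gamma(t),m(t))\big)dt+g_0(\gamma(T),m(T)).$$ Let $V(R)=\operatorname{conv}\{(x,v):|x|\le R,\ c(x,v)\le0\}$. **Standing assumptions.** Convexity: there is $C>0$ such that for all $x$, $L(x,\cdot)$ is strongly convex with parameter $1/C$ and $L(x,v)\ge(1/C)|v|^2-C$ for all $(x,v)$; each $c_i(x,\cdot)$ is convex; $\psi$ is monotone, $\langle\psi(y)-\psi(x),y-x\rangle\ge0$. Regularity: $L,c$ are $C^2$; $a,b,g_1,g_2$ are $C^1$; for each $m\in\mathcal{P}_1(\mathbb{R}^n)$, $f(\cdot,m)$ and $g_0(\cdot,m)$ are $C^1$; $f,D_xf,g_0,D_xg_0$ are continuous in both variables; $\psi$ is continuous. Growth: for every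 $R>0$ there is $C(R)>0$ such that for all $(x,v)\in V(R)$, $|D_xL(x,v)|\le C(R)(1+|v|^2)$ and $|D_vL(x,v)|\le C(R)(1+|v|)$; for every $R>0$ there is $C(R)>0$ such that for all $(x,v),(\tilde x,\tilde v)\in V(R)+\bar B(1)$, $|D_xc(x,v)|+|D_vc(x,v)|\le C(R)$ and $|D_vc(x,v)-D_vc(\tilde x,\tilde v)|\le C(R)|(x,v)-(\tilde x,\tilde v)|$; there is $C>0$ with $|a(x)|\le C(1+|x|)$, $|b(x)|\le C(1+|x|)$ for all $x$; $K_0$ is bounded; there is $C>0$ such that for all $x_0\in K_0$, $m\in C([0,T];\mathcal{P}_1(\mathbb{R}^n))$, $(\gamma,v)\in\mathcal{K}[x_0]$: $\int_0^Tf(\gamma(t),m(t))dt+g_0(\gamma(T),m(T))\ge-C$ and $\|D_xf(\gamma(\cdot),m(\cdot))\|_{L^\infty(0,T)}\le C$; $\psi$ is bounded. Feasibility: for every $R>0$ there is $C(R)>0$ such that for each $x\in\bar B(R)$ there is $v\in\bar B(C(R))$ with $c(x,v)\le0$; there is $C>0$ such that for all $x_0\in K_0$, all $m\in C([0,T];\mathcal{P}_1(\mathbb{R}^n))$ with $m(0)=m_0$ and all $P$ with $\|P\|_{L^\infty}\le\sup_\theta|\psi(\theta)|$, there is $(\gamma_0,v_0)\in\mathcal{K}[x_0]$ with $J[m,P](\gamma_0,v_0)\le C$. Qualification: call $(y,w)\in H^1(0,T;\mathbb{R}^n)\times L^\infty(0,T;\mathbb{R}^m)$ linearized at $(\gamma,v)$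 if $\dot y=(Da(\gamma)+\sum_iDb_i(\gamma)v_i)y+b(\gamma)w$, $y(0)=0$. (1) There is $C>0$ such that for all $x_0\in K_0$, $(\gamma,v)\in\mathcal{K}[x_0]$, $z_1\in\mathbb{R}^{n_{g_1}}$ there is $(y,w)$ linearized at $(\gamma,v)$ with $Dg_1(\gamma(T))y(T)=z_1$, $\|y\|_{H^1}\le C|z_1|$, $\|w\|_{L^\infty}\le C|z_1|$. (2) There is $C>0$ such that for all $x_0\in K_0$, $(\gamma,v)\in\mathcal{K}[x_0]$ there is $(y,w)$ linearized at $(\gamma,v)$ with $Dg_1(\gamma(T))y(T)=0$, $g_2(\gamma(T))+Dg_2(\gamma(T))y(T)\le-\frac1C\mathbf 1$, $c(\gamma(t),v(t))+Dc(\gamma(t),v(t))(y(t),w(t))\le-\frac1C\mathbf 1$ for a.e. $t$, $\|y\|_{H^1}\le C$, $\|w\|_{L^\infty}\le C$. (3) There is $C>0$ such that for all $(x,v)$ with $c(x,v)\le0$ and all $\omega\in\mathbb{R}^{|I(x,v)|}$, $|D_vc_{I(x,v)}(x,v)^\top\omega|\ge(1/C)|\omega|$, where $I(x,v)=\{i:c_i(x,v)=0\}$. (4) For every $R>0$ there are $C,\varepsilon>0$ depending only on $R$ such that for all $x\in\bar B(R)$, $v$ with $c(x,v)\le0$, there is $w\in\bar B(C)$ with $c(x,v)+D_vc(x,v)w\le-\varepsilon\mathbf 1$. **Lagrangian equilibria.** For $t\in[0,T]$ let $e_t:\Gamma\times\mathcal{U}\to\mathbb{R}^n$, $e_t(\gamma,v)=\gamma(t)$,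 and $\mathcal{P}_{m_0}(\Gamma\times\mathcal{U})=\{\eta\in\mathcal{P}_1(\Gamma\times\mathcal{U}):e_0\sharp\eta=m_0\}$. For such $\eta$: $m^\eta_t=e_t\sharp\eta$, $P^\eta=\Psi\big(\int_{\Gamma\times\mathcal{U}}v\,d\eta(\gamma,v)\big)$, a Bochner integral in $L^2(0,T;\mathbb{R}^m)$, where $\Psi[\theta](t)=\psi(\theta(t))$; $J^\eta=J[m^\eta,P^\eta]$; $\Gamma^\eta[x_0]$ is the set of minimizers of $J^\eta$ over $\mathcal{K}[x_0]$. $\eta\in\mathcal{P}_{m_0}(\Gamma\times\mathcal{U})$ is a Lagrangian MFGC equilibrium if $\operatorname{supp}(\eta)\subset\bigcup_{x\in\operatorname{supp}(m_0)}\Gamma^\eta[x]$. **Monotonicity.** $\varphi:\mathbb{R}^n\times\mathcal{P}_1(\mathbb{R}^n)\to\mathbb{R}$ is monotone if $\int_{\mathbb{R}^n}(\varphi(x,m_1)-\varphi(x,m_2))\,d(m_1-m_2)(x)\ge0$ for all $m_1,m_2$. It is strictly monotone if it is monotone and this integral is $0$ if and only if $\varphi(x,m_1)=\varphi(x,m_2)$ for all $x\in\mathbb{R}^n$. *)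

theory Defs
  imports "HOL-Probability.Probability"
begin

section \<open>The Hilbert space of square integrable functions on the real line\<close>

definition sq_integrable :: "(real \<Rightarrow> 'b::euclidean_space) \<Rightarrow> bool" where
  "sq_integrable f \<longleftrightarrow> f \<in> borel_measurable lborel \<and> integrable lborel (\<lambda>t. (norm (f t))\<^sup>2)"

lemma sq_integrableD [measurable_dest]: "sq_integrable f \<Longrightarrow> f \<in> borel_measurable borel"
  by (simp add: sq_integrable_def)

lemma sq_integrable_zero [simp]: "sq_integrable (\<lambda>t. 0)"
  by (simp add: sq_integrable_def)

lemma sq_integrable_bound:
  assumes f: "f \<in> borel_measurable borel" and w: "integrable lborel w"
    and le: "AE t in lborel. (norm (f t))\<^sup>2 \<le> w t"
  shows "sq_integrable f"
  unfolding sq_integrable_def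
proof
  show "f \<in> borel_measurable lborel" using f by simp
  have [measurable]: "f \<in> borel_measurable borel" by fact
  show "integrable lborel (\<lambda>t. (norm (f t))\<^sup>2)"
    by (rule Bochner_Integration.integrable_bound[OF w]) (use le in \<open>auto elim!: eventually_mono\<close>)
qed

lemma sq_integrable_add:
  assumes "sq_integrable f" "sq_integrable g"
  shows "sq_integrable (\<lambda>t. f t + g t)"
proof (rule sq_integrable_bound)
  note [measurable] = assms[THEN sq_integrableD]
  show "(\<lambda>t. f t + g t) \<in> borel_measurable borel" by measurable
  show "integrable lborel (\<lambda>t. 2 * (norm (f t))\<^sup>2 + 2 * (norm (g t))\<^sup>2)"
    using assms by (auto simp: sq_integrable_def)
  have "(norm (f t + g t))\<^sup>2 \<le> 2 * (norm (f t))\<^sup>2 + 2 * (norm (g t))\<^sup>2" for t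
  proof -
    have "(norm (f t + g t))\<^sup>2 \<le> (norm (f t) + norm (g t))\<^sup>2"
      by (intro power_mono norm_triangle_ineq norm_ge_zero)
    also have "\<dots> \<le> 2 * (norm (f t))\<^sup>2 + 2 * (norm (g t))\<^sup>2"
      using sum_squares_bound[of "norm (f t)" "norm (g t)"] by (simp add: power2_sum)
    finally show ?thesis .
  qed
  then show "AE t in lborel. (norm (f t + g t))\<^sup>2 \<le> 2 * (norm (f t))\<^sup>2 + 2 * (norm (g t))\<^sup>2"
    by simp
qed

lemma sq_integrable_scaleR: "sq_integrable f \<Longrightarrow> sq_integrable (\<lambda>t. r *\<^sub>R f t)"
  by (auto simp: sq_integrable_def power_mult_distrib)

lemma sq_integrable_minus: "sq_integrable f \<Longrightarrow> sq_integrable (\<lambda>t. - f t)"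
  by (auto simp: sq_integrable_def)

lemma sq_integrable_diff:
  "sq_integrable f \<Longrightarrow> sq_integrable g \<Longrightarrow> sq_integrable (\<lambda>t. f t - g t)"
  using sq_integrable_add[of f "\<lambda>t. - g t"] by (simp add: sq_integrable_minus)

lemma sq_integrable_sum:
  "(\<And>i. i \<in> I \<Longrightarrow> sq_integrable (f i)) \<Longrightarrow> sq_integrable (\<lambda>t. \<Sum>i\<in>I. f i t)"
  by (induction I rule: infinite_finite_induct) (auto intro: sq_integrable_add)

lemma sq_integrable_inner:
  assumes "sq_integrable f" "sq_integrable g"
  shows "integrable lborel (\<lambda>t. f t \<bullet> g t)"
proof (rule Bochner_Integration.integrable_bound)
  note [measurable] = assms[THEN sq_integrableD]
  show "integrable lborel (\<lambda>t. (norm (f t))\<^sup>2 + (norm (g t))\<^sup>2)"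
    using assms by (auto simp: sq_integrable_def)
  show "(\<lambda>t. f t \<bullet> g t) \<in> borel_measurable lborel" by measurable
  have "\<bar>f t \<bullet> g t\<bar> \<le> (norm (f t))\<^sup>2 + (norm (g t))\<^sup>2" for t
  proof -
    have "\<bar>f t \<bullet> g t\<bar> \<le> norm (f t) * norm (g t)" by (rule Cauchy_Schwarz_ineq2)
    also have "\<dots> \<le> 2 * norm (f t) * norm (g t)" by simp
    also have "\<dots> \<le> (norm (f t))\<^sup>2 + (norm (g t))\<^sup>2"
      by (rule sum_squares_bound)
    finally show ?thesis .
  qed
  then show "AE t in lborel. norm (f t \<bullet> g t) \<le> norm ((norm (f t))\<^sup>2 + (norm (g t))\<^sup>2)"
    by simp
qed

definition L2_rel :: "(real \<Rightarrow> 'b::euclidean_space) \<Rightarrow> (real \<Rightarrow> 'b) \<Rightarrow> bool" where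
  "L2_rel f g \<longleftrightarrow> sq_integrable f \<and> sq_integrable g \<and> (AE t in lborel. f t = g t)"

quotient_type (overloaded) 'b L2fun = "real \<Rightarrow> 'b::euclidean_space" / partial: L2_rel
proof (rule part_equivpI)
  show "\<exists>f::real \<Rightarrow> 'b. L2_rel f f"
    by (rule exI[of _ "\<lambda>_. 0"]) (simp add: L2_rel_def)
  show "symp (L2_rel :: (real \<Rightarrow> 'b) \<Rightarrow> _)"
    by (rule sympI) (auto simp: L2_rel_def elim: eventually_mono)
  show "transp (L2_rel :: (real \<Rightarrow> 'b) \<Rightarrow> _)"
    by (rule transpI) (auto simp: L2_rel_def elim: eventually_elim2)
qed

(* some Borel representative; every statement below is insensitive to its choice *)
definition L2_apply :: "'b::euclidean_space L2fun \<Rightarrow> real \<Rightarrow> 'b" where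
  "L2_apply = rep_L2fun"

lemma L2_rel_rep: "L2_rel (rep_L2fun u) (rep_L2fun u)"
  using Quotient3_rep_reflp[OF Quotient3_L2fun] .

lemma sq_integrable_L2_apply [simp, intro]: "sq_integrable (L2_apply u)"
  using L2_rel_rep[of u] by (simp add: L2_rel_def L2_apply_def)

lemma L2_apply_measurable [measurable]: "L2_apply u \<in> borel_measurable borel"
  using sq_integrableD[OF sq_integrable_L2_apply] .

lemma AE_abs_L2fun:
  assumes "sq_integrable f"
  shows "AE t in lborel. L2_apply (abs_L2fun f) t = f t"
  using rep_abs_rsp_left[OF Quotient3_L2fun, of f f] assms
  by (simp add: L2_rel_def L2_apply_def)

lemma L2fun_eqI:
  assumes "AE t in lborel. L2_apply u t = L2_apply v t"
  shows "u = v"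
  using assms Quotient3_rel_rep[OF Quotient3_L2fun, of u v]
    sq_integrable_L2_apply[of u] sq_integrable_L2_apply[of v]
  by (auto simp: L2_rel_def L2_apply_def)

lemma abs_L2_apply [simp]: "abs_L2fun (L2_apply u) = u"
  unfolding L2_apply_def by (rule Quotient3_abs_rep[OF Quotient3_L2fun])

instantiation L2fun :: (euclidean_space) real_inner
begin

lift_definition zero_L2fun :: "'a L2fun" is "\<lambda>t. 0" by (simp add: L2_rel_def)
lift_definition plus_L2fun :: "'a L2fun \<Rightarrow> 'a L2fun \<Rightarrow> 'a L2fun" is "\<lambda>f g t. f t + g t"
  by (auto simp: L2_rel_def intro!: sq_integrable_add elim: eventually_elim2)
lift_definition minus_L2fun :: "'a L2fun \<Rightarrow> 'a L2fun \<Rightarrow> 'a L2fun" is "\<lambda>f g t. f t - g t"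
  by (auto simp: L2_rel_def intro!: sq_integrable_diff elim: eventually_elim2)
lift_definition uminus_L2fun :: "'a L2fun \<Rightarrow> 'a L2fun" is "\<lambda>f t. - f t"
  by (auto simp: L2_rel_def intro!: sq_integrable_minus)
lift_definition scaleR_L2fun :: "real \<Rightarrow> 'a L2fun \<Rightarrow> 'a L2fun" is "\<lambda>r f t. r *\<^sub>R f t"
  by (auto simp: L2_rel_def intro!: sq_integrable_scaleR elim: eventually_mono)
lift_definition inner_L2fun :: "'a L2fun \<Rightarrow> 'a L2fun \<Rightarrow> real" is
  "\<lambda>f g. integral\<^sup>L lborel (\<lambda>t. f t \<bullet> g t)"
  unfolding L2_rel_def
  by (intro integral_cong_AE) (auto elim: eventually_elim2)

definition norm_L2fun :: "'a L2fun \<Rightarrow> real" where "norm_L2fun u = sqrt (u \<bullet> u)"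
definition sgn_L2fun :: "'a L2fun \<Rightarrow> 'a L2fun" where "sgn_L2fun u = scaleR (inverse (norm u)) u"
definition dist_L2fun :: "'a L2fun \<Rightarrow> 'a L2fun \<Rightarrow> real" where "dist_L2fun u v = norm (u - v)"
definition uniformity_L2fun :: "('a L2fun \<times> 'a L2fun) filter" where
  "uniformity_L2fun = (INF e\<in>{0<..}. principal {(x, y). dist x y < e})"
definition open_L2fun :: "'a L2fun set \<Rightarrow> bool" where
  "open_L2fun U = (\<forall>x\<in>U. eventually (\<lambda>(x', y). x' = x \<longrightarrow> y \<in> U) uniformity)"

instance
proof
  fix u v w :: "'a L2fun" and r s :: real
  show "dist u v = norm (u - v)" by (rule dist_L2fun_def)
  show "u + v + w = u + (v + w)"
    by transfer (auto simp: L2_rel_def add.assoc intro!: sq_integrable_add)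
  show "u + v = v + u"
    by transfer (auto simp: L2_rel_def add.commute intro!: sq_integrable_add)
  show "0 + u = u" by transfer (auto simp: L2_rel_def)
  show "- u + u = 0" by transfer (auto simp: L2_rel_def)
  show "u - v = u + - v"
    by transfer (auto simp: L2_rel_def intro!: sq_integrable_diff sq_integrable_minus)
  show "r *\<^sub>R (u + v) = r *\<^sub>R u + r *\<^sub>R v"
    by transfer (auto simp: L2_rel_def scaleR_add_right intro!: sq_integrable_add sq_integrable_scaleR)
  show "(r + s) *\<^sub>R u = r *\<^sub>R u + s *\<^sub>R u"
    by transfer (auto simp: L2_rel_def scaleR_add_left intro!: sq_integrable_add sq_integrable_scaleR)
  show "r *\<^sub>R s *\<^sub>R u = (r * s) *\<^sub>R u"
    by transfer (auto simp: L2_rel_def intro!: sq_integrable_scaleR)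
  show "1 *\<^sub>R u = u" by transfer (auto simp: L2_rel_def)
  show "sgn u = scaleR (inverse (norm u)) u" by (rule sgn_L2fun_def)
  show "uniformity = (INF e\<in>{0<..}. principal {(x::'a L2fun, y). dist x y < e})"
    by (rule uniformity_L2fun_def)
  show "open U = (\<forall>x\<in>U. eventually (\<lambda>(x', y). x' = x \<longrightarrow> y \<in> U) uniformity)" for U :: "'a L2fun set"
    by (rule open_L2fun_def)
  show "u \<bullet> v = v \<bullet> u" by transfer (simp add: inner_commute)
  show "(u + v) \<bullet> w = u \<bullet> w + v \<bullet> w"
    by transfer (auto simp: L2_rel_def inner_add_left sq_integrable_inner)
  show "r *\<^sub>R u \<bullet> v = r * (u \<bullet> v)"
    by transfer (auto simp: L2_rel_def)
  show "0 \<le> u \<bullet> u" by transfer simp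
  show "(u \<bullet> u = 0) = (u = 0)"
    by transfer (auto simp: L2_rel_def integral_nonneg_eq_0_iff_AE sq_integrable_inner)
  show "norm u = sqrt (u \<bullet> u)" by (rule norm_L2fun_def)
qed

end

lemma abs_L2fun_add:
  "sq_integrable f \<Longrightarrow> sq_integrable g \<Longrightarrow> abs_L2fun f + abs_L2fun g = abs_L2fun (\<lambda>t. f t + g t)"
  by (rule plus_L2fun.abs_eq) (auto simp: L2_rel_def)

lemma abs_L2fun_diff:
  "sq_integrable f \<Longrightarrow> sq_integrable g \<Longrightarrow> abs_L2fun f - abs_L2fun g = abs_L2fun (\<lambda>t. f t - g t)"
  by (rule minus_L2fun.abs_eq) (auto simp: L2_rel_def)

lemma abs_L2fun_scaleR: "sq_integrable f \<Longrightarrow> r *\<^sub>R abs_L2fun f = abs_L2fun (\<lambda>t. r *\<^sub>R f t)"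
  by (rule scaleR_L2fun.abs_eq) (auto simp: L2_rel_def)

lemma abs_L2fun_zero: "abs_L2fun (\<lambda>t. 0) = 0"
  by (simp add: zero_L2fun.abs_eq)

lemma abs_L2fun_sum:
  "(\<And>i. i \<in> I \<Longrightarrow> sq_integrable (f i)) \<Longrightarrow> abs_L2fun (\<lambda>t. \<Sum>i\<in>I. f i t) = (\<Sum>i\<in>I. abs_L2fun (f i))"
  by (induction I rule: infinite_finite_induct)
    (auto simp: abs_L2fun_zero abs_L2fun_add[symmetric] sq_integrable_sum)

lemma norm_abs_L2fun:
  "sq_integrable f \<Longrightarrow> (norm (abs_L2fun f))\<^sup>2 = integral\<^sup>L lborel (\<lambda>t. (norm (f t))\<^sup>2)"
  by (simp add: power2_norm_eq_inner inner_L2fun.abs_eq L2_rel_def)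

lemma norm_L2fun_eq: "(norm u)\<^sup>2 = integral\<^sup>L lborel (\<lambda>t. (norm (L2_apply u t))\<^sup>2)"
  using norm_abs_L2fun[of "L2_apply u"] by simp

lemma AE_L2_apply_add: "AE t in lborel. L2_apply (u + v) t = L2_apply u t + L2_apply v t"
  using AE_abs_L2fun[of "\<lambda>t. L2_apply u t + L2_apply v t"]
  by (simp add: abs_L2fun_add[symmetric] sq_integrable_add)

lemma AE_L2_apply_diff: "AE t in lborel. L2_apply (u - v) t = L2_apply u t - L2_apply v t"
  using AE_abs_L2fun[of "\<lambda>t. L2_apply u t - L2_apply v t"]
  by (simp add: abs_L2fun_diff[symmetric] sq_integrable_diff)

lemma AE_L2_apply_scaleR: "AE t in lborel. L2_apply (r *\<^sub>R u) t = r *\<^sub>R L2_apply u t"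
  using AE_abs_L2fun[of "\<lambda>t. r *\<^sub>R L2_apply u t"]
  by (simp add: abs_L2fun_scaleR[symmetric] sq_integrable_scaleR)

lemma inner_L2fun_eq: "u \<bullet> v = integral\<^sup>L lborel (\<lambda>t. L2_apply u t \<bullet> L2_apply v t)"
  using inner_L2fun.abs_eq[of "L2_apply u" "L2_apply v"] by (simp add: L2_rel_def)

lemma tendsto_abs_L2fun:
  fixes f :: "nat \<Rightarrow> real \<Rightarrow> 'b::euclidean_space"
  assumes f: "\<And>k. sq_integrable (f k)" and g: "sq_integrable g" and w: "sq_integrable (w :: real \<Rightarrow> real)"
    and lim: "\<And>t. (\<lambda>k. f k t) \<longlonglongrightarrow> g t" and bd: "\<And>k t. norm (f k t) \<le> w t"
  shows "(\<lambda>k. abs_L2fun (f k)) \<longlonglongrightarrow> abs_L2fun g"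
proof -
  note [measurable] = f[THEN sq_integrableD] g[THEN sq_integrableD]
  have gw: "norm (g t) \<le> w t" for t
    by (rule Lim_bounded[OF tendsto_norm[OF lim]]) (use bd in auto)
  have "(\<lambda>k. integral\<^sup>L lborel (\<lambda>t. (norm (f k t - g t))\<^sup>2)) \<longlonglongrightarrow> integral\<^sup>L lborel (\<lambda>t::real. 0::real)"
  proof (rule integral_dominated_convergence)
    show "integrable lborel (\<lambda>t. 4 * (norm (w t))\<^sup>2)" using w by (auto simp: sq_integrable_def)
    have "(\<lambda>k. (norm (f k t - g t))\<^sup>2) \<longlonglongrightarrow> 0" for t
      using tendsto_power[OF tendsto_norm_zero[OF LIM_zero[OF lim[of t]]], of 2] by simp
    then show "AE t in lborel. (\<lambda>k. (norm (f k t - g t))\<^sup>2) \<longlonglongrightarrow> 0" by simp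
    have "norm ((norm (f k t - g t))\<^sup>2) \<le> 4 * (norm (w t))\<^sup>2" for k t
    proof -
      have "norm (f k t - g t) \<le> norm (f k t) + norm (g t)" by (rule norm_triangle_ineq4)
      also have "\<dots> \<le> 2 * norm (w t)" using bd[of k t] gw[of t] by simp
      finally have "(norm (f k t - g t))\<^sup>2 \<le> (2 * norm (w t))\<^sup>2" by (intro power_mono) auto
      then show ?thesis by (simp add: power_mult_distrib)
    qed
    then show "AE t in lborel. norm ((norm (f k t - g t))\<^sup>2) \<le> 4 * (norm (w t))\<^sup>2" for k by simp
  qed measurable
  then have "(\<lambda>k. (norm (abs_L2fun (f k) - abs_L2fun g))\<^sup>2) \<longlonglongrightarrow> 0"
    by (simp add: abs_L2fun_diff f g norm_abs_L2fun sq_integrable_diff)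
  then have "(\<lambda>k. sqrt ((norm (abs_L2fun (f k) - abs_L2fun g))\<^sup>2)) \<longlonglongrightarrow> sqrt 0"
    by (intro tendsto_real_sqrt)
  then show ?thesis
    by (simp add: LIM_zero_iff tendsto_norm_zero_iff)
qed

subsection \<open>Completeness\<close>

instance L2fun :: (euclidean_space) banach
proof
  fix X :: "nat \<Rightarrow> 'a L2fun"
  assume X: "Cauchy X"
  have "\<exists>r. strict_mono r \<and> (\<forall>k. \<forall>i\<ge>r k. \<forall>j\<ge>r k. norm (X i - X j) < (1/2)^k)"
  proof -
    have "\<forall>k. \<exists>N. \<forall>i\<ge>N. \<forall>j\<ge>N. norm (X i - X j) < (1/2)^k"
      using X unfolding Cauchy_iff by simp
    then obtain N where N: "\<And>k i j. i \<ge> N k \<Longrightarrow> j \<ge> N k \<Longrightarrow> norm (X i - X j) < (1/2)^k"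
      by metis
    define r where "r k = k + (\<Sum>i\<le>k. N i)" for k
    have "strict_mono r" by (rule strict_mono_Suc_iff[THEN iffD2]) (simp add: r_def)
    moreover have "N k \<le> r k" for k
      using member_le_sum[of k "{..k}" N] by (simp add: r_def)
    ultimately show ?thesis using N by (meson le_trans)
  qed
  then obtain r where r: "strict_mono r"
    and rc: "\<And>k i j. r k \<le> i \<Longrightarrow> r k \<le> j \<Longrightarrow> norm (X i - X j) < (1/2)^k" by blast
  define h where "h k = L2_apply (X (r k))" for k
  have h[simp]: "sq_integrable (h k)" for k by (simp add: h_def)
  note [measurable] = h[THEN sq_integrableD]
  have hd: "sq_integrable (\<lambda>t. h i t - h j t)" for i j by (simp add: sq_integrable_diff)
  have nd: "(norm (X (r i) - X (r j)))\<^sup>2 = integral\<^sup>L lborel (\<lambda>t. (norm (h i t - h j t))\<^sup>2)" for i j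
    using norm_abs_L2fun[OF hd[of i j]] by (simp add: abs_L2fun_diff[symmetric] h_def)
  have nn: "(\<integral>\<^sup>+t. ennreal ((norm (h i t - h j t))\<^sup>2) \<partial>lborel) = ennreal ((norm (X (r i) - X (r j)))\<^sup>2)" for i j
    unfolding nd using hd[of i j] by (intro nn_integral_eq_integral) (auto simp: sq_integrable_def)
  have bd: "(norm (X (r i) - X (r j)))\<^sup>2 \<le> (1/4)^k" if "k \<le> i" "k \<le> j" for i j k
  proof -
    have "norm (X (r i) - X (r j)) < (1/2)^k"
      by (rule rc) (use r that in \<open>auto simp: strict_mono_less_eq\<close>)
    then have "(norm (X (r i) - X (r j)))\<^sup>2 \<le> ((1/2)^k)\<^sup>2" by (intro power_mono) auto
    also have "\<dots> = (1/4)^k" by (simp add: power2_eq_square power_mult_distrib[symmetric])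
    finally show ?thesis .
  qed
  define G where "G t = (\<Sum>k. ennreal (2^k * (norm (h (Suc k) t - h k t))\<^sup>2))" for t
  have "(\<integral>\<^sup>+t. G t \<partial>lborel) = (\<Sum>k. \<integral>\<^sup>+t. ennreal (2^k * (norm (h (Suc k) t - h k t))\<^sup>2) \<partial>lborel)"
    unfolding G_def by (rule nn_integral_suminf) measurable
  also have "\<dots> = (\<Sum>k. ennreal (2^k * (norm (X (r (Suc k)) - X (r k)))\<^sup>2))"
    by (simp add: ennreal_mult nn_integral_cmult nn)
  also have "\<dots> \<le> (\<Sum>k. ennreal ((1/2)^k))"
  proof (rule suminf_le)
    show "ennreal (2^k * (norm (X (r (Suc k)) - X (r k)))\<^sup>2) \<le> ennreal ((1/2)^k)" for k
    proof (rule ennreal_leI)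
      have "2^k * (norm (X (r (Suc k)) - X (r k)))\<^sup>2 \<le> 2^k * (1/4)^k"
        by (intro mult_left_mono bd) auto
      also have "\<dots> = (1/2)^k" by (simp add: power_mult_distrib[symmetric])
      finally show "2^k * (norm (X (r (Suc k)) - X (r k)))\<^sup>2 \<le> (1/2)^k" .
    qed
  qed auto
  also have "\<dots> = ennreal (\<Sum>k. (1/2)^k)"
    by (rule suminf_ennreal2) (auto intro!: summable_geometric)
  finally have "(\<integral>\<^sup>+t. G t \<partial>lborel) \<noteq> \<infinity>" by (auto simp: top_unique)
  then have AEG: "AE t in lborel. G t \<noteq> \<infinity>"
    by (intro nn_integral_noteq_infinite) (auto simp: G_def)
  have conv: "convergent (\<lambda>k. h k t)" if "G t \<noteq> \<infinity>" for t
  proof -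
    let ?a = "\<lambda>k. 2^k * (norm (h (Suc k) t - h k t))\<^sup>2"
    have "summable ?a" using that unfolding G_def
      by (intro summable_suminf_not_top) (auto simp: infinity_ennreal_def)
    then have sm: "summable (\<lambda>k. ?a k + (1/2)^k)"
      by (intro summable_add summable_geometric) auto
    have le: "norm (h (Suc k) t - h k t) \<le> ?a k + (1/2)^k" for k
    proof -
      define n where "n = norm (h (Suc k) t - h k t)"
      define p where "p = (2::real)^k"
      have p: "p > 0" by (simp add: p_def)
      have "0 \<le> (p * n - 1)\<^sup>2 + p * n" using p by (simp add: n_def)
      then have "p * n \<le> p * (p * n\<^sup>2 + 1/p)"
        using p by (simp add: power2_eq_square algebra_simps)
      then have "n \<le> p * n\<^sup>2 + 1/p" using p by simp
      then show ?thesis by (simp add: n_def p_def power_divide)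
    qed
    have "summable (\<lambda>k. h (Suc k) t - h k t)"
      by (rule summable_comparison_test'[OF sm, of 0]) (use le in auto)
    moreover have "(\<Sum>k<n. h (Suc k) t - h k t) = h n t - h 0 t" for n
      by (rule sum_lessThan_telescope)
    ultimately have "convergent (\<lambda>k. h k t - h 0 t)"
      by (simp only: summable_iff_convergent)
    then have "convergent (\<lambda>k. (h k t - h 0 t) + h 0 t)"
      by (intro convergent_add convergent_const)
    then show ?thesis by simp
  qed
  define g where "g t = (if G t \<noteq> \<infinity> then lim (\<lambda>k. h k t) else 0)" for t
  have Gm[measurable]: "G \<in> borel_measurable borel" unfolding G_def by measurable
  have lim: "(\<lambda>k. if G t \<noteq> \<infinity> then h k t else 0) \<longlonglongrightarrow> g t" for t
    using conv[of t] by (auto simp: g_def convergent_LIMSEQ_iff)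
  have g[measurable]: "g \<in> borel_measurable borel"
    by (rule borel_measurable_LIMSEQ_metric[OF _ lim]) measurable
  have AElim: "AE t in lborel. (\<lambda>k. h k t) \<longlonglongrightarrow> g t"
    using AEG 
  proof eventually_elim
    case (elim t)
    then show ?case using lim[of t] by simp
  qed
  have fat: "(\<integral>\<^sup>+t. ennreal ((norm (g t - h i t))\<^sup>2) \<partial>lborel) \<le> ennreal ((1/4)^i)" for i
  proof -
    have "(\<integral>\<^sup>+t. ennreal ((norm (g t - h i t))\<^sup>2) \<partial>lborel)
        = (\<integral>\<^sup>+t. liminf (\<lambda>j. ennreal ((norm (h j t - h i t))\<^sup>2)) \<partial>lborel)"
    proof (rule nn_integral_cong_AE)
      show "AE t in lborel. ennreal ((norm (g t - h i t))\<^sup>2) = liminf (\<lambda>j. ennreal ((norm (h j t - h i t))\<^sup>2))"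
        using AElim
      proof eventually_elim
        case (elim t)
        have "(\<lambda>j. ennreal ((norm (h j t - h i t))\<^sup>2)) \<longlonglongrightarrow> ennreal ((norm (g t - h i t))\<^sup>2)"
          by (intro tendsto_ennrealI tendsto_power tendsto_norm tendsto_diff elim tendsto_const)
        from lim_imp_Liminf[OF _ this] show ?case by simp
      qed
    qed
    also have "\<dots> \<le> liminf (\<lambda>j. \<integral>\<^sup>+t. ennreal ((norm (h j t - h i t))\<^sup>2) \<partial>lborel)"
      by (rule nn_integral_liminf) measurable
    also have "\<dots> \<le> ennreal ((1/4)^i)"
    proof (rule Liminf_le)
      show "\<forall>\<^sub>F j in sequentially. (\<integral>\<^sup>+t. ennreal ((norm (h j t - h i t))\<^sup>2) \<partial>lborel) \<le> ennreal ((1/4)^i)"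
        using eventually_ge_at_top[of i]
        by eventually_elim (auto simp: nn intro!: ennreal_leI bd)
    qed simp
    finally show ?thesis .
  qed
  have gh: "sq_integrable (\<lambda>t. g t - h i t)" for i
    unfolding sq_integrable_def
    by (auto intro!: integrableI_bounded le_less_trans[OF fat])
  have gi: "sq_integrable g"
    using sq_integrable_add[OF gh[of 0] h[of 0]] by simp
  have close: "(norm (abs_L2fun g - X (r i)))\<^sup>2 \<le> (1/4)^i" for i
  proof -
    have "(norm (abs_L2fun g - X (r i)))\<^sup>2 = integral\<^sup>L lborel (\<lambda>t. (norm (g t - h i t))\<^sup>2)"
      using norm_abs_L2fun[OF gh[of i]] gi by (simp add: abs_L2fun_diff[symmetric] h_def)
    moreover have "ennreal (integral\<^sup>L lborel (\<lambda>t. (norm (g t - h i t))\<^sup>2)) \<le> ennreal ((1/4)^i)"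
      using fat[of i] gh[of i] by (subst nn_integral_eq_integral[symmetric]) (auto simp: sq_integrable_def)
    ultimately show ?thesis by (simp add: ennreal_le_iff)
  qed
  have "(\<lambda>i. (norm (abs_L2fun g - X (r i)))\<^sup>2) \<longlonglongrightarrow> 0"
    by (rule tendsto_sandwich[of "\<lambda>_. 0" _ _ "\<lambda>i. (1/4)^i"])
      (use close in \<open>auto intro!: LIMSEQ_power_zero\<close>)
  then have "(\<lambda>i. sqrt ((norm (abs_L2fun g - X (r i)))\<^sup>2)) \<longlonglongrightarrow> sqrt 0"
    by (intro tendsto_real_sqrt)
  then have "(\<lambda>i. norm (X (r i) - abs_L2fun g)) \<longlonglongrightarrow> 0" by (simp add: norm_minus_commute)
  then have "(X \<circ> r) \<longlonglongrightarrow> abs_L2fun g"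
    by (simp add: LIM_zero_iff tendsto_norm_zero_iff comp_def)
  then have "X \<longlonglongrightarrow> abs_L2fun g"
    using Cauchy_converges_subseq[OF X r] by blast
  then show "convergent X" by (auto simp: convergent_def)
qed

subsection \<open>Separability\<close>

lemma countable_dense_imp_basis:
  fixes D :: "'a::metric_space set"
  assumes "countable D" and dense: "closure D = UNIV"
  shows "\<exists>B::'a set set. countable B \<and> open = generate_topology B"
proof -
  define B where "B = (\<lambda>(d, n). ball d (inverse (real (Suc n)))) ` (D \<times> UNIV)"
  have "countable B" unfolding B_def using assms(1) by (intro countable_image) auto
  moreover have "topological_basis B"
  proof (rule topological_basisI)
    show "\<And>b. b \<in> B \<Longrightarrow> open b" by (auto simp: B_def)
    fix U :: "'a set" and x assume "open U" "x \<in> U"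
    then obtain e where e: "e > 0" "ball x e \<subseteq> U" by (auto simp: open_contains_ball)
    obtain n where n: "inverse (real (Suc n)) < e / 2"
      using reals_Archimedean[of "e/2"] e by auto
    have "x \<in> closure D" using dense by auto
    then obtain d where d: "d \<in> D" "dist d x < inverse (real (Suc n))"
      unfolding closure_approachable by (meson inverse_positive_iff_positive of_nat_0_less_iff zero_less_Suc)
    have "ball d (inverse (real (Suc n))) \<subseteq> ball x e"
    proof
      fix y assume "y \<in> ball d (inverse (real (Suc n)))"
      then have "dist x y < e" using d(2) n dist_triangle[of x y d] by (auto simp: dist_commute)
      then show "y \<in> ball x e" by simp
    qed
    then show "\<exists>b\<in>B. x \<in> b \<and> b \<subseteq> U"
      using d e by (intro bexI[of _ "ball d (inverse (real (Suc n)))"]) (auto simp: B_def)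
  qed
  ultimately show ?thesis by (blast dest: topological_basis_imp_subbasis)
qed

lemma countable_total_imp_dense:
  fixes B :: "'a::real_normed_vector set"
  assumes "countable B"
  shows "\<exists>D. countable D \<and> B \<subseteq> closure D \<and> subspace (closure D)"
proof -
  define F :: "(rat \<times> 'a) list \<Rightarrow> 'a" where "F xs = (\<Sum>(q, b)\<leftarrow>xs. real_of_rat q *\<^sub>R b)" for xs
  define D where "D = F ` lists (UNIV \<times> B)"
  have "countable D" unfolding D_def using assms by (intro countable_image countable_lists) auto
  have Dadd: "x + y \<in> D" if xy: "x \<in> D" "y \<in> D" for x y
  proof -
    obtain xs where "x = F xs" "xs \<in> lists (UNIV \<times> B)"
      using xy(1) unfolding D_def by (rule imageE)
    moreover obtain ys where "y = F ys" "ys \<in> lists (UNIV \<times> B)"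
      using xy(2) unfolding D_def by (rule imageE)
    ultimately have "x + y = F (xs @ ys)" "xs @ ys \<in> lists (UNIV \<times> B)" by (auto simp: F_def)
    then show ?thesis by (auto simp: D_def)
  qed
  have Dsc: "real_of_rat q *\<^sub>R x \<in> D" if x: "x \<in> D" for q x
  proof -
    obtain xs where xs: "x = F xs" "xs \<in> lists (UNIV \<times> B)" using x unfolding D_def by (rule imageE)
    have "real_of_rat q *\<^sub>R F xs = F (map (\<lambda>(p, b). (q * p, b)) xs)"
      by (induction xs) (auto simp: F_def of_rat_mult scaleR_add_right)
    moreover have "map (\<lambda>(p, b). (q * p, b)) xs \<in> lists (UNIV \<times> B)" using xs(2) by (auto simp: in_lists_conv_set)
    ultimately show ?thesis using xs by (auto simp: D_def)
  qed
  have "B \<subseteq> D"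
  proof
    fix b assume "b \<in> B"
    then have "F [(1, b)] = b" "[(1, b)] \<in> lists (UNIV \<times> B)" by (auto simp: F_def)
    then show "b \<in> D" unfolding D_def by (metis imageI)
  qed
  have "subspace (closure D)"
  proof (rule subspaceI)
    have "F [] \<in> D" unfolding D_def by auto
    then have "0 \<in> D" by (simp add: F_def)
    then show "0 \<in> closure D" using closure_subset by blast
  next
    fix x y assume "x \<in> closure D" "y \<in> closure D"
    then obtain f g where fg: "\<And>n::nat. f n \<in> D" "f \<longlonglongrightarrow> x" "\<And>n::nat. g n \<in> D" "g \<longlonglongrightarrow> y"
      unfolding closure_sequential by blast
    then show "x + y \<in> closure D"
      unfolding closure_sequential by (intro exI[of _ "\<lambda>n. f n + g n"]) (auto intro: Dadd tendsto_add)
  next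
    fix c :: real and x assume "x \<in> closure D"
    then obtain f where f: "\<And>n::nat. f n \<in> D" "f \<longlonglongrightarrow> x" unfolding closure_sequential by blast
    have "c \<in> closure \<rat>" by (simp add: Rats_closure_real)
    then obtain q where q: "\<And>n::nat. q n \<in> \<rat>" "q \<longlonglongrightarrow> c" unfolding closure_sequential by blast
    have "q n *\<^sub>R f n \<in> D" for n
    proof -
      obtain p where "q n = real_of_rat p" using q(1)[of n] by (auto simp: Rats_def)
      then show ?thesis using Dsc[OF f(1)] by simp
    qed
    then show "c *\<^sub>R x \<in> closure D"
      unfolding closure_sequential
      by (intro exI[of _ "\<lambda>n. q n *\<^sub>R f n"]) (auto intro: tendsto_scaleR f q)
  qed
  then show ?thesis using \<open>countable D\<close> \<open>B \<subseteq> D\<close> closure_subset by blast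
qed

lemma sq_integrable_indicator:
  fixes e :: "'b::euclidean_space"
  assumes [measurable]: "A \<in> sets borel" and "A \<subseteq> {- real N..real N}"
  shows "sq_integrable (\<lambda>t. indicator A t *\<^sub>R e)"
proof (rule sq_integrable_bound)
  show "integrable lborel (\<lambda>t. (norm e)\<^sup>2 * indicator {- real N..real N} t)"
    by (intro integrable_mult_right integrable_real_indicator) auto
  show "AE t in lborel. (norm (indicator A t *\<^sub>R e))\<^sup>2 \<le> (norm e)\<^sup>2 * indicator {- real N..real N} t"
    using assms(2) by (intro always_eventually) (auto simp: indicator_def)
qed measurable

instance L2fun :: (euclidean_space) second_countable_topology
proof
  obtain W :: "real set set" where W: "countable W" "topological_basis W"
    using ex_countable_basis by blast
  define E where "E = Inter ` {F. finite F \<and> F \<subseteq> W}"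
  have Wo: "open S" if "S \<in> W" for S using W(2) that by (rule topological_basis_open)
  have Eo: "open S" if "S \<in> E" for S using that Wo by (auto simp: E_def)
  have WE: "W \<subseteq> E"
  proof
    fix S assume "S \<in> W"
    then have "S = \<Inter>{S}" "finite {S}" "{S} \<subseteq> W" by auto
    then show "S \<in> E" unfolding E_def by blast
  qed
  have UE: "UNIV \<in> E" unfolding E_def by (rule image_eqI[of _ _ "{}"]) auto
  have Est: "Int_stable E"
  proof (rule Int_stableI)
    fix A B assume "A \<in> E" "B \<in> E"
    then obtain F G where "A = \<Inter>F" "B = \<Inter>G" "finite F" "finite G" "F \<subseteq> W" "G \<subseteq> W" by (auto simp: E_def)
    then show "A \<inter> B \<in> E" unfolding E_def by (intro image_eqI[of _ _ "F \<union> G"]) auto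
  qed
  have Ec: "countable E" unfolding E_def using W(1) by (intro countable_image countable_Collect_finite_subset)
  have sigE: "sigma_sets UNIV E = sets borel"
  proof
    show "sigma_sets UNIV E \<subseteq> sets borel"
      using sets.sigma_sets_subset[of E borel] Eo by (auto simp: subset_iff)
    have "sets borel = sigma_sets UNIV W"
      by (subst borel_eq_countable_basis[OF W]) (simp add: sets_measure_of)
    also have "\<dots> \<subseteq> sigma_sets UNIV E" by (rule sigma_sets_mono') (rule WE)
    finally show "sets borel \<subseteq> sigma_sets UNIV E" .
  qed
  define ind :: "real set \<Rightarrow> nat \<Rightarrow> 'a \<Rightarrow> 'a L2fun"
    where "ind A N e = abs_L2fun (\<lambda>t. indicator (A \<inter> {- real N..real N}) t *\<^sub>R e)" for A N e
  define B where "B = (\<lambda>(A, N, e). ind A N e) ` (E \<times> UNIV \<times> (Basis :: 'a set))"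
  have "countable B" unfolding B_def
    by (intro countable_image countable_SIGMA Ec countableI_type countable_finite finite_Basis)
  then obtain D where D: "countable D" "B \<subseteq> closure D" "subspace (closure D)"
    using countable_total_imp_dense by blast
  have indE: "ind A N e \<in> closure D" if "A \<in> E" "e \<in> Basis" for A N e
  proof -
    have "ind A N e \<in> B"
      unfolding B_def by (rule image_eqI[of _ _ "(A, N, e)"]) (use that in auto)
    then show ?thesis using D(2) by blast
  qed
  have ind_in: "ind A N e \<in> closure D" if "A \<in> sets borel" "e \<in> Basis" for A N e
  proof -
    have "A \<in> sigma_sets UNIV E" using that sigE by simp
    have "E \<subseteq> Pow UNIV" by simp
    from Est this \<open>A \<in> sigma_sets UNIV E\<close> show ?thesis
    proof (induction rule: sigma_sets_induct_disjoint)
      fix A assume "A \<in> E"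
      then show "ind A N e \<in> closure D" using indE that by blast
    next
      show "ind {} N e \<in> closure D"
        using D(3) by (simp add: ind_def abs_L2fun_zero subspace_0)
    next
      fix A assume A: "A \<in> sigma_sets UNIV E" and IH: "ind A N e \<in> closure D"
      have [measurable]: "A \<in> sets borel" using A sigE by simp
      have eq: "(\<lambda>t. indicator (UNIV \<inter> {- real N..real N}) t *\<^sub>R e - indicator (A \<inter> {- real N..real N}) t *\<^sub>R e)
          = (\<lambda>t. indicator ((UNIV - A) \<inter> {- real N..real N}) t *\<^sub>R e)"
        by (auto simp: indicator_def fun_eq_iff)
      have "ind UNIV N e - ind A N e = ind (UNIV - A) N e"
        unfolding ind_def eq[symmetric]
        by (intro abs_L2fun_diff sq_integrable_indicator[of _ N]) auto
      then have "ind (UNIV - A) N e = ind UNIV N e - ind A N e" ..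
      moreover have "ind UNIV N e \<in> closure D" using indE UE that by blast
      ultimately show "ind (UNIV - A) N e \<in> closure D" using IH D(3) by (simp add: subspace_diff)
    next
      fix A :: "nat \<Rightarrow> real set"
      assume dis: "disjoint_family A" and A: "range A \<subseteq> sigma_sets UNIV E"
        and IH: "\<And>i. ind (A i) N e \<in> closure D"
      have Am[measurable]: "A i \<in> sets borel" for i using A sigE by auto
      have "(\<lambda>k. ind (\<Union>i<k. A i) N e) \<longlonglongrightarrow> ind (\<Union>i. A i) N e"
        unfolding ind_def
      proof (rule tendsto_abs_L2fun)
        show "sq_integrable (\<lambda>t. indicator ((\<Union>i<k. A i) \<inter> {- real N..real N}) t *\<^sub>R e)" for k
          by (rule sq_integrable_indicator) auto
        show "sq_integrable (\<lambda>t. indicator ((\<Union>i. A i) \<inter> {- real N..real N}) t *\<^sub>R e)"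
          by (rule sq_integrable_indicator) auto
        show "sq_integrable (\<lambda>t. indicator {- real N..real N} t *\<^sub>R norm e)"
          by (rule sq_integrable_indicator) auto
        show "norm (indicator ((\<Union>i<k. A i) \<inter> {- real N..real N}) t *\<^sub>R e)
            \<le> indicator {- real N..real N} t *\<^sub>R norm e" for k t
          by (auto simp: indicator_def)
        show "(\<lambda>k. indicator ((\<Union>i<k. A i) \<inter> {- real N..real N}) t *\<^sub>R e)
            \<longlonglongrightarrow> indicator ((\<Union>i. A i) \<inter> {- real N..real N}) t *\<^sub>R e" for t
        proof (cases "\<exists>j. t \<in> A j")
          case True
          then obtain j where j: "t \<in> A j" by blast
          show ?thesis
          proof (rule tendsto_eventually)
            show "\<forall>\<^sub>F k in sequentially. indicator ((\<Union>i<k. A i) \<inter> {- real N..real N}) t *\<^sub>R e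
                = indicator ((\<Union>i. A i) \<inter> {- real N..real N}) t *\<^sub>R e"
              using eventually_gt_at_top[of j] by eventually_elim (use j in \<open>auto simp: indicator_def\<close>)
          qed
        qed (auto simp: indicator_def)
      qed
      moreover have "ind (\<Union>i<k. A i) N e \<in> closure D" for k
      proof -
        have "ind (\<Union>i<k. A i) N e = (\<Sum>i<k. ind (A i) N e)"
        proof -
          have "(\<lambda>t. indicator ((\<Union>i<k. A i) \<inter> {- real N..real N}) t *\<^sub>R e)
              = (\<lambda>t. \<Sum>i<k. indicator (A i \<inter> {- real N..real N}) t *\<^sub>R e)"
          proof
            fix t
            have "disjoint_family_on (\<lambda>i. A i \<inter> {- real N..real N}) {..<k}"
              using dis by (auto simp: disjoint_family_on_def)
            then have "indicator (\<Union>i<k. A i \<inter> {- real N..real N}) t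
                = (\<Sum>i<k. indicator (A i \<inter> {- real N..real N}) t :: real)"
              by (intro indicator_UN_disjoint) auto
            moreover have "(\<Union>i<k. A i) \<inter> {- real N..real N} = (\<Union>i<k. A i \<inter> {- real N..real N})" by auto
            ultimately show "indicator ((\<Union>i<k. A i) \<inter> {- real N..real N}) t *\<^sub>R e
              = (\<Sum>i<k. indicator (A i \<inter> {- real N..real N}) t *\<^sub>R e)"
              by (simp only: scaleR_sum_left)
          qed
          then show ?thesis unfolding ind_def
            by (subst abs_L2fun_sum[symmetric]) (auto intro!: sq_integrable_indicator[of _ N])
        qed
        then show ?thesis using D(3) IH by (simp add: subspace_sum)
      qed
      ultimately show "ind (\<Union>(range A)) N e \<in> closure D"
        using closed_sequentially[OF closed_closure, where f="\<lambda>k. ind (\<Union>i<k. A i) N e"] by metis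
    qed
  qed
  have "u \<in> closure D" for u :: "'a L2fun"
  proof -
    define f where "f = L2_apply u"
    have f: "sq_integrable f" by (simp add: f_def)
    obtain s where s: "\<And>i. simple_function lborel (s i)" "\<And>t. (\<lambda>i. s i t) \<longlonglongrightarrow> f t"
      "\<And>i t. norm (s i t) \<le> 2 * norm (f t)"
      using borel_measurable_implies_sequence_metric[of f lborel 0] f
      by (auto simp: sq_integrable_def)
    define s' where "s' i t = indicator {- real i..real i} t *\<^sub>R s i t" for i t
    have [measurable]: "s i \<in> borel_measurable borel" for i
      using borel_measurable_simple_function[OF s(1)] by simp
    have pre[measurable]: "s i -` {y} \<in> sets borel" for i y
      using measurable_sets[of "s i" borel borel "{y}"] by simp
    have fin: "finite (range (s i))" for i using s(1)[of i] by (simp add: simple_function_def)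
    have rep: "s' i = (\<lambda>t. \<Sum>y\<in>range (s i). \<Sum>e\<in>Basis.
        (y \<bullet> e) *\<^sub>R indicator (s i -` {y} \<inter> {- real i..real i}) t *\<^sub>R e)" for i
    proof
      fix t
      have "(\<Sum>y\<in>range (s i). \<Sum>e\<in>Basis. (y \<bullet> e) *\<^sub>R indicator (s i -` {y} \<inter> {- real i..real i}) t *\<^sub>R e)
         = (\<Sum>y\<in>range (s i). if y = s i t then s' i t else 0)"
      proof (intro sum.cong refl)
        fix y assume "y \<in> range (s i)"
        show "(\<Sum>e\<in>Basis. (y \<bullet> e) *\<^sub>R indicator (s i -` {y} \<inter> {- real i..real i}) t *\<^sub>R e)
            = (if y = s i t then s' i t else 0)"
          by (auto simp: s'_def indicator_def euclidean_representation)
      qed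
      also have "\<dots> = s' i t" using fin by simp
      finally show "s' i t = (\<Sum>y\<in>range (s i). \<Sum>e\<in>Basis.
        (y \<bullet> e) *\<^sub>R indicator (s i -` {y} \<inter> {- real i..real i}) t *\<^sub>R e)" by simp
    qed
    have si: "sq_integrable (\<lambda>t. indicator (s i -` {y} \<inter> {- real i..real i}) t *\<^sub>R e)" for i y and e :: 'a
      by (rule sq_integrable_indicator[of _ i]) auto
    have "abs_L2fun (s' i) = (\<Sum>y\<in>range (s i). \<Sum>e\<in>Basis. (y \<bullet> e) *\<^sub>R ind (s i -` {y}) i e)" for i
      unfolding rep ind_def
      by (simp add: abs_L2fun_sum abs_L2fun_scaleR si sq_integrable_sum sq_integrable_scaleR del: scaleR_scaleR)
    then have s'D: "abs_L2fun (s' i) \<in> closure D" for i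
      using D(3) ind_in pre by (auto intro!: subspace_sum subspace_scale)
    have "(\<lambda>i. abs_L2fun (s' i)) \<longlonglongrightarrow> abs_L2fun f"
    proof (rule tendsto_abs_L2fun)
      show "sq_integrable (s' i)" for i unfolding rep
        by (intro sq_integrable_sum sq_integrable_scaleR si)
      show "sq_integrable f" by fact
      show "sq_integrable (\<lambda>t. 2 * norm (f t))"
        using f by (auto simp: sq_integrable_def power_mult_distrib)
      show "norm (s' i t) \<le> 2 * norm (f t)" for i t
        using s(3)[of i t] by (auto simp: s'_def indicator_def)
      show "(\<lambda>i. s' i t) \<longlonglongrightarrow> f t" for t
      proof (rule Lim_transform_eventually[OF s(2)])
        obtain n where n: "\<bar>t\<bar> \<le> real n" using real_arch_simple by blast
        show "\<forall>\<^sub>F i in sequentially. s i t = s' i t"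
          using eventually_ge_at_top[of n]
        proof eventually_elim
          case (elim i)
          then have "\<bar>t\<bar> \<le> real i" using n by simp
          then show ?case by (auto simp: s'_def indicator_def)
        qed
      qed
    qed
    then have "abs_L2fun f \<in> closure D"
      using closed_sequentially[OF closed_closure, where f="\<lambda>i. abs_L2fun (s' i)"] s'D by metis
    then show ?thesis by (simp add: f_def)
  qed
  then have "closure D = UNIV" by auto
  with D(1) show "\<exists>B::'a L2fun set set. countable B \<and> open = generate_topology B"
    by (rule countable_dense_imp_basis)
qed

section \<open>Function spaces on the time interval\<close>

abbreviation leb :: "real \<Rightarrow> real measure" where
  "leb T \<equiv> restrict_space lborel {0<..<T}"

text \<open>
  The space \<open>L\<^sup>2(0,T)\<close> is the closed subspace of functions on the line that vanish a.e. outside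
  \<open>(0,T)\<close>. It carries the induced norm, and Bochner integrals of functions with values in it stay
  in it.
\<close>

definition L2_on :: "real \<Rightarrow> 'b::euclidean_space L2fun set" where
  "L2_on T = {u. AE t in lborel. t \<notin> {0<..<T} \<longrightarrow> L2_apply u t = 0}"

text \<open>
  An element of \<open>H\<^sup>1(0,T)\<close> is identified with its continuous representative: it is a primitive of
  its \<open>L\<^sup>2\<close> derivative. It is extended from \<open>[0,T]\<close> to the line by its end-point values, so
  that the norm of the type of bounded continuous functions is the supremum norm on \<open>[0,T]\<close>.
\<close>

definition H1_deriv ::
  "real \<Rightarrow> (real \<Rightarrow>\<^sub>C 'b::euclidean_space) \<Rightarrow> 'b L2fun \<Rightarrow> bool" where
  "H1_deriv T \<gamma> \<gamma>' \<longleftrightarrow>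
    (\<forall>t. \<gamma> t = \<gamma> (max 0 (min T t))) \<and> \<gamma>' \<in> L2_on T \<and>
    (\<forall>t\<in>{0..T}. \<gamma> t = \<gamma> 0 + (LINT s:{0..t}|lborel. L2_apply \<gamma>' s))"

definition H1 :: "real \<Rightarrow> (real \<Rightarrow>\<^sub>C 'b::euclidean_space) set" where
  "H1 T = {\<gamma>. \<exists>\<gamma>'. H1_deriv T \<gamma> \<gamma>'}"

(* the H^1 norm of y, whose derivative is y' *)
definition H1_norm :: "real \<Rightarrow> (real \<Rightarrow>\<^sub>C 'b::euclidean_space) \<Rightarrow> 'b L2fun \<Rightarrow> real" where
  "H1_norm T y y' = sqrt ((LINT t|leb T. (norm (y t))\<^sup>2) + (norm y')\<^sup>2)"

definition Linf_norm :: "real \<Rightarrow> (real \<Rightarrow> 'b::real_normed_vector) \<Rightarrow> ereal" where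
  "Linf_norm T w = esssup (leb T) (\<lambda>t. ereal (norm (w t)))"

definition Linf :: "real \<Rightarrow> (real \<Rightarrow> 'b::euclidean_space) set" where
  "Linf T = {w. w \<in> borel_measurable (leb T) \<and> Linf_norm T w < \<infinity>}"

text \<open>
  For a control in \<open>L\<^sup>2\<close> the running cost is bounded below by an integrable function but may fail to
  be integrable, so costs are extended real valued: the Lebesgue integral of a measurable function whose negative part is integrable, with value
  \<open>\<infinity>\<close> if the positive part is not.
\<close>

definition ereal_integral :: "'a measure \<Rightarrow> ('a \<Rightarrow> real) \<Rightarrow> ereal" where
  "ereal_integral M h =
    enn2ereal (\<integral>\<^sup>+x. ennreal (h x) \<partial>M) - enn2ereal (\<integral>\<^sup>+x. ennreal (- h x) \<partial>M)"

section \<open>Derivatives and convexity\<close>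

definition fderiv ::
  "('a::euclidean_space \<Rightarrow> 'b::real_normed_vector) \<Rightarrow> 'a \<Rightarrow> 'a \<Rightarrow>\<^sub>L 'b" where
  "fderiv f x = Blinfun (frechet_derivative f (at x))"

definition C1 :: "('a::euclidean_space \<Rightarrow> 'b::real_normed_vector) \<Rightarrow> bool" where
  "C1 f \<longleftrightarrow> (\<forall>x. f differentiable (at x)) \<and> continuous_on UNIV (fderiv f)"

definition C2 :: "('a::euclidean_space \<Rightarrow> 'b::real_normed_vector) \<Rightarrow> bool" where
  "C2 f \<longleftrightarrow> C1 f \<and> C1 (fderiv f)"

abbreviation fderiv_x ::
  "('a::euclidean_space \<times> 'b::euclidean_space \<Rightarrow> 'c::real_normed_vector)
    \<Rightarrow> 'a \<Rightarrow> 'b \<Rightarrow> 'a \<Rightarrow>\<^sub>L 'c" where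
  "fderiv_x h x v \<equiv> fderiv (\<lambda>x. h (x, v)) x"

abbreviation fderiv_v ::
  "('a::euclidean_space \<times> 'b::euclidean_space \<Rightarrow> 'c::real_normed_vector)
    \<Rightarrow> 'a \<Rightarrow> 'b \<Rightarrow> 'b \<Rightarrow>\<^sub>L 'c" where
  "fderiv_v h x v \<equiv> fderiv (\<lambda>v. h (x, v)) v"

definition strongly_convex :: "real \<Rightarrow> ('a::real_normed_vector \<Rightarrow> real) \<Rightarrow> bool" where
  "strongly_convex \<alpha> h \<longleftrightarrow>
    (\<forall>u v. \<forall>s\<in>{0..1}.
      h ((1 - s) *\<^sub>R u + s *\<^sub>R v)
        \<le> (1 - s) * h u + s * h v - \<alpha> / 2 * s * (1 - s) * (norm (u - v))\<^sup>2)"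

section \<open>Probability measures\<close>

text \<open>
  Borel probability measures with finite first moment on a subset \<open>S\<close> of a normed space; the
  trace of the Borel \<open>\<sigma>\<close>-algebra is the Borel \<open>\<sigma>\<close>-algebra of the metric space \<open>S\<close>.
\<close>

definition P1 :: "'a::real_normed_vector set \<Rightarrow> 'a measure set" where
  "P1 S = {\<mu>. sets \<mu> = sets (restrict_space borel S) \<and> prob_space \<mu> \<and> integrable \<mu> norm}"

definition narrow :: "'a::real_normed_vector measure topology" where
  "narrow = topology_generated_by
    {{\<mu> \<in> P1 UNIV. (LINT x|\<mu>. \<phi> x) \<in> V} | (\<phi> :: 'a \<Rightarrow> real) V.
      continuous_on UNIV \<phi> \<and> bounded (range \<phi>) \<and> open V}"

definition supp :: "'a::topological_space measure \<Rightarrow> 'a set" where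
  "supp \<mu> = {x \<in> space \<mu>. \<forall>V. open V \<and> x \<in> V \<longrightarrow> emeasure \<mu> (V \<inter> space \<mu>) > 0}"

definition curves :: "real \<Rightarrow> (real \<Rightarrow> 'a::real_normed_vector measure) set" where
  "curves T = {m. continuous_map (top_of_set {0..T}) narrow m}"

text \<open>
  Since \<open>\<phi>(\<cdot>, m)\<close> may be unbounded, the integral against \<open>m1 - m2\<close> need not exist for all
  pairs of measures; monotonicity is tested on the pairs for which it does (otherwise Bochner's
  default value 0 would interfere).
\<close>

definition mono_meas :: "('a::real_normed_vector \<Rightarrow> 'a measure \<Rightarrow> real) \<Rightarrow> bool" where
  "mono_meas \<phi> \<longleftrightarrow>
    (\<forall>m1\<in>P1 UNIV. \<forall>m2\<in>P1 UNIV.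
      integrable m1 (\<lambda>x. \<phi> x m1 - \<phi> x m2) \<and> integrable m2 (\<lambda>x. \<phi> x m1 - \<phi> x m2) \<longrightarrow>
      (LINT x|m1. \<phi> x m1 - \<phi> x m2) - (LINT x|m2. \<phi> x m1 - \<phi> x m2) \<ge> 0)"

definition strict_mono_meas :: "('a::real_normed_vector \<Rightarrow> 'a measure \<Rightarrow> real) \<Rightarrow> bool" where
  "strict_mono_meas \<phi> \<longleftrightarrow> mono_meas \<phi> \<and>
    (\<forall>m1\<in>P1 UNIV. \<forall>m2\<in>P1 UNIV.
      integrable m1 (\<lambda>x. \<phi> x m1 - \<phi> x m2) \<and> integrable m2 (\<lambda>x. \<phi> x m1 - \<phi> x m2) \<longrightarrow>
      ((LINT x|m1. \<phi> x m1 - \<phi> x m2) - (LINT x|m2. \<phi> x m1 - \<phi> x m2) = 0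
        \<longleftrightarrow> (\<forall>x. \<phi> x m1 = \<phi> x m2)))"

section \<open>The control problem\<close>

type_synonym ('n, 'm) pair = "(real \<Rightarrow>\<^sub>C (real^'n)) \<times> (real^'m) L2fun"

definition pairs :: "real \<Rightarrow> ('n::finite, 'm::finite) pair set" where
  "pairs T = H1 T \<times> L2_on T"

definition admissible ::
  "real \<Rightarrow> (real^'n::finite \<Rightarrow> real^'n) \<Rightarrow> (real^'n \<Rightarrow> real^'m::finite^'n)
    \<Rightarrow> ((real^'n) \<times> (real^'m) \<Rightarrow> real^'nc::finite)
    \<Rightarrow> (real^'n \<Rightarrow> real^'g1::finite) \<Rightarrow> (real^'n \<Rightarrow> real^'g2::finite)
    \<Rightarrow> real^'n \<Rightarrow> ('n, 'm) pair set" where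
  "admissible T a b c g1 g2 x0 =
    {(\<gamma>, v). \<gamma> \<in> H1 T \<and> v \<in> L2_on T \<and>
      (\<exists>\<gamma>'. H1_deriv T \<gamma> \<gamma>' \<and>
        (AE t in leb T. L2_apply \<gamma>' t = a (\<gamma> t) + b (\<gamma> t) *v L2_apply v t)) \<and>
      (AE t in leb T. c (\<gamma> t, L2_apply v t) \<le> 0) \<and>
      \<gamma> 0 = x0 \<and> g1 (\<gamma> T) = 0 \<and> g2 (\<gamma> T) \<le> 0}"

definition cost ::
  "real \<Rightarrow> ((real^'n::finite) \<times> (real^'m::finite) \<Rightarrow> real)
    \<Rightarrow> (real^'n \<Rightarrow> (real^'n) measure \<Rightarrow> real) \<Rightarrow> (real^'n \<Rightarrow> (real^'n) measure \<Rightarrow> real)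
    \<Rightarrow> (real \<Rightarrow> (real^'n) measure) \<Rightarrow> (real \<Rightarrow> real^'m) \<Rightarrow> ('n, 'm) pair \<Rightarrow> ereal" where
  "cost T L f g0 m P = (\<lambda>(\<gamma>, v).
    ereal_integral (leb T)
      (\<lambda>t. L (\<gamma> t, L2_apply v t) + P t \<bullet> L2_apply v t + f (\<gamma> t) (m t))
    + ereal (g0 (\<gamma> T) (m T)))"

definition V_hull ::
  "((real^'n::finite) \<times> (real^'m::finite) \<Rightarrow> real^'nc::finite) \<Rightarrow> real
    \<Rightarrow> ((real^'n) \<times> (real^'m)) set" where
  "V_hull c R = convex hull {(x, v). norm x \<le> R \<and> c (x, v) \<le> 0}"

definition linearized ::
  "real \<Rightarrow> (real^'n::finite \<Rightarrow> real^'n) \<Rightarrow> (real^'n \<Rightarrow> real^'m::finite^'n)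
    \<Rightarrow> (real \<Rightarrow>\<^sub>C (real^'n)) \<Rightarrow> (real^'m) L2fun
    \<Rightarrow> (real \<Rightarrow>\<^sub>C (real^'n)) \<Rightarrow> (real^'n) L2fun \<Rightarrow> (real \<Rightarrow> real^'m) \<Rightarrow> bool" where
  "linearized T a b \<gamma> v y y' w \<longleftrightarrow>
    H1_deriv T y y' \<and> w \<in> Linf T \<and> y 0 = 0 \<and>
    (AE t in leb T. L2_apply y' t =
      fderiv a (\<gamma> t) (y t)
      + (\<Sum>i\<in>UNIV. (L2_apply v t $ i) *\<^sub>R fderiv (\<lambda>x. column i (b x)) (\<gamma> t) (y t))
      + b (\<gamma> t) *v w t)"

section \<open>Standing assumptions\<close>

definition convexity ::
  "((real^'n::finite) \<times> (real^'m::finite) \<Rightarrow> real)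
    \<Rightarrow> ((real^'n) \<times> (real^'m) \<Rightarrow> real^'nc::finite) \<Rightarrow> (real^'m \<Rightarrow> real^'m) \<Rightarrow> bool" where
  "convexity L c \<psi> \<longleftrightarrow>
    (\<exists>C>0. (\<forall>x. strongly_convex (1 / C) (\<lambda>v. L (x, v))) \<and>
      (\<forall>x v. L (x, v) \<ge> (1 / C) * (norm v)\<^sup>2 - C)) \<and>
    (\<forall>x i. convex_on UNIV (\<lambda>v. c (x, v) $ i)) \<and>
    (\<forall>x y. (\<psi> y - \<psi> x) \<bullet> (y - x) \<ge> 0)"

definition regularity ::
  "(real^'n::finite \<Rightarrow> real^'n) \<Rightarrow> (real^'n \<Rightarrow> real^'m::finite^'n)
    \<Rightarrow> ((real^'n) \<times> (real^'m) \<Rightarrow> real^'nc::finite)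
    \<Rightarrow> (real^'n \<Rightarrow> real^'g1::finite) \<Rightarrow> (real^'n \<Rightarrow> real^'g2::finite)
    \<Rightarrow> ((real^'n) \<times> (real^'m) \<Rightarrow> real)
    \<Rightarrow> (real^'n \<Rightarrow> (real^'n) measure \<Rightarrow> real) \<Rightarrow> (real^'n \<Rightarrow> (real^'n) measure \<Rightarrow> real)
    \<Rightarrow> (real^'m \<Rightarrow> real^'m) \<Rightarrow> bool" where
  "regularity a b c g1 g2 L f g0 \<psi> \<longleftrightarrow>
    C2 L \<and> C2 c \<and> C1 a \<and> C1 b \<and> C1 g1 \<and> C1 g2 \<and>
    (\<forall>h\<in>{f, g0}.
      (\<forall>\<mu>\<in>P1 UNIV. C1 (\<lambda>x. h x \<mu>)) \<and>
      continuous_map (prod_topology euclidean narrow) euclidean (\<lambda>(x, \<mu>). h x \<mu>) \<and>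
      continuous_map (prod_topology euclidean narrow) euclidean
        (\<lambda>(x, \<mu>). fderiv (\<lambda>x. h x \<mu>) x)) \<and>
    continuous_on UNIV \<psi>"

definition growth ::
  "real \<Rightarrow> (real^'n::finite \<Rightarrow> real^'n) \<Rightarrow> (real^'n \<Rightarrow> real^'m::finite^'n)
    \<Rightarrow> ((real^'n) \<times> (real^'m) \<Rightarrow> real^'nc::finite)
    \<Rightarrow> (real^'n \<Rightarrow> real^'g1::finite) \<Rightarrow> (real^'n \<Rightarrow> real^'g2::finite)
    \<Rightarrow> ((real^'n) \<times> (real^'m) \<Rightarrow> real)
    \<Rightarrow> (real^'n \<Rightarrow> (real^'n) measure \<Rightarrow> real) \<Rightarrow> (real^'n \<Rightarrow> (real^'n) measure \<Rightarrow> real)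
    \<Rightarrow> (real^'m \<Rightarrow> real^'m) \<Rightarrow> (real^'n) measure \<Rightarrow> bool" where
  "growth T a b c g1 g2 L f g0 \<psi> m0 \<longleftrightarrow>
    (\<forall>R>0. \<exists>C>0. \<forall>(x, v)\<in>V_hull c R.
      norm (fderiv_x L x v) \<le> C * (1 + (norm v)\<^sup>2) \<and>
      norm (fderiv_v L x v) \<le> C * (1 + norm v)) \<and>
    (\<forall>R>0. \<exists>C>0.
      \<forall>(x, v)\<in>{p + q |p q. p \<in> V_hull c R \<and> q \<in> cball 0 1}.
      \<forall>(x', v')\<in>{p + q |p q. p \<in> V_hull c R \<and> q \<in> cball 0 1}.
        norm (fderiv_x c x v) + norm (fderiv_v c x v) \<le> C \<and>
        norm (fderiv_v c x v - fderiv_v c x' v') \<le> C * norm ((x, v) - (x', v'))) \<and>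
    (\<exists>C>0. \<forall>x. norm (a x) \<le> C * (1 + norm x) \<and> norm (b x) \<le> C * (1 + norm x)) \<and>
    bounded (supp m0) \<and>
    (\<exists>C>0. \<forall>x0\<in>supp m0. \<forall>m\<in>curves T. \<forall>(\<gamma>, v)\<in>admissible T a b c g1 g2 x0.
      (LINT t|leb T. f (\<gamma> t) (m t)) + g0 (\<gamma> T) (m T) \<ge> - C \<and>
      Linf_norm T (\<lambda>t. fderiv (\<lambda>x. f x (m t)) (\<gamma> t)) \<le> ereal C) \<and>
    bounded (range \<psi>)"

definition feasibility ::
  "real \<Rightarrow> (real^'n::finite \<Rightarrow> real^'n) \<Rightarrow> (real^'n \<Rightarrow> real^'m::finite^'n)
    \<Rightarrow> ((real^'n) \<times> (real^'m) \<Rightarrow> real^'nc::finite)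
    \<Rightarrow> (real^'n \<Rightarrow> real^'g1::finite) \<Rightarrow> (real^'n \<Rightarrow> real^'g2::finite)
    \<Rightarrow> ((real^'n) \<times> (real^'m) \<Rightarrow> real)
    \<Rightarrow> (real^'n \<Rightarrow> (real^'n) measure \<Rightarrow> real) \<Rightarrow> (real^'n \<Rightarrow> (real^'n) measure \<Rightarrow> real)
    \<Rightarrow> (real^'m \<Rightarrow> real^'m) \<Rightarrow> (real^'n) measure \<Rightarrow> bool" where
  "feasibility T a b c g1 g2 L f g0 \<psi> m0 \<longleftrightarrow>
    (\<forall>R>0. \<exists>C>0. \<forall>x\<in>cball 0 R. \<exists>v\<in>cball 0 C. c (x, v) \<le> 0) \<and>
    (\<exists>C>0. \<forall>x0\<in>supp m0. \<forall>m\<in>curves T. \<forall>P\<in>Linf T.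
      m 0 = m0 \<and> Linf_norm T P \<le> ereal (SUP \<theta>. norm (\<psi> \<theta>)) \<longrightarrow>
      (\<exists>p\<in>admissible T a b c g1 g2 x0. cost T L f g0 m P p \<le> ereal C))"

definition qualification ::
  "real \<Rightarrow> (real^'n::finite \<Rightarrow> real^'n) \<Rightarrow> (real^'n \<Rightarrow> real^'m::finite^'n)
    \<Rightarrow> ((real^'n) \<times> (real^'m) \<Rightarrow> real^'nc::finite)
    \<Rightarrow> (real^'n \<Rightarrow> real^'g1::finite) \<Rightarrow> (real^'n \<Rightarrow> real^'g2::finite)
    \<Rightarrow> (real^'n) measure \<Rightarrow> bool" where
  "qualification T a b c g1 g2 m0 \<longleftrightarrow>
    (\<exists>C>0. \<forall>x0\<in>supp m0. \<forall>(\<gamma>, v)\<in>admissible T a b c g1 g2 x0. \<forall>z1.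
      \<exists>y y' w. linearized T a b \<gamma> v y y' w \<and>
        fderiv g1 (\<gamma> T) (y T) = z1 \<and>
        H1_norm T y y' \<le> C * norm z1 \<and> Linf_norm T w \<le> ereal (C * norm z1)) \<and>
    (\<exists>C>0. \<forall>x0\<in>supp m0. \<forall>(\<gamma>, v)\<in>admissible T a b c g1 g2 x0.
      \<exists>y y' w. linearized T a b \<gamma> v y y' w \<and>
        fderiv g1 (\<gamma> T) (y T) = 0 \<and>
        g2 (\<gamma> T) + fderiv g2 (\<gamma> T) (y T) \<le> - (1 / C) *\<^sub>R 1 \<and>
        (AE t in leb T. c (\<gamma> t, L2_apply v t) + fderiv c (\<gamma> t, L2_apply v t) (y t, w t)
          \<le> - (1 / C) *\<^sub>R 1) \<and>
        H1_norm T y y' \<le> C \<and> Linf_norm T w \<le> ereal C) \<and>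
    \<comment> \<open>a vector indexed by the active constraints is extended by zero\<close>
    (\<exists>C>0. \<forall>x v. c (x, v) \<le> 0 \<longrightarrow>
      (\<forall>\<omega>. (\<forall>i. c (x, v) $ i \<noteq> 0 \<longrightarrow> \<omega> $ i = 0) \<longrightarrow>
        norm (adjoint (blinfun_apply (fderiv_v c x v)) \<omega>) \<ge> (1 / C) * norm \<omega>)) \<and>
    (\<forall>R>0. \<exists>C>0. \<exists>\<epsilon>>0. \<forall>x\<in>cball 0 R. \<forall>v. c (x, v) \<le> 0 \<longrightarrow>
      (\<exists>w\<in>cball 0 C. c (x, v) + fderiv_v c x v w \<le> - \<epsilon> *\<^sub>R 1))"

section \<open>Lagrangian equilibria\<close>

definition P_init :: "real \<Rightarrow> (real^'n::finite) measure \<Rightarrow> ('n, 'm::finite) pair measure set" where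
  "P_init T m0 = {\<eta> \<in> P1 (pairs T). distr \<eta> borel (\<lambda>(\<gamma>, v). \<gamma> 0) = m0}"

definition m_eq :: "('n::finite, 'm::finite) pair measure \<Rightarrow> real \<Rightarrow> (real^'n) measure" where
  "m_eq \<eta> t = distr \<eta> borel (\<lambda>(\<gamma>, v). \<gamma> t)"

(* the integral is a Bochner integral in L^2 *)
definition P_eq ::
  "(real^'m \<Rightarrow> real^'m) \<Rightarrow> ('n::finite, 'm::finite) pair measure \<Rightarrow> real \<Rightarrow> real^'m" where
  "P_eq \<psi> \<eta> t = \<psi> (L2_apply (LINT p|\<eta>. snd p) t)"

definition J_eq ::
  "real \<Rightarrow> ((real^'n::finite) \<times> (real^'m::finite) \<Rightarrow> real)
    \<Rightarrow> (real^'n \<Rightarrow> (real^'n) measure \<Rightarrow> real) \<Rightarrow> (real^'n \<Rightarrow> (real^'n) measure \<Rightarrow> real)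
    \<Rightarrow> (real^'m \<Rightarrow> real^'m) \<Rightarrow> ('n, 'm) pair measure \<Rightarrow> ('n, 'm) pair \<Rightarrow> ereal" where
  "J_eq T L f g0 \<psi> \<eta> = cost T L f g0 (m_eq \<eta>) (P_eq \<psi> \<eta>)"

definition minimizers ::
  "real \<Rightarrow> (real^'n::finite \<Rightarrow> real^'n) \<Rightarrow> (real^'n \<Rightarrow> real^'m::finite^'n)
    \<Rightarrow> ((real^'n) \<times> (real^'m) \<Rightarrow> real^'nc::finite)
    \<Rightarrow> (real^'n \<Rightarrow> real^'g1::finite) \<Rightarrow> (real^'n \<Rightarrow> real^'g2::finite)
    \<Rightarrow> ((real^'n) \<times> (real^'m) \<Rightarrow> real)
    \<Rightarrow> (real^'n \<Rightarrow> (real^'n) measure \<Rightarrow> real) \<Rightarrow> (real^'n \<Rightarrow> (real^'n) measure \<Rightarrow> real)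
    \<Rightarrow> (real^'m \<Rightarrow> real^'m) \<Rightarrow> ('n, 'm) pair measure \<Rightarrow> real^'n \<Rightarrow> ('n, 'm) pair set" where
  "minimizers T a b c g1 g2 L f g0 \<psi> \<eta> x0 =
    {p \<in> admissible T a b c g1 g2 x0.
      \<forall>q\<in>admissible T a b c g1 g2 x0. J_eq T L f g0 \<psi> \<eta> p \<le> J_eq T L f g0 \<psi> \<eta> q}"

definition equilibrium ::
  "real \<Rightarrow> (real^'n::finite \<Rightarrow> real^'n) \<Rightarrow> (real^'n \<Rightarrow> real^'m::finite^'n)
    \<Rightarrow> ((real^'n) \<times> (real^'m) \<Rightarrow> real^'nc::finite)
    \<Rightarrow> (real^'n \<Rightarrow> real^'g1::finite) \<Rightarrow> (real^'n \<Rightarrow> real^'g2::finite)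
    \<Rightarrow> ((real^'n) \<times> (real^'m) \<Rightarrow> real)
    \<Rightarrow> (real^'n \<Rightarrow> (real^'n) measure \<Rightarrow> real) \<Rightarrow> (real^'n \<Rightarrow> (real^'n) measure \<Rightarrow> real)
    \<Rightarrow> (real^'m \<Rightarrow> real^'m) \<Rightarrow> (real^'n) measure \<Rightarrow> ('n, 'm) pair measure \<Rightarrow> bool" where
  "equilibrium T a b c g1 g2 L f g0 \<psi> m0 \<eta> \<longleftrightarrow>
    \<eta> \<in> P_init T m0 \<and>
    supp \<eta> \<subseteq> (\<Union>x\<in>supp m0. minimizers T a b c g1 g2 L f g0 \<psi> \<eta> x)"

end

theory Submission
  imports Defs
begin

text \<open>
  The theorem is an instance of the monotonicity argument of Lasry and Lions. Every pair in the support
  of the first equilibrium minimises the cost of the first equilibrium among the pairs with the same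
  initial position, and the two equilibria have the same distribution of initial positions. Hence the
  mean of the first cost under the first equilibrium is at most its mean under the second, and vice
  versa (\<open>expected_cost_le\<close>). In the sum of the two inequalities the Lagrangian cancels, and there
  remain three terms: the pairing of the difference of the prices with the difference of the mean
  controls, the time integral of the pairing of the difference of \<open>f\<close> with the difference of the time
  marginals, and the analogous terminal term with \<open>g0\<close> (\<open>expected_cost_difference\<close>). All are
  nonnegative and their sum is nonpositive, so they vanish. Strict monotonicity of \<open>\<psi>\<close> then makes the
  mean controls, hence the prices, agree; strict monotonicity of \<open>f\<close> and \<open>g0\<close> makes the couplings agree
  at almost all times and at the final time, at every point of the state space, so that the costs agree
  on all pairs (\<open>equilibria_agree\<close>, \<open>cost_cong_AE\<close>).

  The work lies in the first inequality. Comparing means through the initial distribution amounts to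
  integrating the value function, whose measurability is not obvious. It follows from topology
  (\<open>integral_le_if_fibrewise_le\<close>): the cost is lower semicontinuous (\<open>running_cost_lsc\<close>), and an
  equilibrium is carried by countably many compact sets of pairs (\<open>tight_if_AE_retraction\<close>), whose
  images under evaluation at time zero are compact. Tightness needs an argument because the bounded
  continuous functions on the line are not separable and \<open>H\<^sup>1\<close> is not complete in the supremum norm.
  An admissible pair, however, is recovered continuously from its initial position, its velocity and its
  control, which live in a Polish space, and the state equation expresses the velocity as a continuous
  function of the pair (\<open>continuous_velocity\<close>, \<open>pair_of_data_velocity\<close>).

  Finally, all integrals must exist. Feasibility and coercivity bound the controls of optimal pairs in
  \<open>L\<^sup>2\<close>, Gronwall's inequality bounds their trajectories (\<open>tame_if_cost_le\<close>), and the couplings are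
  continuous, hence bounded on the compact sets so obtained.
\<close>

section \<open>Extended real integrals\<close>

lemma ereal_integral_integrable:
  assumes "integrable M h"
  shows "ereal_integral M h = ereal (integral\<^sup>L M h)"
proof -
  have "(\<integral>\<^sup>+x. ennreal (h x) \<partial>M) \<noteq> \<infinity>" "(\<integral>\<^sup>+x. ennreal (- h x) \<partial>M) \<noteq> \<infinity>"
    using assms by (auto simp: real_integrable_def)
  then show ?thesis
    unfolding ereal_integral_def real_lebesgue_integral_def[OF assms]
    by (cases "\<integral>\<^sup>+x. ennreal (h x) \<partial>M"; cases "\<integral>\<^sup>+x. ennreal (- h x) \<partial>M")
      (auto simp: enn2ereal_ennreal)
qed

text \<open>
  A lower bound rules out that the negative part is infinite, so a finite value can only come from a
  finite positive part.
\<close>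

lemma integrable_if_ereal_integral_less_top:
  assumes [measurable]: "h \<in> borel_measurable M" and w: "integrable M w"
    and le: "AE x in M. w x \<le> h x" and fin: "ereal_integral M h < \<infinity>"
  shows "integrable M h"
proof -
  have "(\<integral>\<^sup>+x. ennreal (- h x) \<partial>M) \<le> (\<integral>\<^sup>+x. ennreal (- w x) \<partial>M)"
    using le by (intro nn_integral_mono_AE) (auto elim!: eventually_mono intro!: ennreal_leI)
  moreover have "(\<integral>\<^sup>+x. ennreal (- w x) \<partial>M) \<noteq> \<infinity>"
    using w by (auto simp: real_integrable_def)
  ultimately have neg: "(\<integral>\<^sup>+x. ennreal (- h x) \<partial>M) \<noteq> \<infinity>"
    by (auto simp: top_unique)
  have "(\<integral>\<^sup>+x. ennreal (h x) \<partial>M) \<noteq> \<infinity>"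
  proof
    assume top: "(\<integral>\<^sup>+x. ennreal (h x) \<partial>M) = \<infinity>"
    obtain r where "(\<integral>\<^sup>+x. ennreal (- h x) \<partial>M) = ennreal r" "r \<ge> 0"
      using neg by (cases "\<integral>\<^sup>+x. ennreal (- h x) \<partial>M") auto
    then show False
      using fin top by (simp add: ereal_integral_def enn2ereal_ennreal)
  qed
  then show ?thesis using neg by (simp add: real_integrable_def)
qed

section \<open>Supports and tightness\<close>

lemma supp_eq_Int_closed:
  "\<exists>C. closed C \<and> supp \<mu> = space \<mu> \<inter> C"
proof (intro exI conjI)
  let ?U = "\<Union>{V. open V \<and> \<not> emeasure \<mu> (V \<inter> space \<mu>) > 0}"
  show "closed (- ?U)" by (intro closed_Compl open_Union) auto
  show "supp \<mu> = space \<mu> \<inter> - ?U" by (auto simp: supp_def)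
qed

text \<open>
  The points outside the support are covered by open null sets. Pulled back along \<open>\<Phi>\<close>, this cover
  has a countable subcover by the Lindelof property, so a measure is concentrated on its support even if the
  ambient space is not separable, provided that it lives on a continuous image of a second countable
  space.
\<close>

lemma AE_in_supp:
  fixes \<mu> :: "'a::topological_space measure"
    and \<Phi> :: "'z::second_countable_topology \<Rightarrow> 'a"
  assumes sets: "sets \<mu> = sets (restrict_space borel S)"
    and cont: "continuous_on UNIV \<Phi>" and sub: "S \<subseteq> range \<Phi>"
  shows "AE x in \<mu>. x \<in> supp \<mu>"
proof -
  have sp: "space \<mu> = S"
    using sets_eq_imp_space_eq[OF sets] by (simp add: space_restrict_space)
  define NV where "NV = {V. open V \<and> \<not> emeasure \<mu> (V \<inter> space \<mu>) > 0}"
  have "open W" if "W \<in> (\<lambda>V. \<Phi> -` V) ` NV" for W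
    using that cont by (auto simp: NV_def intro!: open_vimage)
  then obtain F' where F': "F' \<subseteq> (\<lambda>V. \<Phi> -` V) ` NV" "countable F'" "\<Union>F' = \<Union>((\<lambda>V. \<Phi> -` V) ` NV)"
    using Lindelof by metis
  then obtain NV' where NV': "NV' \<subseteq> NV" "countable NV'" "F' = (\<lambda>V. \<Phi> -` V) ` NV'"
    by (metis countable_subset_image)
  have null: "V \<inter> space \<mu> \<in> null_sets \<mu>" if "V \<in> NV'" for V
  proof (rule null_setsI)
    have "open V" "\<not> emeasure \<mu> (V \<inter> space \<mu>) > 0" using that NV' by (auto simp: NV_def)
    then show "emeasure \<mu> (V \<inter> space \<mu>) = 0" by (simp add: zero_less_iff_neq_zero)
    show "V \<inter> space \<mu> \<in> sets \<mu>"
      unfolding sets sp sets_restrict_space using \<open>open V\<close> by (auto intro!: image_eqI[of _ _ V])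
  qed
  have "(\<Union>V\<in>NV'. V \<inter> space \<mu>) \<in> null_sets \<mu>"
    using NV'(2) null by (rule null_sets_UN')
  then show ?thesis
  proof (rule AE_I')
    show "{x \<in> space \<mu>. x \<notin> supp \<mu>} \<subseteq> (\<Union>V\<in>NV'. V \<inter> space \<mu>)"
    proof
      fix x assume x: "x \<in> {x \<in> space \<mu>. x \<notin> supp \<mu>}"
      then obtain V where V: "V \<in> NV" "x \<in> V" unfolding supp_def NV_def by blast
      obtain z where z: "x = \<Phi> z" using x sub sp by blast
      then have "z \<in> \<Union>((\<lambda>V. \<Phi> -` V) ` NV')" using V F'(3) NV'(3) by blast
      then show "x \<in> (\<Union>V\<in>NV'. V \<inter> space \<mu>)" using x z by blast
    qed
  qed
qed

text \<open>
  Tightness is transported from a Polish space: the image of \<open>\<mu>\<close> under \<open>\<Theta>\<close> is inner regular, and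
  \<open>\<Phi>\<close> maps compact sets back to compact sets that carry the same mass, because \<open>\<Phi> \<circ> \<Theta>\<close> is almost
  surely the identity.
\<close>

lemma tight_if_AE_retraction:
  fixes \<mu> :: "'a::t2_space measure"
    and \<Phi> :: "'z::{second_countable_topology, complete_space} \<Rightarrow> 'a"
  assumes "prob_space \<mu>" and \<Theta>[measurable]: "\<Theta> \<in> borel_measurable \<mu>"
    and \<Phi>: "continuous_on UNIV \<Phi>" and id: "AE x in \<mu>. \<Phi> (\<Theta> x) = x"
  obtains K :: "nat \<Rightarrow> 'a set" where "\<And>n. compact (K n)" "\<And>n. K n \<subseteq> range \<Phi>" "AE x in \<mu>. x \<in> (\<Union>n. K n)"
proof -
  interpret prob_space \<mu> by fact
  let ?N = "distr \<mu> borel \<Theta>"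
  interpret N: prob_space ?N by (rule prob_space_distr) fact
  have "\<exists>K. compact K \<and> measure ?N K > 1 - inverse (real (Suc n))" for n
  proof -
    have "emeasure ?N UNIV = (SUP K\<in>{K. K \<subseteq> UNIV \<and> compact K}. emeasure ?N K)"
      by (rule inner_regular) auto
    moreover have "emeasure ?N UNIV = 1" using N.emeasure_space_1 by simp
    moreover have "ennreal (1 - inverse (real (Suc n))) < 1" by (simp add: ennreal_less_one_iff field_simps)
    ultimately have "ennreal (1 - inverse (real (Suc n))) < (SUP K\<in>{K. K \<subseteq> UNIV \<and> compact K}. emeasure ?N K)"
      by simp
    then obtain K where "compact K" "ennreal (1 - inverse (real (Suc n))) < emeasure ?N K"
      unfolding less_SUP_iff by auto
    then show ?thesis
      by (auto simp: N.emeasure_eq_measure ennreal_less_iff field_simps intro!: exI[of _ K])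
  qed
  then obtain K where K: "\<And>n. compact (K n)" "\<And>n. measure ?N (K n) > 1 - inverse (real (Suc n))"
    by metis
  have Ks[measurable]: "K n \<in> sets borel" for n using K(1) by (simp add: borel_compact)
  have ge: "1 - inverse (real (Suc n)) \<le> measure ?N (\<Union>n. K n)" for n
  proof -
    have "measure ?N (K n) \<le> measure ?N (\<Union>n. K n)" by (rule N.finite_measure_mono) auto
    then show ?thesis using K(2)[of n] by simp
  qed
  have "(\<lambda>n. 1 - inverse (real (Suc n))) \<longlonglongrightarrow> 1 - 0"
    by (intro tendsto_diff tendsto_const LIMSEQ_inverse_real_of_nat)
  then have "1 \<le> measure ?N (\<Union>n. K n)"
    using ge by (intro LIMSEQ_le_const2[where X="\<lambda>n. 1 - inverse (real (Suc n))"]) auto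
  then have "N.prob (\<Union>n. K n) = 1" using N.prob_le_1 by (simp add: antisym)
  then have "AE y in ?N. y \<in> (\<Union>n. K n)" by (subst (asm) N.prob_eq_1) auto
  then have "AE x in \<mu>. \<Theta> x \<in> (\<Union>n. K n)" by (subst (asm) AE_distr_iff) auto
  then have "AE x in \<mu>. x \<in> (\<Union>n. \<Phi> ` K n)"
    using id by eventually_elim force
  moreover have "compact (\<Phi> ` K n)" for n
    using K(1) \<Phi> by (intro compact_continuous_image) (auto intro: continuous_on_subset)
  ultimately show thesis by (intro that[of "\<lambda>n. \<Phi> ` K n"]) auto
qed

section \<open>Comparison of two measures with the same marginal\<close>

text \<open>
  The value function \<open>W\<close> assigns to \<open>x\<close> the common value of \<open>J\<close> on the part of the fibre of \<open>e\<close> over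
  \<open>x\<close> that carries \<open>\<mu>\<close>. Then \<open>J = W \<circ> e\<close> almost surely for \<open>\<mu>\<close> and \<open>W \<circ> e \<le> J\<close> almost surely
  for \<open>\<nu>\<close>, while the integral of \<open>W \<circ> e\<close> depends on the common marginal alone. Compactness is what makes
  \<open>W\<close> measurable: its sublevel sets are, on the image of the sets \<open>K n\<close>, countable unions of
  continuous images of compact sets.
\<close>

lemma integral_le_if_fibrewise_le:
  fixes \<mu> \<nu> :: "'a::metric_space measure" and e :: "'a \<Rightarrow> 'b::metric_space" and J :: "'a \<Rightarrow> real"
  assumes e\<mu>[measurable]: "e \<in> borel_measurable \<mu>" and e\<nu>[measurable]: "e \<in> borel_measurable \<nu>"
    and marg: "distr \<mu> borel e = distr \<nu> borel e"
    and cont: "continuous_on UNIV e"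
    and K: "\<And>n \<beta>. compact {p \<in> K n. J p \<le> \<beta>}"
    and \<mu>K: "AE p in \<mu>. p \<in> (\<Union>n::nat. K n)" and \<nu>B: "AE q in \<nu>. q \<in> B"
    and le: "\<And>p q. p \<in> (\<Union>n. K n) \<Longrightarrow> q \<in> (\<Union>n. K n) \<union> B \<Longrightarrow> e p = e q \<Longrightarrow> J p \<le> J q"
    and J\<mu>: "integrable \<mu> J" and J\<nu>: "integrable \<nu> J"
  shows "integral\<^sup>L \<mu> J \<le> integral\<^sup>L \<nu> J"
proof -
  define A where "A = (\<Union>n. K n)"
  define W where "W x = (if x \<in> e ` A then J (SOME p. p \<in> A \<and> e p = x) else 0)" for x
  have We: "W (e p) = J p" if p: "p \<in> A" for p
  proof -
    let ?q = "SOME q. q \<in> A \<and> e q = e p"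
    have "?q \<in> A \<and> e ?q = e p" by (rule someI[of _ p]) (use p in simp)
    then have "J ?q = J p" using le[of ?q p] le[of p ?q] p by (auto simp: A_def)
    then show ?thesis using p by (simp add: W_def)
  qed
  have cpt: "e ` {p \<in> K n. J p \<le> \<beta>} \<in> sets borel" for n \<beta>
    by (intro borel_compact compact_continuous_image K continuous_on_subset[OF cont]) auto
  have eA[measurable]: "e ` A \<in> sets borel"
  proof -
    have "e ` A = (\<Union>n. \<Union>k::nat. e ` {p \<in> K n. J p \<le> real k})"
      using real_arch_simple by (fastforce simp: A_def)
    then show ?thesis using cpt by auto
  qed
  have W[measurable]: "W \<in> borel_measurable borel"
  proof (rule borel_measurable_iff_le[THEN iffD2, rule_format])
    fix \<beta>
    have "{x \<in> space borel. W x \<le> \<beta>} = (\<Union>n. e ` {p \<in> K n. J p \<le> \<beta>}) \<union> (if 0 \<le> \<beta> then - e ` A else {})"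
      (is "?l = ?r")
    proof (rule set_eqI)
      fix x
      show "x \<in> ?l \<longleftrightarrow> x \<in> ?r"
      proof (cases "x \<in> e ` A")
        case True
        then obtain p n where p: "p \<in> K n" "x = e p" by (auto simp: A_def)
        then have W: "W x = J p" using We by (auto simp: A_def)
        have "x \<in> ?r \<longleftrightarrow> x \<in> (\<Union>n. e ` {p \<in> K n. J p \<le> \<beta>})" using True by auto
        also have "\<dots> \<longleftrightarrow> (\<exists>n. \<exists>q\<in>K n. e q = x \<and> J q \<le> \<beta>)" by blast
        also have "\<dots> \<longleftrightarrow> J p \<le> \<beta>"
        proof
          assume "\<exists>n. \<exists>q\<in>K n. e q = x \<and> J q \<le> \<beta>"
          then obtain q m where "q \<in> K m" "e q = x" "J q \<le> \<beta>" by blast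
          moreover from this have "q \<in> A" by (auto simp: A_def)
          ultimately show "J p \<le> \<beta>" using W We by metis
        qed (use p in blast)
        finally show ?thesis using W by simp
      next
        case False
        then have "x \<notin> (\<Union>n. e ` {p \<in> K n. J p \<le> \<beta>})" by (auto simp: A_def)
        then show ?thesis using False by (auto simp: W_def)
      qed
    qed
    also have "\<dots> \<in> sets borel" using cpt eA by (auto intro!: sets.Un sets.countable_UN)
    finally show "{x \<in> space borel. W x \<le> \<beta>} \<in> sets borel" .
  qed
  have AEW: "AE p in \<mu>. W (e p) = J p" using \<mu>K We by (auto simp: A_def elim!: eventually_mono)
  have iW: "integrable \<mu> (\<lambda>p. W (e p))"
    using AEW J\<mu> by (subst integrable_cong_AE[where g=J]) auto
  then have "integrable (distr \<mu> borel e) W" by (subst integrable_distr_eq) auto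
  then have iW': "integrable \<nu> (\<lambda>q. W (e q))" by (simp add: marg integrable_distr_eq)
  have "AE x in \<mu>. e x \<in> e ` A" using \<mu>K by (auto simp: A_def elim!: eventually_mono)
  then have "AE x in distr \<mu> borel e. x \<in> e ` A" by (subst AE_distr_iff) auto
  then have AE\<nu>: "AE q in \<nu>. e q \<in> e ` A" unfolding marg by (subst (asm) AE_distr_iff) auto
  have "integral\<^sup>L \<mu> J = (LINT p|\<mu>. W (e p))"
    using AEW J\<mu> iW by (intro integral_cong_AE) (auto elim: eventually_mono)
  also have "\<dots> = integral\<^sup>L (distr \<mu> borel e) W" by (subst integral_distr) auto
  also have "\<dots> = (LINT q|\<nu>. W (e q))" unfolding marg by (subst integral_distr) auto
  also have "\<dots> \<le> integral\<^sup>L \<nu> J"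
  proof (rule integral_mono_AE[OF iW' J\<nu>])
    show "AE q in \<nu>. W (e q) \<le> J q"
      using AE\<nu> \<nu>B
    proof eventually_elim
      case (elim q)
      then obtain p where "p \<in> A" "e q = e p" by auto
      then show ?case using We[of p] le[of p q] elim by (auto simp: A_def)
    qed
  qed
  finally show ?thesis .
qed

section \<open>Trajectories as primitives of square integrable functions\<close>

lemma norm_matrix_vector_le:
  fixes A :: "real^'m::finite^'n::finite"
  shows "norm (A *v x) \<le> norm A * norm x"
proof -
  have "norm (A *v x) = L2_set (\<lambda>i. norm (A $ i \<bullet> x)) UNIV"
    by (simp add: norm_vec_def matrix_vector_mul_component)
  also have "\<dots> \<le> L2_set (\<lambda>i. norm (A $ i) * norm x) UNIV"
    by (rule L2_set_mono) (auto intro: Cauchy_Schwarz_ineq2)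
  also have "\<dots> = norm A * norm x"
    by (simp add: norm_vec_def L2_set_left_distrib)
  finally show ?thesis .
qed

lemma sq_integrable_restrict:
  assumes "sq_integrable f" and [measurable]: "A \<in> sets borel"
  shows "sq_integrable (\<lambda>t. indicator A t *\<^sub>R f t)"
proof (rule sq_integrable_bound)
  note [measurable] = sq_integrableD[OF assms(1)]
  show "(\<lambda>t. indicator A t *\<^sub>R f t) \<in> borel_measurable borel" by measurable
  show "integrable lborel (\<lambda>t. (norm (f t))\<^sup>2)" using assms(1) by (simp add: sq_integrable_def)
  show "AE t in lborel. (norm (indicator A t *\<^sub>R f t))\<^sup>2 \<le> (norm (f t))\<^sup>2"
    by (auto simp: indicator_def)
qed

text \<open>
  The orthogonal projection of \<open>L\<^sup>2\<close> of the line onto \<open>L\<^sup>2(0,T)\<close>.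
\<close>

definition restrict_L2 :: "real \<Rightarrow> 'b::euclidean_space L2fun \<Rightarrow> 'b L2fun" where
  "restrict_L2 T u = abs_L2fun (\<lambda>t. indicator {0<..<T} t *\<^sub>R L2_apply u t)"

lemma AE_restrict_L2:
  "AE t in lborel. L2_apply (restrict_L2 T u) t = indicator {0<..<T} t *\<^sub>R L2_apply u t"
  unfolding restrict_L2_def by (intro AE_abs_L2fun sq_integrable_restrict) auto

lemma restrict_L2_in_L2_on: "restrict_L2 T u \<in> L2_on T"
  unfolding L2_on_def using AE_restrict_L2[of T u] by (auto elim!: eventually_mono)

lemma restrict_L2_ident:
  assumes "u \<in> L2_on T" shows "restrict_L2 T u = u"
proof (rule L2fun_eqI)
  show "AE t in lborel. L2_apply (restrict_L2 T u) t = L2_apply u t"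
    using AE_restrict_L2[of T u] assms[unfolded L2_on_def mem_Collect_eq]
    by eventually_elim (auto simp: indicator_def)
qed

lemma bounded_linear_restrict_L2: "bounded_linear (restrict_L2 T :: 'b::euclidean_space L2fun \<Rightarrow> _)"
proof (rule bounded_linear_intro[where K=1])
  fix u v :: "'b L2fun" and r :: real
  show "restrict_L2 T (u + v) = restrict_L2 T u + restrict_L2 T v"
  proof (rule L2fun_eqI)
    show "AE t in lborel. L2_apply (restrict_L2 T (u + v)) t = L2_apply (restrict_L2 T u + restrict_L2 T v) t"
      using AE_restrict_L2[of T "u + v"] AE_restrict_L2[of T u] AE_restrict_L2[of T v]
        AE_L2_apply_add[of u v] AE_L2_apply_add[of "restrict_L2 T u" "restrict_L2 T v"]
      by eventually_elim (simp add: scaleR_add_right)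
  qed
  show "restrict_L2 T (r *\<^sub>R u) = r *\<^sub>R restrict_L2 T u"
  proof (rule L2fun_eqI)
    show "AE t in lborel. L2_apply (restrict_L2 T (r *\<^sub>R u)) t = L2_apply (r *\<^sub>R restrict_L2 T u) t"
      using AE_restrict_L2[of T "r *\<^sub>R u"] AE_restrict_L2[of T u]
        AE_L2_apply_scaleR[of r u] AE_L2_apply_scaleR[of r "restrict_L2 T u"]
      by eventually_elim simp
  qed
  have "(norm (restrict_L2 T u))\<^sup>2 \<le> (norm u)\<^sup>2"
    unfolding norm_L2fun_eq
  proof (rule integral_mono_AE)
    show "AE t in lborel. (norm (L2_apply (restrict_L2 T u) t))\<^sup>2 \<le> (norm (L2_apply u t))\<^sup>2"
      using AE_restrict_L2[of T u] by eventually_elim (auto simp: indicator_def)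
  qed (use sq_integrable_L2_apply in \<open>auto simp: sq_integrable_def\<close>)
  then show "norm (restrict_L2 T u) \<le> norm u * 1" by (simp add: power2_le_iff_abs_le)
qed

text \<open>
  The Cauchy-Schwarz inequality against an indicator function.
\<close>

lemma L2_set_integral:
  fixes u :: "'b::euclidean_space L2fun"
  assumes [measurable]: "A \<in> sets borel" and fin: "emeasure lborel A < \<infinity>"
  shows "set_integrable lborel A (L2_apply u)"
    and "(LINT t:A|lborel. norm (L2_apply u t)) \<le> sqrt (measure lborel A) * norm u"
    and "norm (LINT t:A|lborel. L2_apply u t) \<le> sqrt (measure lborel A) * norm u"
proof -
  have sq: "sq_integrable (\<lambda>t. norm (L2_apply u t))"
    using sq_integrable_L2_apply[of u] by (auto simp: sq_integrable_def)
  have si: "sq_integrable (indicator A :: real \<Rightarrow> real)"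
    using fin by (auto simp: sq_integrable_def power2_eq_square indicator_inter_arith[symmetric])
  have ni: "set_integrable lborel A (\<lambda>t. norm (L2_apply u t))"
    using sq_integrable_inner[OF si sq] by (simp add: set_integrable_def)
  then show i: "set_integrable lborel A (L2_apply u)"
    using integrable_norm_iff[of "\<lambda>t. indicator A t *\<^sub>R L2_apply u t" lborel]
    by (simp add: set_integrable_def)
  define N where "N = abs_L2fun (\<lambda>t. norm (L2_apply u t))"
  define X where "X = abs_L2fun (indicator A :: real \<Rightarrow> real)"
  have "(norm N)\<^sup>2 = (norm u)\<^sup>2" unfolding N_def norm_abs_L2fun[OF sq] by (simp add: norm_L2fun_eq)
  then have N: "norm N = norm u" by simp
  have "(norm X)\<^sup>2 = measure lborel A"
    unfolding X_def norm_abs_L2fun[OF si]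
    using fin by (simp add: power2_eq_square indicator_inter_arith[symmetric])
  then have X: "norm X = sqrt (measure lborel A)" by (metis norm_ge_zero real_sqrt_unique)
  have "(LINT t:A|lborel. norm (L2_apply u t)) = X \<bullet> N"
    unfolding X_def N_def by (subst inner_L2fun.abs_eq) (auto simp: L2_rel_def si sq set_lebesgue_integral_def)
  also have "\<dots> \<le> norm X * norm N" by (rule norm_cauchy_schwarz)
  finally show b: "(LINT t:A|lborel. norm (L2_apply u t)) \<le> sqrt (measure lborel A) * norm u"
    unfolding X N .
  have "norm (LINT t:A|lborel. L2_apply u t) \<le> (LINT t:A|lborel. norm (L2_apply u t))"
    by (rule set_integral_norm_bound[OF i])
  then show "norm (LINT t:A|lborel. L2_apply u t) \<le> sqrt (measure lborel A) * norm u" using b by simp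
qed

lemma continuous_apply_bcontfun: "continuous_on UNIV (\<lambda>\<gamma>. apply_bcontfun \<gamma> t)"
  unfolding continuous_on_iff by (meson dist_bounded le_less_trans)

text \<open>
  The argument is clamped to \<open>[0,T]\<close> so that primitives satisfy the extension convention of
  \<open>H1_deriv\<close>.
\<close>

definition primitive :: "real \<Rightarrow> 'b::euclidean_space \<times> 'b L2fun \<Rightarrow> real \<Rightarrow>\<^sub>C 'b" where
  "primitive T z = Bcontfun (\<lambda>t. fst z + (LINT s:{0..max 0 (min T t)}|lborel. L2_apply (snd z) s))"

lemma apply_primitive:
  fixes z :: "'b::euclidean_space \<times> 'b L2fun"
  assumes "T \<ge> 0"
  shows "primitive T z t = fst z + (LINT s:{0..max 0 (min T t)}|lborel. L2_apply (snd z) s)"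
proof -
  let ?f = "\<lambda>t. fst z + (LINT s:{0..max 0 (min T t)}|lborel. L2_apply (snd z) s)"
  have int: "set_integrable lborel {0..t} (L2_apply (snd z))" for t
    by (rule L2_set_integral(1)) (auto simp: emeasure_lborel_Icc_eq)
  have "continuous_on {0..T} (\<lambda>t. integral {0..t} (L2_apply (snd z)))"
    by (intro indefinite_integral_continuous_1 set_borel_integral_eq_integral int)
  then have "continuous_on {0..T} (\<lambda>t. LINT s:{0..t}|lborel. L2_apply (snd z) s)"
    by (simp add: set_borel_integral_eq_integral int)
  then have "continuous_on UNIV (\<lambda>t. LINT s:{0..max 0 (min T t)}|lborel. L2_apply (snd z) s)"
    by (rule continuous_on_compose2[where f="\<lambda>t. max 0 (min T t)"])
      (use assms in \<open>auto intro!: continuous_intros\<close>)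
  then have "continuous_on UNIV ?f" by (intro continuous_intros)
  moreover have "norm (?f t) \<le> norm (fst z) + sqrt T * norm (snd z)" for t
  proof -
    have "norm (LINT s:{0..max 0 (min T t)}|lborel. L2_apply (snd z) s)
        \<le> sqrt (measure lborel {0..max 0 (min T t)}) * norm (snd z)"
      by (rule L2_set_integral(3)) (auto simp: emeasure_lborel_Icc_eq)
    also have "\<dots> \<le> sqrt T * norm (snd z)" using assms by (intro mult_right_mono) auto
    finally show ?thesis by (intro norm_triangle_le) simp
  qed
  ultimately have "?f \<in> bcontfun" by (rule bcontfun_normI)
  then show ?thesis by (simp add: primitive_def Bcontfun_inverse)
qed

lemma primitive_0: "T \<ge> 0 \<Longrightarrow> primitive T z 0 = fst z"
proof -
  assume "T \<ge> 0"
  have "norm (LINT s:{0..0}|lborel. L2_apply (snd z) s) \<le> sqrt (measure lborel {0..0::real}) * norm (snd z)"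
    by (rule L2_set_integral(3)) auto
  then show ?thesis using \<open>T \<ge> 0\<close> by (simp add: apply_primitive min_def)
qed

lemma bounded_linear_primitive:
  assumes "T \<ge> 0"
  shows "bounded_linear (primitive T :: 'b::euclidean_space \<times> 'b L2fun \<Rightarrow> _)"
proof (rule bounded_linear_intro[where K="1 + sqrt T"])
  fix z w :: "'b \<times> 'b L2fun" and r :: real
  have int: "set_integrable lborel {0..t} (L2_apply u)" for t and u :: "'b L2fun"
    by (rule L2_set_integral(1)) (auto simp: emeasure_lborel_Icc_eq)
  show "primitive T (z + w) = primitive T z + primitive T w"
  proof (rule bcontfun_eqI)
    fix t
    let ?I = "{0..max 0 (min T t)}"
    have "(LINT s:?I|lborel. L2_apply (snd z + snd w) s)
        = (LINT s:?I|lborel. L2_apply (snd z) s + L2_apply (snd w) s)"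
      using AE_L2_apply_add[of "snd z" "snd w"]
      by (intro set_lebesgue_integral_cong_AE) (auto elim: eventually_mono)
    then show "primitive T (z + w) t = (primitive T z + primitive T w) t"
      using assms by (simp add: apply_primitive set_integral_add int plus_bcontfun.rep_eq)
  qed
  show "primitive T (r *\<^sub>R z) = r *\<^sub>R primitive T z"
  proof (rule bcontfun_eqI)
    fix t
    let ?I = "{0..max 0 (min T t)}"
    have "(LINT s:?I|lborel. L2_apply (r *\<^sub>R snd z) s) = (LINT s:?I|lborel. r *\<^sub>R L2_apply (snd z) s)"
      using AE_L2_apply_scaleR[of r "snd z"]
      by (intro set_lebesgue_integral_cong_AE) (auto elim: eventually_mono)
    then show "primitive T (r *\<^sub>R z) t = (r *\<^sub>R primitive T z) t"
      using assms by (simp add: apply_primitive scaleR_add_right)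
  qed
  show "norm (primitive T z) \<le> norm z * (1 + sqrt T)"
  proof (rule norm_bound)
    fix t
    have "norm (LINT s:{0..max 0 (min T t)}|lborel. L2_apply (snd z) s)
        \<le> sqrt (measure lborel {0..max 0 (min T t)}) * norm (snd z)"
      by (rule L2_set_integral(3)) (auto simp: emeasure_lborel_Icc_eq)
    also have "\<dots> \<le> sqrt T * norm z"
      using assms norm_snd_le[of "snd z" "fst z"] by (intro mult_mono) auto
    finally have "norm (primitive T z t) \<le> norm (fst z) + sqrt T * norm z"
      using assms by (simp add: apply_primitive norm_triangle_le)
    also have "\<dots> \<le> norm z + sqrt T * norm z" using norm_fst_le[of "fst z" "snd z"] by simp
    finally show "norm (primitive T z t) \<le> norm z * (1 + sqrt T)" by (simp add: algebra_simps)
  qed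
qed

lemma H1_deriv_primitive:
  assumes "T \<ge> 0"
  shows "H1_deriv T (primitive T (x, u)) (restrict_L2 T u)"
  unfolding H1_deriv_def
proof (intro conjI allI ballI restrict_L2_in_L2_on)
  show "primitive T (x, u) t = primitive T (x, u) (max 0 (min T t))" for t
    using assms by (simp add: apply_primitive min_def max_def)
  fix t assume t: "t \<in> {0..T}"
  \<comment> \<open>The restriction removes the end points as well, which form a null set.\<close>
  have "AE s in lborel. s \<noteq> 0 \<and> s \<noteq> T" by (intro AE_conjI AE_lborel_singleton)
  then have "(LINT s:{0..t}|lborel. L2_apply u s) = (LINT s:{0..t}|lborel. L2_apply (restrict_L2 T u) s)"
    using AE_restrict_L2[of T u] t
    by (intro set_lebesgue_integral_cong_AE) (auto elim!: eventually_elim2 simp: indicator_def)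
  then show "primitive T (x, u) t = primitive T (x, u) 0 + (LINT s:{0..t}|lborel. L2_apply (restrict_L2 T u) s)"
    using assms t by (simp add: primitive_0) (simp add: apply_primitive)
qed

lemma primitive_of_deriv:
  assumes "T \<ge> 0" "H1_deriv T \<gamma> \<gamma>'"
  shows "primitive T (\<gamma> 0, \<gamma>') = \<gamma>"
proof (rule bcontfun_eqI)
  fix t
  let ?c = "max 0 (min T t)"
  have "\<gamma> t = \<gamma> ?c" using assms(2) unfolding H1_deriv_def by blast
  also have "?c \<in> {0..T}" using assms(1) by auto
  then have "\<gamma> ?c = \<gamma> 0 + (LINT s:{0..?c}|lborel. L2_apply \<gamma>' s)"
    using assms(2) unfolding H1_deriv_def by blast
  finally show "primitive T (\<gamma> 0, \<gamma>') t = \<gamma> t" using assms(1) by (simp add: apply_primitive)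
qed

text \<open>
  The pairs of trajectories and controls form a continuous image of a Polish space, with which the
  Borel structure of the non-separable ambient space is controlled.
\<close>

definition pair_of_data ::
  "real \<Rightarrow> ((real^'n::finite) \<times> (real^'n) L2fun) \<times> (real^'m::finite) L2fun \<Rightarrow> ('n, 'm) pair" where
  "pair_of_data T z = (primitive T (fst z), restrict_L2 T (snd z))"

lemma continuous_pair_of_data: "T \<ge> 0 \<Longrightarrow> continuous_on UNIV (pair_of_data T)"
  unfolding pair_of_data_def
  by (intro continuous_intros bounded_linear.continuous_on[OF bounded_linear_primitive]
      bounded_linear.continuous_on[OF bounded_linear_restrict_L2])

lemma range_pair_of_data:
  assumes "T \<ge> 0"
  shows "range (pair_of_data T) = (pairs T :: ('n::finite, 'm::finite) pair set)"
proof
  show "range (pair_of_data T) \<subseteq> (pairs T :: ('n, 'm) pair set)"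
    using H1_deriv_primitive[OF assms] restrict_L2_in_L2_on
    by (force simp: pairs_def pair_of_data_def H1_def)
  show "(pairs T :: ('n, 'm) pair set) \<subseteq> range (pair_of_data T)"
  proof
    fix p :: "('n, 'm) pair" assume "p \<in> pairs T"
    then obtain \<gamma>' where "H1_deriv T (fst p) \<gamma>'" "snd p \<in> L2_on T" by (auto simp: pairs_def H1_def)
    then have "p = pair_of_data T ((apply_bcontfun (fst p) 0, \<gamma>'), snd p)"
      by (simp add: pair_of_data_def restrict_L2_ident primitive_of_deriv[OF assms])
    then show "p \<in> range (pair_of_data T)" by blast
  qed
qed

section \<open>Bounds on trajectories\<close>

lemma integral_mult_le_sqrt:
  fixes f g :: "real \<Rightarrow> real"
  assumes f: "sq_integrable f" and g: "sq_integrable g"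
  shows "(LINT t|lborel. f t * g t) \<le> sqrt (LINT t|lborel. (f t)\<^sup>2) * sqrt (LINT t|lborel. (g t)\<^sup>2)"
proof -
  have "(LINT t|lborel. f t * g t) = abs_L2fun f \<bullet> abs_L2fun g"
    by (subst inner_L2fun.abs_eq) (auto simp: L2_rel_def f g)
  also have "\<dots> \<le> norm (abs_L2fun f) * norm (abs_L2fun g)" by (rule norm_cauchy_schwarz)
  also have "norm (abs_L2fun f) = sqrt (LINT t|lborel. (f t)\<^sup>2)"
    using norm_abs_L2fun[OF f] by (intro real_sqrt_unique[symmetric]) auto
  also have "norm (abs_L2fun g) = sqrt (LINT t|lborel. (g t)\<^sup>2)"
    using norm_abs_L2fun[OF g] by (intro real_sqrt_unique[symmetric]) auto
  finally show ?thesis .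
qed

lemma sq_integrable_continuous_bounded:
  fixes f :: "real \<Rightarrow> 'b::euclidean_space"
  assumes f: "continuous_on {0..T} f" and A[measurable]: "A \<in> sets borel" and AT: "A \<subseteq> {0..T}"
  shows "sq_integrable (\<lambda>t. indicator A t *\<^sub>R f t)"
proof -
  have "compact (f ` {0..T})" by (intro compact_continuous_image f) auto
  then obtain D where D: "\<And>t. t \<in> {0..T} \<Longrightarrow> norm (f t) \<le> D"
    using compact_imp_bounded bounded_iff by (metis imageI)
  have "(\<lambda>t. indicator {0..T} t *\<^sub>R f t) \<in> borel_measurable borel"
    by (rule borel_measurable_continuous_on_indicator) (auto intro: f)
  then have [measurable]: "(\<lambda>t. indicator A t *\<^sub>R (indicator {0..T} t *\<^sub>R f t)) \<in> borel_measurable borel"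
    by measurable
  moreover have eq: "(\<lambda>t. indicator A t *\<^sub>R (indicator {0..T} t *\<^sub>R f t)) = (\<lambda>t. indicator A t *\<^sub>R f t)"
    using AT by (auto simp: indicator_def fun_eq_iff)
  ultimately have meas: "(\<lambda>t. indicator A t *\<^sub>R f t) \<in> borel_measurable borel" by simp
  show ?thesis
  proof (rule sq_integrable_bound[OF meas])
    show "integrable lborel (\<lambda>t. D\<^sup>2 * indicator {0..T} t)"
      by (intro integrable_mult_right integrable_real_indicator) (auto simp: emeasure_lborel_Icc_eq)
    have "(norm (indicator A t *\<^sub>R f t))\<^sup>2 \<le> D\<^sup>2 * indicator {0..T} t" for t
      using D[of t] AT by (cases "t \<in> A") (auto intro!: power_mono simp: indicator_def subset_iff)
    then show "AE t in lborel. (norm (indicator A t *\<^sub>R f t))\<^sup>2 \<le> D\<^sup>2 * indicator {0..T} t" by simp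
  qed
qed

text \<open>
  At the maximum point of \<open>exp (- l t) * u t\<close>, where this product equals \<open>M\<close>, the Cauchy-Schwarz
  inequality bounds the integral of \<open>k * u\<close> by \<open>M * exp (l t)\<close> times the square root of
  \<open>B / (2 l)\<close>. The rate \<open>l = 2 B + 1\<close> makes this factor at most one half, so that the term is absorbed.
\<close>

lemma gronwall_sq_integrable:
  fixes u k :: "real \<Rightarrow> real"
  assumes T: "T \<ge> 0" and u: "continuous_on {0..T} u" and u0: "\<And>t. t \<in> {0..T} \<Longrightarrow> u t \<ge> 0"
    and k: "sq_integrable k" and k0: "\<And>t. k t \<ge> 0" and A: "A \<ge> 0"
    and le: "\<And>t. t \<in> {0..T} \<Longrightarrow> u t \<le> A + (LINT s:{0..t}|lborel. k s * u s)"
    and B: "(LINT t|lborel. (k t)\<^sup>2) \<le> B"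
    and t: "t \<in> {0..T}"
  shows "u t \<le> 2 * A * exp ((2 * B + 1) * T)"
proof -
  define l where "l = 2 * B + 1"
  have B0: "B \<ge> 0" using B by (rule order_trans[rotated]) simp
  then have l: "l > 0" by (simp add: l_def)
  have "continuous_on {0..T} (\<lambda>t. exp (- l * t) * u t)" by (intro continuous_intros u)
  then obtain r where r: "r \<in> {0..T}" and max: "\<And>s. s \<in> {0..T} \<Longrightarrow> exp (- l * s) * u s \<le> exp (- l * r) * u r"
    using continuous_attains_sup[of "{0..T}" "\<lambda>t. exp (- l * t) * u t"] T by auto
  define M where "M = exp (- l * r) * u r"
  have M0: "M \<ge> 0" using u0[OF r] by (simp add: M_def)
  have uM: "u s \<le> M * exp (l * s)" if "s \<in> {0..T}" for s
    using max[OF that] by (simp add: M_def exp_minus field_simps)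
  define e where "e s = indicator {0..r} s *\<^sub>R exp (l * s)" for s
  have "(LINT s|lborel. indicator {0..r} s *\<^sub>R exp (2 * l * s)) = exp (2 * l * r) / (2 * l) - exp (2 * l * 0) / (2 * l)"
    using r l by (intro integral_FTC_atLeastAtMost)
      (auto intro!: derivative_eq_intros continuous_intros simp flip: has_real_derivative_iff_has_vector_derivative)
  moreover have "(e s)\<^sup>2 = indicator {0..r} s *\<^sub>R exp (2 * l * s)" for s
    by (auto simp: e_def indicator_def power2_eq_square simp flip: exp_add)
  ultimately have e2: "(LINT s|lborel. (e s)\<^sup>2) \<le> exp (2 * l * r) / (2 * l)" using l by simp
  have e: "sq_integrable e"
    unfolding e_def using r by (intro sq_integrable_continuous_bounded[where T=T] continuous_intros) auto
  have "(LINT s:{0..r}|lborel. k s * u s) \<le> (LINT s|lborel. M * (k s * e s))"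
    unfolding set_lebesgue_integral_def
  proof (rule integral_mono')
    show "integrable lborel (\<lambda>s. M * (k s * e s))" using sq_integrable_inner[OF k e] by simp
    show "0 \<le> M * (k s * e s)" for s using M0 k0 by (simp add: e_def)
    show "indicator {0..r} s *\<^sub>R (k s * u s) \<le> M * (k s * e s)" for s
    proof (cases "s \<in> {0..r}")
      case True
      then have "k s * u s \<le> k s * (M * exp (l * s))" using r by (intro mult_left_mono uM k0) auto
      then show ?thesis using True by (simp add: e_def mult_ac)
    qed (simp add: e_def)
  qed
  also have "\<dots> = M * (LINT s|lborel. k s * e s)" by simp
  also have "\<dots> \<le> M * (exp (l * r) / 2)"
  proof (rule mult_left_mono[OF _ M0])
    have "(LINT s|lborel. k s * e s) \<le> sqrt (LINT t|lborel. (k t)\<^sup>2) * sqrt (LINT t|lborel. (e t)\<^sup>2)"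
      by (rule integral_mult_le_sqrt[OF k e])
    also have "\<dots> \<le> sqrt B * sqrt (exp (2 * l * r) / (2 * l))"
      using B e2 B0 by (intro mult_mono real_sqrt_le_mono) auto
    also have "\<dots> = sqrt (B * exp (2 * l * r) / (2 * l))" by (simp add: real_sqrt_mult[symmetric])
    also have "\<dots> \<le> sqrt ((exp (l * r) / 2)\<^sup>2)"
    proof (rule real_sqrt_le_mono)
      have "B / (2 * l) \<le> 1 / 4" using B0 by (simp add: l_def field_simps)
      then have "B / (2 * l) * exp (2 * l * r) \<le> 1 / 4 * exp (2 * l * r)" by (intro mult_right_mono) auto
      also have "\<dots> = (exp (l * r) / 2)\<^sup>2" by (simp add: power2_eq_square exp_add[symmetric])
      finally show "B * exp (2 * l * r) / (2 * l) \<le> (exp (l * r) / 2)\<^sup>2" by simp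
    qed
    also have "\<dots> = exp (l * r) / 2" by simp
    finally show "(LINT s|lborel. k s * e s) \<le> exp (l * r) / 2" .
  qed
  finally have "u r \<le> A + M * (exp (l * r) / 2)" using le[OF r] by simp
  then have "M \<le> exp (- l * r) * (A + M * (exp (l * r) / 2))" unfolding M_def by (intro mult_left_mono) auto
  also have "\<dots> = exp (- l * r) * A + M / 2" by (simp add: algebra_simps exp_minus)
  also have "\<dots> \<le> A + M / 2"
  proof -
    have "exp (- l * r) \<le> 1" using l r by simp
    then show ?thesis using mult_right_mono[OF _ A, of "exp (- l * r)" 1] by simp
  qed
  finally have "M \<le> 2 * A" by simp
  have "u t \<le> M * exp (l * t)" by (rule uM[OF t])
  also have "\<dots> \<le> 2 * A * exp (l * T)"
    using \<open>M \<le> 2 * A\<close> A t l by (intro mult_mono) auto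
  finally show ?thesis by (simp add: l_def)
qed

text \<open>
  With \<open>u = 1 + |\<gamma>|\<close>, the linear growth of the dynamics gives \<open>|\<gamma>'| \<le> k u\<close> for \<open>k = C (1 + |v|)\<close>,
  which is square integrable on \<open>(0,T)\<close>.
\<close>

lemma trajectory_bound:
  fixes a :: "real^'n::finite \<Rightarrow> real^'n" and b :: "real^'n \<Rightarrow> real^'m::finite^'n"
  assumes T: "T \<ge> 0" and d: "H1_deriv T \<gamma> \<gamma>'"
    and ode: "AE t in leb T. L2_apply \<gamma>' t = a (\<gamma> t) + b (\<gamma> t) *v L2_apply v t"
    and C: "\<And>x. norm (a x) \<le> C * (1 + norm x)" "\<And>x. norm (b x) \<le> C * (1 + norm x)"
    and v: "norm v \<le> M" and R0: "norm (\<gamma> 0) \<le> R0"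
  shows "norm \<gamma> \<le> 2 * (1 + R0) * exp ((2 * (2 * C\<^sup>2 * (T + M\<^sup>2)) + 1) * T)" (is "_ \<le> ?R")
proof -
  have C0: "C \<ge> 0" using C(1)[of 0] norm_ge_zero[of "a 0"] by (simp del: norm_ge_zero)
  define k where "k t = indicator {0<..<T} t *\<^sub>R (C * (1 + norm (L2_apply v t)))" for t
  have k0: "k t \<ge> 0" for t using C0 by (simp add: k_def indicator_def)
  have v2: "integrable lborel (\<lambda>t. (norm (L2_apply v t))\<^sup>2)"
    using sq_integrable_L2_apply[of v] by (simp add: sq_integrable_def)
  define w where "w t = 2 * C\<^sup>2 * (indicator {0<..<T} t + (norm (L2_apply v t))\<^sup>2)" for t :: real
  have w: "integrable lborel w" unfolding w_def
    using T by (intro integrable_mult_right Bochner_Integration.integrable_add integrable_real_indicator v2) auto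
  have kw: "(norm (k t))\<^sup>2 \<le> w t" for t
  proof -
    have "(1 + norm (L2_apply v t))\<^sup>2 \<le> 2 * (1 + (norm (L2_apply v t))\<^sup>2)"
      using sum_squares_bound[of 1 "norm (L2_apply v t)"] by (simp add: power2_sum)
    then have "C\<^sup>2 * (1 + norm (L2_apply v t))\<^sup>2 \<le> C\<^sup>2 * (2 * (1 + (norm (L2_apply v t))\<^sup>2))"
      by (rule mult_left_mono) simp
    also have "\<dots> = 2 * (C\<^sup>2 * (1 + (norm (L2_apply v t))\<^sup>2))" by (rule mult.left_commute)
    finally show ?thesis
      by (auto simp: k_def w_def indicator_def power_mult_distrib mult_ac)
  qed
  have k: "sq_integrable k"
  proof (rule sq_integrable_bound[OF _ w])
    show "k \<in> borel_measurable borel" unfolding k_def by measurable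
  qed (use kw in simp)
  have "(LINT t|lborel. (k t)\<^sup>2) \<le> integral\<^sup>L lborel w"
    using k w kw by (intro integral_mono) (auto simp: sq_integrable_def)
  also have "\<dots> = 2 * C\<^sup>2 * (T + (norm v)\<^sup>2)"
    unfolding w_def[abs_def] using T by (simp add: v2 norm_L2fun_eq)
  also have "\<dots> \<le> 2 * C\<^sup>2 * (T + M\<^sup>2)" using v by (intro mult_left_mono add_left_mono power_mono) auto
  finally have kB: "(LINT t|lborel. (k t)\<^sup>2) \<le> 2 * C\<^sup>2 * (T + M\<^sup>2)" .
  define u where "u t = 1 + norm (\<gamma> t)" for t
  have u: "continuous_on {0..T} u" unfolding u_def by (intro continuous_intros) auto
  have le: "u t \<le> (1 + R0) + (LINT s:{0..t}|lborel. k s * u s)" if t: "t \<in> {0..T}" for t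
  proof -
    have ku: "integrable lborel (\<lambda>s. indicator {0..t} s *\<^sub>R (k s * u s))"
      using sq_integrable_inner[OF k sq_integrable_continuous_bounded[OF u, of "{0..t}"]] t
      by (simp add: mult_ac)
    have AEle: "AE s in lborel. norm (indicator {0..t} s *\<^sub>R L2_apply \<gamma>' s) \<le> indicator {0..t} s *\<^sub>R (k s * u s)"
    proof -
      have "AE s in lborel. s \<in> {0<..<T} \<longrightarrow> L2_apply \<gamma>' s = a (\<gamma> s) + b (\<gamma> s) *v L2_apply v s"
        using ode by (subst (asm) AE_restrict_space_iff) auto
      moreover have "AE s in lborel. s \<notin> {0<..<T} \<longrightarrow> L2_apply \<gamma>' s = 0"
        using d by (simp add: H1_deriv_def L2_on_def)
      ultimately show ?thesis
      proof eventually_elim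
        case (elim s)
        show ?case
        proof (cases "s \<in> {0<..<T}")
          case True
          have "norm (a (\<gamma> s) + b (\<gamma> s) *v L2_apply v s) \<le> norm (a (\<gamma> s)) + norm (b (\<gamma> s)) * norm (L2_apply v s)"
            by (intro norm_triangle_le add_left_mono norm_matrix_vector_le)
          also have "\<dots> \<le> C * (1 + norm (\<gamma> s)) + C * (1 + norm (\<gamma> s)) * norm (L2_apply v s)"
            by (intro add_mono mult_right_mono C) auto
          also have "\<dots> = k s * u s" using True by (simp add: k_def u_def algebra_simps)
          finally show ?thesis using True elim by (auto simp: indicator_def)
        next
          case False
          then show ?thesis using elim k0[of s] by (simp add: u_def indicator_def)
        qed
      qed
    qed
    have "norm (LINT s:{0..t}|lborel. L2_apply \<gamma>' s) \<le> (LINT s:{0..t}|lborel. k s * u s)"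
      unfolding set_lebesgue_integral_def
      by (rule order_trans[OF integral_norm_bound], rule integral_mono_AE'[OF ku AEle])
        (use k0 in \<open>simp add: u_def\<close>)
    moreover have "\<gamma> t = \<gamma> 0 + (LINT s:{0..t}|lborel. L2_apply \<gamma>' s)"
      using d t unfolding H1_deriv_def by blast
    then have "norm (\<gamma> t) \<le> norm (\<gamma> 0) + norm (LINT s:{0..t}|lborel. L2_apply \<gamma>' s)"
      by (metis norm_triangle_ineq)
    ultimately show ?thesis using R0 by (simp add: u_def)
  qed
  have R0': "0 \<le> R0" using R0 by (rule order_trans[rotated]) simp
  have bd: "u t \<le> ?R" if "t \<in> {0..T}" for t
    by (rule gronwall_sq_integrable[OF T u _ k k0 _ le kB that]) (use R0' in \<open>auto simp: u_def\<close>)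
  show ?thesis
  proof (rule norm_bound)
    fix t
    have "\<gamma> t = \<gamma> (max 0 (min T t))" using d unfolding H1_deriv_def by blast
    moreover have "max 0 (min T t) \<in> {0..T}" using T by auto
    from bd[OF this] have "norm (\<gamma> (max 0 (min T t))) \<le> ?R" by (simp add: u_def)
    ultimately show "norm (\<gamma> t) \<le> ?R" by simp
  qed
qed

section \<open>The velocity as a function of trajectory and control\<close>

text \<open>
  On admissible pairs this is the derivative of the trajectory. Differentiation is not continuous for
  the supremum norm; the right-hand side of the state equation is.
\<close>

definition velocity ::
  "real \<Rightarrow> (real^'n::finite \<Rightarrow> real^'n) \<Rightarrow> (real^'n \<Rightarrow> real^'m::finite^'n) \<Rightarrow> ('n, 'm) pair \<Rightarrow> (real^'n) L2fun"
  where "velocity T a b p =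
    abs_L2fun (\<lambda>t. indicator {0<..<T} t *\<^sub>R (a (apply_bcontfun (fst p) t) + b (apply_bcontfun (fst p) t) *v L2_apply (snd p) t))"

lemma continuous_bounded_on_ball:
  fixes f :: "'a::euclidean_space \<Rightarrow> 'b::real_normed_vector"
  assumes "continuous_on UNIV f"
  obtains D where "D \<ge> 0" "\<And>x. norm x \<le> R \<Longrightarrow> norm (f x) \<le> D"
proof -
  have "compact (f ` cball 0 R)"
    by (intro compact_continuous_image continuous_on_subset[OF assms]) auto
  then obtain D where D: "\<And>x. norm x \<le> R \<Longrightarrow> norm (f x) \<le> D"
    using compact_imp_bounded[of "f ` cball 0 R"] unfolding bounded_iff by (metis imageI mem_cball_0)
  show thesis by (rule that[of "max D 0"]) (use D in \<open>auto simp: le_max_iff_disj\<close>)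
qed

lemma sq_integrable_drift:
  fixes a :: "real^'n::finite \<Rightarrow> real^'n"
  assumes a: "continuous_on UNIV a"
  shows "sq_integrable (\<lambda>t. indicator {0<..<T} t *\<^sub>R a (apply_bcontfun \<gamma> t))"
proof (rule sq_integrable_continuous_bounded[where T=T])
  show "continuous_on {0..T} (\<lambda>t. a (\<gamma> t))" by (rule continuous_on_compose2[OF a]) auto
qed auto

lemma measurable_matrix_vector [measurable (raw)]:
  fixes A :: "'a \<Rightarrow> real^'m::finite^'n::finite"
  assumes "A \<in> borel_measurable M" "x \<in> borel_measurable M"
  shows "(\<lambda>t. A t *v x t) \<in> borel_measurable M"
proof -
  have "bounded_bilinear ((*v) :: real^'m^'n \<Rightarrow> _)"
  proof
    show "\<exists>K. \<forall>(A::real^'m^'n) x. norm (A *v x) \<le> norm A * norm x * K"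
      by (rule exI[of _ 1]) (simp add: norm_matrix_vector_le)
  qed (simp_all add: matrix_vector_mult_add_rdistrib matrix_vector_right_distrib
      scaleR_matrix_vector_assoc matrix_vector_mult_scaleR)
  from bounded_bilinear.continuous_on[OF this, of UNIV fst snd]
  have "continuous_on UNIV (\<lambda>p::(real^'m^'n) \<times> _. fst p *v snd p)"
    by (simp add: continuous_on_fst continuous_on_snd continuous_on_id)
  from measurable_compose[OF borel_measurable_Pair[OF assms] borel_measurable_continuous_onI[OF this]]
  show ?thesis by simp
qed

lemma sq_integrable_control:
  fixes b :: "real^'n::finite \<Rightarrow> real^'m::finite^'n"
  assumes b: "continuous_on UNIV b"
    and D: "\<And>t. norm (b (apply_bcontfun \<gamma> t)) \<le> D"
  shows "sq_integrable (\<lambda>t. indicator {0<..<T} t *\<^sub>R (b (\<gamma> t) *v L2_apply v t))" (is "sq_integrable ?f")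
    and "norm (abs_L2fun (\<lambda>t. indicator {0<..<T} t *\<^sub>R (b (\<gamma> t) *v L2_apply v t))) \<le> D * norm v"
proof -
  have D0: "D \<ge> 0" using D[of 0] norm_ge_zero[of "b (\<gamma> 0)"] by linarith
  have "continuous_on UNIV (\<lambda>t. b (\<gamma> t))"
    by (rule continuous_on_compose2[OF b]) auto
  then have [measurable]: "(\<lambda>t. b (\<gamma> t)) \<in> borel_measurable borel"
    by (rule borel_measurable_continuous_onI)
  have iw: "integrable lborel (\<lambda>t. D\<^sup>2 * (norm (L2_apply v t))\<^sup>2)"
    using sq_integrable_L2_apply[of v] by (simp add: sq_integrable_def)
  have le: "(norm (?f t))\<^sup>2 \<le> D\<^sup>2 * (norm (L2_apply v t))\<^sup>2" for t
  proof -
    have "norm (b (\<gamma> t) *v L2_apply v t) \<le> norm (b (\<gamma> t)) * norm (L2_apply v t)"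
      by (rule norm_matrix_vector_le)
    also have "\<dots> \<le> D * norm (L2_apply v t)" by (intro mult_right_mono D) auto
    finally have "norm (?f t) \<le> D * norm (L2_apply v t)" using D0 by (auto simp: indicator_def)
    then have "(norm (?f t))\<^sup>2 \<le> (D * norm (L2_apply v t))\<^sup>2" by (rule power_mono) simp
    then show ?thesis by (simp add: power_mult_distrib)
  qed
  show sq: "sq_integrable ?f"
    by (rule sq_integrable_bound[OF _ iw]) (use le in \<open>auto intro!: always_eventually\<close>)
  have "(norm (abs_L2fun ?f))\<^sup>2 \<le> (LINT t|lborel. D\<^sup>2 * (norm (L2_apply v t))\<^sup>2)"
    unfolding norm_abs_L2fun[OF sq]
    using sq by (intro integral_mono iw le) (simp add: sq_integrable_def)
  also have "\<dots> = (D * norm v)\<^sup>2" by (simp add: norm_L2fun_eq power_mult_distrib)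
  finally show "norm (abs_L2fun ?f) \<le> D * norm v"
    by (rule power2_le_imp_le) (use D0 in simp)
qed

lemma velocity_eq_sum:
  fixes b :: "real^'n::finite \<Rightarrow> real^'m::finite^'n"
  assumes a: "continuous_on UNIV a" and b: "continuous_on UNIV b"
  shows "velocity T a b (\<gamma>, v) = abs_L2fun (\<lambda>t. indicator {0<..<T} t *\<^sub>R a (\<gamma> t))
    + abs_L2fun (\<lambda>t. indicator {0<..<T} t *\<^sub>R (b (\<gamma> t) *v L2_apply v t))"
proof -
  obtain D where D: "\<And>x. norm x \<le> norm \<gamma> \<Longrightarrow> norm (b x) \<le> D"
    using continuous_bounded_on_ball[OF b] by metis
  have "sq_integrable (\<lambda>t. indicator {0<..<T} t *\<^sub>R (b (\<gamma> t) *v L2_apply v t))"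
    by (rule sq_integrable_control(1)[OF b D]) (rule norm_bounded)
  from abs_L2fun_add[OF sq_integrable_drift[OF a] this] show ?thesis
    by (simp add: velocity_def scaleR_add_right)
qed

text \<open>
  The controls converge in norm only, so the control term is split into a fixed control with varying
  coefficient, which converges by domination, and a null sequence of controls with bounded coefficient.
\<close>

lemma continuous_velocity:
  fixes b :: "real^'n::finite \<Rightarrow> real^'m::finite^'n"
  assumes a: "continuous_on UNIV a" and b: "continuous_on UNIV b"
  shows "continuous_on UNIV (velocity T a b)"
proof (rule continuous_on_sequentiallyI)
  fix p and q :: "('n, 'm) pair"
  assume "p \<longlonglongrightarrow> q"
  then have g: "(\<lambda>k. fst (p k)) \<longlonglongrightarrow> fst q" and v: "(\<lambda>k. snd (p k)) \<longlonglongrightarrow> snd q"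
    by (auto intro: tendsto_fst tendsto_snd)
  define \<gamma> where "\<gamma> = fst q"
  define w where "w = snd q"
  define gk where "gk k = fst (p k)" for k
  define vk where "vk k = snd (p k)" for k
  have gt: "(\<lambda>k. gk k t) \<longlonglongrightarrow> \<gamma> t" for t
    by (rule continuous_on_tendsto_compose[OF continuous_apply_bcontfun]) (use g in \<open>auto simp: gk_def \<gamma>_def\<close>)
  obtain R where R: "\<And>k. norm (gk k) \<le> R"
    using Bseq_def convergent_imp_Bseq[of gk] g unfolding gk_def convergent_def by metis
  have gR: "norm (gk k t) \<le> R" for k t using norm_bounded[of "gk k" t] R[of k] by simp
  have \<gamma>R: "norm (\<gamma> t) \<le> R" for t
    by (rule Lim_bounded[OF tendsto_norm[OF gt]]) (use gR in auto)
  obtain Da where Da: "\<And>x. norm x \<le> R \<Longrightarrow> norm (a x) \<le> Da"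
    using continuous_bounded_on_ball[OF a] by metis
  obtain Db where Db0: "Db \<ge> 0" and Db: "\<And>x. norm x \<le> R \<Longrightarrow> norm (b x) \<le> Db"
    using continuous_bounded_on_ball[OF b] by metis
  let ?I = "\<lambda>t. indicator {0<..<T} t :: real"
  have 1: "(\<lambda>k. abs_L2fun (\<lambda>t. ?I t *\<^sub>R a (gk k t))) \<longlonglongrightarrow> abs_L2fun (\<lambda>t. ?I t *\<^sub>R a (\<gamma> t))"
  proof (rule tendsto_abs_L2fun)
    show "(\<lambda>k. ?I t *\<^sub>R a (gk k t)) \<longlonglongrightarrow> ?I t *\<^sub>R a (\<gamma> t)" for t
      by (intro tendsto_scaleR tendsto_const continuous_on_tendsto_compose[OF a gt]) auto
    show "sq_integrable (\<lambda>t. ?I t *\<^sub>R Da)"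
    proof (rule sq_integrable_bound)
      show "integrable lborel (\<lambda>t. Da\<^sup>2 * ?I t)"
        by (intro integrable_mult_right integrable_real_indicator) (auto intro!: emeasure_bounded_finite[unfolded infinity_ennreal_def])
      show "AE t in lborel. (norm (?I t *\<^sub>R Da))\<^sup>2 \<le> Da\<^sup>2 * ?I t"
        by (auto simp: indicator_def)
    qed measurable
    show "norm (?I t *\<^sub>R a (gk k t)) \<le> ?I t *\<^sub>R Da" for k t
      using Da[OF gR] by (auto simp: indicator_def)
  qed (rule sq_integrable_drift[OF a])+
  have 2: "(\<lambda>k. abs_L2fun (\<lambda>t. ?I t *\<^sub>R (b (gk k t) *v L2_apply w t)))
      \<longlonglongrightarrow> abs_L2fun (\<lambda>t. ?I t *\<^sub>R (b (\<gamma> t) *v L2_apply w t))"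
  proof (rule tendsto_abs_L2fun)
    show "sq_integrable (\<lambda>t. Db * norm (L2_apply w t))"
      using sq_integrable_L2_apply[of w] by (auto simp: sq_integrable_def power_mult_distrib)
    show "norm (?I t *\<^sub>R (b (gk k t) *v L2_apply w t)) \<le> Db * norm (L2_apply w t)" for k t
      using norm_matrix_vector_le[of "b (gk k t)" "L2_apply w t"]
        mult_right_mono[OF Db[OF gR[of k t]], of "norm (L2_apply w t)"] Db0
      by (auto simp: indicator_def)
    have "(\<lambda>k. b (gk k t) *v L2_apply w t) \<longlonglongrightarrow> b (\<gamma> t) *v L2_apply w t" for t
    proof (rule LIM_zero_cancel, rule Lim_null_comparison)
      have "(\<lambda>k. b (gk k t) - b (\<gamma> t)) \<longlonglongrightarrow> 0"
        by (intro LIM_zero continuous_on_tendsto_compose[OF b gt]) auto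
      then show "(\<lambda>k. norm (b (gk k t) - b (\<gamma> t)) * norm (L2_apply w t)) \<longlonglongrightarrow> 0"
        by (intro tendsto_mult_left_zero tendsto_norm_zero)
      show "\<forall>\<^sub>F k in sequentially. norm (b (gk k t) *v L2_apply w t - b (\<gamma> t) *v L2_apply w t)
          \<le> norm (b (gk k t) - b (\<gamma> t)) * norm (L2_apply w t)"
        using norm_matrix_vector_le[of "b (gk _ t) - b (\<gamma> t)" "L2_apply w t"]
        by (intro always_eventually) (auto simp: matrix_vector_mult_diff_rdistrib)
    qed
    then show "(\<lambda>k. ?I t *\<^sub>R (b (gk k t) *v L2_apply w t)) \<longlonglongrightarrow> ?I t *\<^sub>R (b (\<gamma> t) *v L2_apply w t)" for t
      by (intro tendsto_scaleR tendsto_const)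
  qed (rule sq_integrable_control(1)[OF b Db], rule gR \<gamma>R)+
  have 3: "(\<lambda>k. abs_L2fun (\<lambda>t. ?I t *\<^sub>R (b (gk k t) *v L2_apply (vk k - w) t))) \<longlonglongrightarrow> 0"
  proof (rule Lim_null_comparison)
    show "(\<lambda>k. Db * norm (vk k - w)) \<longlonglongrightarrow> 0"
      using v by (intro tendsto_mult_right_zero tendsto_norm_zero LIM_zero) (simp add: vk_def w_def)
    show "\<forall>\<^sub>F k in sequentially. norm (abs_L2fun (\<lambda>t. ?I t *\<^sub>R (b (gk k t) *v L2_apply (vk k - w) t)))
        \<le> Db * norm (vk k - w)"
      by (intro always_eventually allI sq_integrable_control(2)[OF b Db]) (rule gR)
  qed
  have eq: "velocity T a b (p k) = abs_L2fun (\<lambda>t. ?I t *\<^sub>R a (gk k t))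
    + (abs_L2fun (\<lambda>t. ?I t *\<^sub>R (b (gk k t) *v L2_apply w t))
    + abs_L2fun (\<lambda>t. ?I t *\<^sub>R (b (gk k t) *v L2_apply (vk k - w) t)))" for k
  proof -
    have sq: "sq_integrable (\<lambda>t. ?I t *\<^sub>R (b (gk k t) *v L2_apply u t))" for u
      by (rule sq_integrable_control(1)[OF b Db]) (rule gR)
    have "abs_L2fun (\<lambda>t. ?I t *\<^sub>R (b (gk k t) *v L2_apply (vk k) t))
      = abs_L2fun (\<lambda>t. ?I t *\<^sub>R (b (gk k t) *v L2_apply w t))
        + abs_L2fun (\<lambda>t. ?I t *\<^sub>R (b (gk k t) *v L2_apply (vk k - w) t))" (is "?l = ?r1 + ?r2")
    proof (rule L2fun_eqI)
      show "AE t in lborel. L2_apply ?l t = L2_apply (?r1 + ?r2) t"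
        using AE_abs_L2fun[OF sq[of "vk k"]] AE_abs_L2fun[OF sq[of w]] AE_abs_L2fun[OF sq[of "vk k - w"]]
          AE_L2_apply_add[of ?r1 ?r2] AE_L2_apply_diff[of "vk k" w]
        by eventually_elim (simp add: matrix_vector_mult_diff_distrib algebra_simps)
    qed
    then show ?thesis using velocity_eq_sum[OF a b, of T "gk k" "vk k"] by (simp add: gk_def vk_def)
  qed
  have "(\<lambda>k. velocity T a b (p k)) \<longlonglongrightarrow> abs_L2fun (\<lambda>t. ?I t *\<^sub>R a (\<gamma> t))
    + (abs_L2fun (\<lambda>t. ?I t *\<^sub>R (b (\<gamma> t) *v L2_apply w t)) + 0)"
    unfolding eq by (intro tendsto_add 1 2 3)
  then show "(\<lambda>k. velocity T a b (p k)) \<longlonglongrightarrow> velocity T a b q"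
    using velocity_eq_sum[OF a b, of T \<gamma> w] by (simp add: \<gamma>_def w_def)
qed

text \<open>
  This is the retraction that makes measures on admissible pairs tight.
\<close>

lemma pair_of_data_velocity:
  fixes b :: "real^'n::finite \<Rightarrow> real^'m::finite^'n"
  assumes T: "T \<ge> 0" and a: "continuous_on UNIV a" and b: "continuous_on UNIV b"
    and p: "p \<in> admissible T a b c g1 g2 x0"
  shows "pair_of_data T ((apply_bcontfun (fst p) 0, velocity T a b p), snd p) = p"
proof -
  obtain \<gamma> v where pv: "p = (\<gamma>, v)" by (cases p)
  obtain \<gamma>' where d: "H1_deriv T \<gamma> \<gamma>'" and v: "v \<in> L2_on T"
    and ode: "AE t in leb T. L2_apply \<gamma>' t = a (\<gamma> t) + b (\<gamma> t) *v L2_apply v t"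
    using p by (auto simp: admissible_def pv)
  obtain D where D: "\<And>x. norm x \<le> norm \<gamma> \<Longrightarrow> norm (b x) \<le> D"
    using continuous_bounded_on_ball[OF b] by metis
  have "sq_integrable (\<lambda>t. indicator {0<..<T} t *\<^sub>R (b (\<gamma> t) *v L2_apply v t))"
    by (rule sq_integrable_control(1)[OF b D]) (rule norm_bounded)
  from sq_integrable_add[OF sq_integrable_drift[OF a] this]
  have sq: "sq_integrable (\<lambda>t. indicator {0<..<T} t *\<^sub>R (a (\<gamma> t) + b (\<gamma> t) *v L2_apply v t))"
    by (simp add: scaleR_add_right)
  have "velocity T a b p = \<gamma>'"
  proof (rule L2fun_eqI)
    have "AE s in lborel. s \<in> {0<..<T} \<longrightarrow> L2_apply \<gamma>' s = a (\<gamma> s) + b (\<gamma> s) *v L2_apply v s"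
      using ode by (subst (asm) AE_restrict_space_iff) auto
    moreover have "AE s in lborel. s \<notin> {0<..<T} \<longrightarrow> L2_apply \<gamma>' s = 0"
      using d by (simp add: H1_deriv_def L2_on_def)
    ultimately show "AE t in lborel. L2_apply (velocity T a b p) t = L2_apply \<gamma>' t"
      using AE_abs_L2fun[OF sq] by eventually_elim (auto simp: velocity_def pv indicator_def)
  qed
  then show ?thesis
    by (simp add: pair_of_data_def restrict_L2_ident[OF v] pv primitive_of_deriv[OF T d])
qed

section \<open>Measurability and lower semicontinuity of the cost\<close>

text \<open>
  Meant for evaluation of trajectories. The space of bounded continuous functions is not second
  countable, so that continuity of the evaluation map does not yield measurability for the product
  \<open>\<sigma>\<close>-algebra; discretisation of time does.
\<close>

lemma measurable_pair_continuous:
  fixes X :: "'a \<Rightarrow> real \<Rightarrow> 'b::metric_space"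
  assumes X: "\<And>t. (\<lambda>p. X p t) \<in> borel_measurable M" and cont: "\<And>p. continuous_on UNIV (X p)"
  shows "(\<lambda>(p, t). X p t) \<in> borel_measurable (M \<Otimes>\<^sub>M borel)"
proof (rule borel_measurable_LIMSEQ_metric)
  define X' where "X' n z = X (fst z) (real_of_int \<lfloor>real (Suc n) * snd z\<rfloor> / real (Suc n))" for n z
  show "X' n \<in> borel_measurable (M \<Otimes>\<^sub>M borel)" for n
    unfolding X'_def
  proof (rule measurable_compose_countable[where f="\<lambda>i z. X (fst z) (real_of_int i / real (Suc n))"])
    show "(\<lambda>z. X (fst z) (real_of_int i / real (Suc n))) \<in> borel_measurable (M \<Otimes>\<^sub>M borel)" for i
      by (rule measurable_compose[OF measurable_fst X])
  qed measurable
  fix z :: "'a \<times> real"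
  have lim: "(\<lambda>n. real_of_int \<lfloor>real (Suc n) * t\<rfloor> / real (Suc n)) \<longlonglongrightarrow> t" for t
  proof (rule tendsto_sandwich)
    show "(\<lambda>n. t - inverse (real (Suc n))) \<longlonglongrightarrow> t"
      using tendsto_diff[OF tendsto_const[of t] LIMSEQ_inverse_real_of_nat] by simp
    show "\<forall>\<^sub>F n in sequentially. t - inverse (real (Suc n)) \<le> real_of_int \<lfloor>real (Suc n) * t\<rfloor> / real (Suc n)"
    proof (rule always_eventually, rule allI)
      fix n
      have "real (Suc n) * t - 1 \<le> real_of_int \<lfloor>real (Suc n) * t\<rfloor>" by linarith
      from divide_right_mono[OF this, of "real (Suc n)"]
      show "t - inverse (real (Suc n)) \<le> real_of_int \<lfloor>real (Suc n) * t\<rfloor> / real (Suc n)"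
        by (simp add: diff_divide_distrib inverse_eq_divide del: of_nat_Suc)
    qed
    show "\<forall>\<^sub>F n in sequentially. real_of_int \<lfloor>real (Suc n) * t\<rfloor> / real (Suc n) \<le> t"
    proof (rule always_eventually, rule allI)
      fix n
      have "real_of_int \<lfloor>real (Suc n) * t\<rfloor> \<le> real (Suc n) * t" by linarith
      from divide_right_mono[OF this, of "real (Suc n)"]
      show "real_of_int \<lfloor>real (Suc n) * t\<rfloor> / real (Suc n) \<le> t" by (simp del: of_nat_Suc)
    qed
  qed auto
  show "(\<lambda>n. X' n z) \<longlonglongrightarrow> (case z of (p, t) \<Rightarrow> X p t)"
    unfolding X'_def split_beta
    by (rule continuous_on_tendsto_compose[OF cont lim]) auto
qed

lemma continuous_eval: "continuous_on UNIV (\<lambda>p::('n::finite, 'm::finite) pair. apply_bcontfun (fst p) t)"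
  by (rule continuous_on_compose2[OF continuous_apply_bcontfun continuous_on_fst[OF continuous_on_id]]) auto

lemma L2_tendsto_AE_subseq:
  fixes v :: "nat \<Rightarrow> 'b::euclidean_space L2fun"
  assumes "v \<longlonglongrightarrow> w"
  shows "\<exists>r. strict_mono r \<and> (AE t in lborel. (\<lambda>k. L2_apply (v (r k)) t) \<longlonglongrightarrow> L2_apply w t)"
proof -
  define u where "u k t = (norm (L2_apply (v k) t - L2_apply w t))\<^sup>2" for k t
  have sq: "sq_integrable (\<lambda>t. L2_apply (v k) t - L2_apply w t)" for k
    by (rule sq_integrable_diff) auto
  have "(LINT t|lborel. norm (u k t)) = (norm (v k - w))\<^sup>2" for k
    using norm_abs_L2fun[OF sq[of k]] by (simp add: u_def abs_L2fun_diff[symmetric])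
  then have "(\<lambda>k. LINT t|lborel. norm (u k t)) = (\<lambda>k. (norm (v k - w))\<^sup>2)"
    by simp
  moreover have "(\<lambda>k. (norm (v k - w))\<^sup>2) \<longlonglongrightarrow> 0"
    using tendsto_power[OF tendsto_norm_zero[OF LIM_zero[OF assms]], of 2] by simp
  ultimately have "(\<lambda>k. LINT t|lborel. norm (u k t)) \<longlonglongrightarrow> 0" by simp
  moreover have "integrable lborel (u k)" for k
    using sq[of k] by (simp add: sq_integrable_def u_def[abs_def])
  ultimately obtain r where r: "strict_mono r" "AE t in lborel. (\<lambda>k. u (r k) t) \<longlonglongrightarrow> 0"
    using tendsto_L1_AE_subseq[of lborel u] by blast
  have "AE t in lborel. (\<lambda>k. L2_apply (v (r k)) t) \<longlonglongrightarrow> L2_apply w t"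
    using r(2)
  proof eventually_elim
    case (elim t)
    from tendsto_real_sqrt[OF this]
    have "(\<lambda>k. norm (L2_apply (v (r k)) t - L2_apply w t)) \<longlonglongrightarrow> 0" by (simp add: u_def)
    then show ?case by (simp add: LIM_zero_iff tendsto_norm_zero_iff)
  qed
  with r(1) show ?thesis by blast
qed

lemma emeasure_leb: "T \<ge> 0 \<Longrightarrow> emeasure (leb T) {0<..<T} = ennreal T"
  by (subst emeasure_restrict_space) auto

lemma finite_measure_leb: "T \<ge> 0 \<Longrightarrow> finite_measure (leb T)"
  by (rule finite_measureI) (simp add: space_restrict_space emeasure_leb)

lemma measure_leb: "T \<ge> 0 \<Longrightarrow> measure (leb T) {0<..<T} = T"
  by (simp add: measure_def emeasure_leb)

text \<open>
  Fatou's lemma along a subsequence for which the controls converge almost everywhere; the lower bound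
  \<open>- D\<close> is available because the trajectories stay in a common ball. The bounds \<open>\<beta> k\<close> may vary to
  accommodate a terminal cost that depends on the trajectory.
\<close>

lemma running_cost_lsc:
  fixes j :: "'x::euclidean_space \<Rightarrow> 'v::euclidean_space \<Rightarrow> real \<Rightarrow> real"
    and \<gamma> :: "nat \<Rightarrow> real \<Rightarrow>\<^sub>C 'x"
  assumes T: "T \<ge> 0"
    and cont: "\<And>t. t \<in> {0<..<T} \<Longrightarrow> continuous_on UNIV (\<lambda>(x, v). j x v t)"
    and low: "\<And>x v t. t \<in> {0<..<T} \<Longrightarrow> norm x \<le> R \<Longrightarrow> - D \<le> j x v t"
    and \<gamma>: "\<gamma> \<longlonglongrightarrow> \<gamma>0" and v: "v \<longlonglongrightarrow> v0" and R: "\<And>k. norm (\<gamma> k) \<le> R"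
    and int: "\<And>k. integrable (leb T) (\<lambda>t. j (\<gamma> k t) (L2_apply (v k) t) t)"
      "integrable (leb T) (\<lambda>t. j (\<gamma>0 t) (L2_apply v0 t) t)"
    and le: "\<And>k. (LINT t|leb T. j (\<gamma> k t) (L2_apply (v k) t) t) \<le> \<beta> k" and \<beta>: "\<beta> \<longlonglongrightarrow> \<beta>0"
  shows "(LINT t|leb T. j (\<gamma>0 t) (L2_apply v0 t) t) \<le> \<beta>0"
proof -
  interpret finite_measure "leb T" by (rule finite_measure_leb[OF T])
  obtain r where r: "strict_mono r" and
    AEv: "AE t in lborel. (\<lambda>k. L2_apply (v (r k)) t) \<longlonglongrightarrow> L2_apply v0 t"
    using L2_tendsto_AE_subseq[OF v] by blast
  define h where "h k t = j (\<gamma> (r k) t) (L2_apply (v (r k)) t) t + D" for k t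
  define h0 where "h0 t = j (\<gamma>0 t) (L2_apply v0 t) t + D" for t
  have ih: "integrable (leb T) (h k)" for k unfolding h_def by (intro Bochner_Integration.integrable_add int) auto
  have ih0: "integrable (leb T) h0" unfolding h0_def by (intro Bochner_Integration.integrable_add int) auto
  have h: "integral\<^sup>L (leb T) (h k) = (LINT t|leb T. j (\<gamma> (r k) t) (L2_apply (v (r k)) t) t) + D * T" for k
    unfolding h_def[abs_def] using int by (simp add: space_restrict_space measure_leb[OF T])
  have h0: "integral\<^sup>L (leb T) h0 = (LINT t|leb T. j (\<gamma>0 t) (L2_apply v0 t) t) + D * T"
    unfolding h0_def[abs_def] using int by (simp add: space_restrict_space measure_leb[OF T])
  have gt: "(\<lambda>k. \<gamma> (r k) t) \<longlonglongrightarrow> \<gamma>0 t" for t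
    by (rule continuous_on_tendsto_compose[OF continuous_apply_bcontfun])
      (use LIMSEQ_subseq_LIMSEQ[OF \<gamma> r] in \<open>auto simp: comp_def\<close>)
  have lim: "AE t in leb T. (\<lambda>k. h k t) \<longlonglongrightarrow> h0 t"
  proof -
    have "AE t in lborel. t \<in> {0<..<T} \<longrightarrow> (\<lambda>k. h k t) \<longlonglongrightarrow> h0 t"
      using AEv
    proof eventually_elim
      case (elim t)
      show ?case
      proof
        assume "t \<in> {0<..<T}"
        from continuous_on_tendsto_compose[OF cont[OF this] tendsto_Pair[OF gt elim]]
        show "(\<lambda>k. h k t) \<longlonglongrightarrow> h0 t" unfolding h_def h0_def by (intro tendsto_add) auto
      qed
    qed
    then show ?thesis by (subst AE_restrict_space_iff) auto
  qed
  have h_nonneg: "AE t in leb T. 0 \<le> h k t" for k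
  proof (rule AE_I2)
    fix t assume "t \<in> space (leb T)"
    then have t: "t \<in> {0<..<T}" by (simp add: space_restrict_space)
    have "norm (\<gamma> (r k) t) \<le> R" using norm_bounded[of "\<gamma> (r k)" t] R[of "r k"] by simp
    from low[OF t this, of "L2_apply (v (r k)) t"] show "0 \<le> h k t" by (simp add: h_def)
  qed
  have h0_nonneg: "AE t in leb T. 0 \<le> h0 t"
    using lim AE_all_countable[THEN iffD2, OF allI[of "\<lambda>k. AE t in leb T. 0 \<le> h k t", OF h_nonneg]]
    by eventually_elim (auto intro: LIMSEQ_le_const)
  have hk: "(\<integral>\<^sup>+t. ennreal (h k t) \<partial>leb T) \<le> ennreal (\<beta> (r k) + D * T)" for k
    using le[of "r k"] unfolding nn_integral_eq_integral[OF ih h_nonneg] h by (intro ennreal_leI) simp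
  have nonneg: "0 \<le> \<beta> (r k) + D * T" for k
    using integral_nonneg_AE[OF h_nonneg[of k]] le[of "r k"] unfolding h by simp
  have \<beta>r: "(\<lambda>k. \<beta> (r k) + D * T) \<longlonglongrightarrow> \<beta>0 + D * T"
    using LIMSEQ_subseq_LIMSEQ[OF \<beta> r] by (intro tendsto_add) (auto simp: comp_def)
  have nonneg0: "0 \<le> \<beta>0 + D * T"
    by (rule LIMSEQ_le_const[OF \<beta>r]) (use nonneg in auto)
  have "ennreal (integral\<^sup>L (leb T) h0) = (\<integral>\<^sup>+t. ennreal (h0 t) \<partial>leb T)"
    by (rule nn_integral_eq_integral[symmetric, OF ih0 h0_nonneg])
  also have "\<dots> = (\<integral>\<^sup>+t. liminf (\<lambda>k. ennreal (h k t)) \<partial>leb T)"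
  proof (rule nn_integral_cong_AE)
    show "AE t in leb T. ennreal (h0 t) = liminf (\<lambda>k. ennreal (h k t))"
      using lim
    proof eventually_elim
      case (elim t)
      from lim_imp_Liminf[OF _ tendsto_ennrealI[OF this]] show ?case by simp
    qed
  qed
  also have "\<dots> \<le> liminf (\<lambda>k. \<integral>\<^sup>+t. ennreal (h k t) \<partial>leb T)"
    using ih by (intro nn_integral_liminf) auto
  also have "\<dots> \<le> liminf (\<lambda>k. ennreal (\<beta> (r k) + D * T))"
    by (intro Liminf_mono always_eventually allI hk)
  also have "\<dots> = ennreal (\<beta>0 + D * T)"
    by (intro lim_imp_Liminf tendsto_ennrealI \<beta>r) simp
  finally have "integral\<^sup>L (leb T) h0 \<le> \<beta>0 + D * T"
    using nonneg0 by (simp add: ennreal_le_iff)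
  then show ?thesis unfolding h0 by simp
qed

section \<open>Curves of time marginals\<close>

lemma measurable_on_pairs:
  assumes "\<eta> \<in> P1 S" and "f \<in> borel_measurable borel"
  shows "f \<in> borel_measurable \<eta>"
proof -
  have "sets \<eta> = sets (restrict_space borel S)" using assms(1) by (simp add: P1_def)
  from measurable_cong_sets[OF this refl] show ?thesis
    using measurable_restrict_space1[OF assms(2)] by blast
qed

lemma measurable_eval:
  assumes "\<eta> \<in> P1 S"
  shows "(\<lambda>p::('n::finite, 'm::finite) pair. apply_bcontfun (fst p) t) \<in> borel_measurable \<eta>"
  by (rule measurable_on_pairs[OF assms borel_measurable_continuous_onI[OF continuous_eval]])

lemma m_eq_in_P1:
  fixes \<eta> :: "('n::finite, 'm::finite) pair measure"
  assumes \<eta>: "\<eta> \<in> P1 S"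
  shows "m_eq \<eta> t \<in> P1 UNIV"
proof -
  note [measurable] = measurable_eval[OF \<eta>]
  interpret prob_space \<eta> using \<eta> by (simp add: P1_def)
  have "integrable \<eta> (\<lambda>p. norm (apply_bcontfun (fst p) t))"
  proof (rule Bochner_Integration.integrable_bound)
    show "integrable \<eta> norm" using \<eta> by (simp add: P1_def)
    have "norm (apply_bcontfun (fst p) t) \<le> norm p" for p :: "('n, 'm) pair"
      using norm_bounded[of "fst p" t] norm_fst_le[of "fst p" "snd p"] by simp
    then show "AE p in \<eta>. norm (norm (apply_bcontfun (fst p) t)) \<le> norm (norm p)" by simp
  qed measurable
  then show ?thesis
    by (auto simp: P1_def m_eq_def split_beta sets_restrict_space integrable_distr_eq intro!: prob_space_distr)
qed

text \<open>
  Trajectories are continuous, so integrals of bounded continuous functions against the time marginals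
  are continuous in time by dominated convergence.
\<close>

lemma m_eq_in_curves:
  fixes \<eta> :: "('n::finite, 'm::finite) pair measure"
  assumes \<eta>: "\<eta> \<in> P1 S"
  shows "m_eq \<eta> \<in> curves T"
proof -
  note [measurable] = measurable_eval[OF \<eta>]
  interpret prob_space \<eta> using \<eta> by (simp add: P1_def)
  let ?S = "{{\<mu> \<in> P1 UNIV. (LINT x|\<mu>. \<phi> x) \<in> V} | (\<phi> :: real^'n \<Rightarrow> real) V.
      continuous_on UNIV \<phi> \<and> bounded (range \<phi>) \<and> open V}"
  have "openin (top_of_set {0..T}) (m_eq \<eta> -` U \<inter> topspace (top_of_set {0..T}))" if "U \<in> ?S" for U
  proof -
    from that obtain \<phi> :: "real^'n \<Rightarrow> real" and V where
      U: "U = {\<mu> \<in> P1 UNIV. (LINT x|\<mu>. \<phi> x) \<in> V}" and \<phi>: "continuous_on UNIV \<phi>"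
      and bd: "bounded (range \<phi>)" and V: "open V" by blast
    have [measurable]: "\<phi> \<in> borel_measurable borel" by (rule borel_measurable_continuous_onI[OF \<phi>])
    obtain D where D: "\<And>x. norm (\<phi> x) \<le> D" using bd unfolding bounded_iff by auto
    let ?h = "\<lambda>t. LINT p|\<eta>. \<phi> (apply_bcontfun (fst p) t)"
    have h: "continuous_on UNIV ?h"
    proof (rule continuous_on_sequentiallyI)
      fix s :: "nat \<Rightarrow> real" and t
      assume s: "s \<longlonglongrightarrow> t"
      show "(\<lambda>k. ?h (s k)) \<longlonglongrightarrow> ?h t"
      proof (rule integral_dominated_convergence)
        show "integrable \<eta> (\<lambda>_. D)" by simp
        have "(\<lambda>k. \<phi> (apply_bcontfun (fst p) (s k))) \<longlonglongrightarrow> \<phi> (apply_bcontfun (fst p) t)" for p :: "('n, 'm) pair"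
          by (intro continuous_on_tendsto_compose[OF \<phi>] continuous_on_tendsto_compose[OF _ s, of UNIV]) auto
        then show "AE p in \<eta>. (\<lambda>k. \<phi> (apply_bcontfun (fst p) (s k))) \<longlonglongrightarrow> \<phi> (apply_bcontfun (fst p) t)" by simp
        show "AE p in \<eta>. norm (\<phi> (apply_bcontfun (fst p) (s k))) \<le> D" for k using D by simp
      qed measurable
    qed
    have "m_eq \<eta> t \<in> U \<longleftrightarrow> ?h t \<in> V" for t
      unfolding U using m_eq_in_P1[OF \<eta>, of t] by (simp add: m_eq_def split_beta integral_distr)
    then have "m_eq \<eta> -` U \<inter> topspace (top_of_set {0..T}) = {0..T} \<inter> ?h -` V" by auto
    then show ?thesis
      using continuous_openin_preimage_gen[OF continuous_on_subset[OF h] V, of "{0..T}"] by simp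
  qed
  moreover
  have "P1 UNIV \<in> ?S"
  proof -
    have "P1 UNIV = {\<mu> \<in> P1 UNIV. (LINT x|\<mu>. (\<lambda>_::real^'n. 0::real) x) \<in> UNIV}" by simp
    moreover have "continuous_on UNIV (\<lambda>_::real^'n. 0::real)" "bounded (range (\<lambda>_::real^'n. 0::real))"
      by auto
    ultimately show ?thesis using open_UNIV by blast
  qed
  then have "m_eq \<eta> ` topspace (top_of_set {0..T}) \<subseteq> \<Union>?S" using m_eq_in_P1[OF \<eta>] by blast
  ultimately show ?thesis
    unfolding curves_def narrow_def mem_Collect_eq continuous_on_generated_topo_iff by blast
qed

lemma continuous_on_along_curve:
  fixes h :: "real^'n::finite \<Rightarrow> (real^'n) measure \<Rightarrow> real"
  assumes h: "continuous_map (prod_topology euclidean narrow) euclidean (\<lambda>(x, \<mu>). h x \<mu>)"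
    and m: "m \<in> curves T"
  shows "continuous_on (UNIV \<times> {0..T}) (\<lambda>(x, t). h x (m t))"
proof -
  have "continuous_map (prod_topology euclidean (top_of_set {0..T})) (prod_topology euclidean narrow)
      (\<lambda>z. (fst z, m (snd z)))"
    using m continuous_map_compose[OF continuous_map_snd, of "top_of_set {0..T}" narrow m]
    by (auto simp: curves_def comp_def intro!: continuous_map_pairedI continuous_map_fst)
  from continuous_map_compose[OF this h]
  have "continuous_map (prod_topology euclidean (top_of_set {0..T})) euclidean (\<lambda>(x, t). h x (m t))"
    by (simp add: comp_def case_prod_unfold)
  moreover have "prod_topology (euclidean :: (real^'n) topology) (top_of_set {0..T}) = top_of_set (UNIV \<times> {0..T})"
    using prod_topology_subtopology_eu[of "UNIV :: (real^'n) set" "{0..T}"] by simp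
  ultimately show ?thesis by simp
qed

section \<open>Time marginals and Fubini\<close>

lemma m_eq_eval: "m_eq \<eta> t = distr \<eta> borel (\<lambda>p. apply_bcontfun (fst p) t)"
  by (simp add: m_eq_def split_beta)

lemma AE_m_eq_iff:
  fixes \<eta> :: "('n::finite, 'm::finite) pair measure"
  assumes \<eta>: "\<eta> \<in> P1 S" and "Measurable.pred borel Q"
  shows "(AE x in m_eq \<eta> t. Q x) \<longleftrightarrow> (AE p in \<eta>. Q (apply_bcontfun (fst p) t))"
  unfolding m_eq_eval
  by (rule AE_distr_iff[OF measurable_eval[OF \<eta>]]) (use assms(2) in \<open>simp add: pred_def\<close>)

lemma integral_m_eq:
  fixes \<eta> :: "('n::finite, 'm::finite) pair measure" and h :: "real^'n \<Rightarrow> real"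
  assumes \<eta>: "\<eta> \<in> P1 S" and "h \<in> borel_measurable borel"
  shows "(LINT x|m_eq \<eta> t. h x) = (LINT p|\<eta>. h (apply_bcontfun (fst p) t))"
  using measurable_eval[OF \<eta>, of t] assms(2) by (simp add: m_eq_eval integral_distr)

lemma continuous_bounded_on_strip:
  fixes h :: "'a::euclidean_space \<Rightarrow> real \<Rightarrow> real"
  assumes "continuous_on (UNIV \<times> {0..T}) (\<lambda>(x, t). h x t)"
  obtains D where "D \<ge> 0" "\<And>x t. norm x \<le> R \<Longrightarrow> t \<in> {0..T} \<Longrightarrow> \<bar>h x t\<bar> \<le> D"
proof -
  have "compact ((\<lambda>(x, t). h x t) ` (cball 0 R \<times> {0..T}))"
    by (intro compact_continuous_image continuous_on_subset[OF assms] compact_Times) auto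
  from compact_imp_bounded[OF this] obtain D
    where D: "\<And>y. y \<in> (\<lambda>(x, t). h x t) ` (cball 0 R \<times> {0..T}) \<Longrightarrow> norm y \<le> D"
    unfolding bounded_iff by blast
  show thesis
  proof (rule that[of "max D 0"])
    show "\<bar>h x t\<bar> \<le> max D 0" if "norm x \<le> R" "t \<in> {0..T}" for x t
      using D[OF image_eqI[of _ _ "(x, t)"], of "h x t"] that by auto
  qed simp
qed

lemma continuous_slice:
  fixes h :: "'a::euclidean_space \<Rightarrow> real \<Rightarrow> real"
  assumes "continuous_on (UNIV \<times> {0..T}) (\<lambda>(x, t). h x t)" and "t \<in> {0..T}"
  shows "continuous_on UNIV (\<lambda>x. h x t)"
proof -
  have "continuous_on UNIV (\<lambda>x. (\<lambda>(x, t). h x t) (x, t))"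
    by (rule continuous_on_compose2[OF assms(1)]) (use assms(2) in \<open>auto intro!: continuous_intros\<close>)
  then show ?thesis by simp
qed

lemma integrable_along_trajectory:
  fixes h :: "'a::euclidean_space \<Rightarrow> real \<Rightarrow> real"
  assumes T: "T \<ge> 0" and h: "continuous_on (UNIV \<times> {0..T}) (\<lambda>(x, t). h x t)"
  shows "integrable (leb T) (\<lambda>t. h (apply_bcontfun \<gamma> t) t)"
proof -
  interpret finite_measure "leb T" by (rule finite_measure_leb[OF T])
  obtain D where D: "\<And>x t. norm x \<le> norm \<gamma> \<Longrightarrow> t \<in> {0..T} \<Longrightarrow> \<bar>h x t\<bar> \<le> D"
    using continuous_bounded_on_strip[OF h] by metis
  show ?thesis
  proof (rule integrable_const_bound)
    show "AE t in leb T. norm (h (\<gamma> t) t) \<le> D"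
      using D[OF norm_bounded] by (intro AE_I2) (simp add: space_restrict_space)
    have "continuous_on {0<..<T} (\<lambda>t. (\<lambda>(x, t). h x t) (\<gamma> t, t))"
      by (rule continuous_on_compose2[OF h]) (auto intro!: continuous_intros)
    then have "(\<lambda>t. h (\<gamma> t) t) \<in> borel_measurable (restrict_space borel {0<..<T})"
      by (intro borel_measurable_continuous_on_restrict) simp
    then show "(\<lambda>t. h (\<gamma> t) t) \<in> borel_measurable (leb T)"
      by (simp cong: measurable_cong_sets add: sets_restrict_space_cong[OF sets_lborel])
  qed
qed

text \<open>
  The uniform bound on the trajectories confines all arguments of \<open>h\<close> to a compact set, on which
  \<open>h\<close> is bounded; this gives the integrability for Fubini's theorem.
\<close>

lemma Fubini_along_trajectories:
  fixes \<eta> :: "('n::finite, 'm::finite) pair measure"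
    and h :: "real^'n \<Rightarrow> real \<Rightarrow> real"
  assumes T: "T \<ge> 0" and \<eta>: "\<eta> \<in> P1 S" and R: "AE p in \<eta>. norm (fst p) \<le> R"
    and h: "continuous_on (UNIV \<times> {0..T}) (\<lambda>(x, t). h x t)"
  shows "\<And>t. t \<in> {0..T} \<Longrightarrow> integrable (m_eq \<eta> t) (\<lambda>x. h x t)"
    and "integrable \<eta> (\<lambda>p. LINT t|leb T. h (apply_bcontfun (fst p) t) t)"
    and "integrable (leb T) (\<lambda>t. LINT x|m_eq \<eta> t. h x t)"
    and "(LINT p|\<eta>. LINT t|leb T. h (apply_bcontfun (fst p) t) t) = (LINT t|leb T. LINT x|m_eq \<eta> t. h x t)"
proof -
  interpret E: prob_space \<eta> using \<eta> by (simp add: P1_def)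
  interpret F: finite_measure "leb T" by (rule finite_measure_leb[OF T])
  interpret P: pair_sigma_finite \<eta> "leb T" by standard
  interpret PF: finite_measure "\<eta> \<Otimes>\<^sub>M leb T"
    by (rule finite_measure_pair_measure) (rule E.finite_measure_axioms F.finite_measure_axioms)+
  obtain D where D: "\<And>x t. norm x \<le> R \<Longrightarrow> t \<in> {0..T} \<Longrightarrow> \<bar>h x t\<bar> \<le> D"
    using continuous_bounded_on_strip[OF h] by metis
  have sl[measurable]: "(\<lambda>x. h x t) \<in> borel_measurable borel" if "t \<in> {0..T}" for t
    by (rule borel_measurable_continuous_onI[OF continuous_slice[OF h that]])
  have Rt: "AE p in \<eta>. norm (apply_bcontfun (fst p) t) \<le> R" for t
    using R by eventually_elim (rule order_trans[OF norm_bounded])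
  show "integrable (m_eq \<eta> t) (\<lambda>x. h x t)" if t: "t \<in> {0..T}" for t
  proof -
    interpret prob_space "m_eq \<eta> t" using m_eq_in_P1[OF \<eta>] by (simp add: P1_def)
    have "AE x in m_eq \<eta> t. norm x \<le> R" using Rt by (subst AE_m_eq_iff[OF \<eta>]) auto
    then have "AE x in m_eq \<eta> t. norm (h x t) \<le> D"
      by eventually_elim (use D[OF _ t] in simp)
    moreover have "(\<lambda>x. h x t) \<in> borel_measurable (m_eq \<eta> t)"
      using sl[OF t] by (simp add: m_eq_def)
    ultimately show ?thesis by (rule integrable_const_bound)
  qed
  define k where "k z = h (apply_bcontfun (fst (fst z)) (snd z)) (snd z)" for z :: "('n, 'm) pair \<times> real"
  have eval: "(\<lambda>z. apply_bcontfun (fst (fst z)) (snd z)) \<in> borel_measurable (\<eta> \<Otimes>\<^sub>M borel)"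
    using measurable_pair_continuous[of "\<lambda>p t. apply_bcontfun (fst p) t" \<eta>] measurable_eval[OF \<eta>]
    by (simp add: split_beta)
  have h': "(\<lambda>z. indicator (UNIV \<times> {0..T}) z *\<^sub>R (case z of (x, t) \<Rightarrow> h x t)) \<in> borel_measurable borel"
    by (rule borel_measurable_continuous_on_indicator[OF _ h]) (auto intro!: borel_closed closed_Times)
  have "(\<lambda>z. indicator {0..T} (snd z) *\<^sub>R k z) \<in> borel_measurable (\<eta> \<Otimes>\<^sub>M borel)"
    using measurable_compose[OF borel_measurable_Pair[OF eval measurable_snd] h']
    by (simp add: k_def indicator_times)
  moreover have "(\<lambda>z. (fst z, snd z)) \<in> (\<eta> \<Otimes>\<^sub>M leb T) \<rightarrow>\<^sub>M (\<eta> \<Otimes>\<^sub>M borel)"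
    by (intro measurable_Pair measurable_fst measurable_compose[OF measurable_snd] measurable_restrict_space1) simp
  ultimately have "(\<lambda>z. indicator {0..T} (snd z) *\<^sub>R k z) \<in> borel_measurable (\<eta> \<Otimes>\<^sub>M leb T)"
    using measurable_compose by fastforce
  moreover have "(\<lambda>z. indicator {0..T} (snd z) *\<^sub>R k z) \<in> borel_measurable (\<eta> \<Otimes>\<^sub>M leb T)
      \<longleftrightarrow> k \<in> borel_measurable (\<eta> \<Otimes>\<^sub>M leb T)"
    by (intro measurable_cong) (auto simp: space_pair_measure space_restrict_space)
  ultimately have km[measurable]: "k \<in> borel_measurable (\<eta> \<Otimes>\<^sub>M leb T)" by simp
  have ik: "integrable (\<eta> \<Otimes>\<^sub>M leb T) k"
  proof (rule PF.integrable_const_bound)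
    have "AE p in \<eta>. AE t in leb T. norm (k (p, t)) \<le> D"
      using R
    proof eventually_elim
      case (elim p)
      show ?case
      proof (rule AE_I2)
        fix t assume "t \<in> space (leb T)"
        then have t: "t \<in> {0..T}" by (simp add: space_restrict_space)
        show "norm (k (p, t)) \<le> D"
          using D[OF order_trans[OF norm_bounded elim] t] by (simp add: k_def)
      qed
    qed
    then show "AE z in \<eta> \<Otimes>\<^sub>M leb T. norm (k z) \<le> D"
      by (intro P.AE_pair_measure) auto
  qed (rule km)
  then have ik': "integrable (\<eta> \<Otimes>\<^sub>M leb T) (case_prod (\<lambda>p t. h (apply_bcontfun (fst p) t) t))"
    by (simp add: k_def[abs_def] split_beta')
  show "integrable \<eta> (\<lambda>p. LINT t|leb T. h (apply_bcontfun (fst p) t) t)"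
    by (rule P.integrable_fst[OF ik'])
  have eq: "(LINT x|m_eq \<eta> t. h x t) = (LINT p|\<eta>. h (apply_bcontfun (fst p) t) t)" if "t \<in> space (leb T)" for t
    by (rule integral_m_eq[OF \<eta> sl]) (use that in \<open>auto simp: space_restrict_space\<close>)
  have "integrable (leb T) (\<lambda>t. LINT p|\<eta>. h (apply_bcontfun (fst p) t) t)"
    by (rule P.integrable_snd[OF ik'])
  then show "integrable (leb T) (\<lambda>t. LINT x|m_eq \<eta> t. h x t)"
    by (subst Bochner_Integration.integrable_cong[OF refl eq])
  have "(LINT p|\<eta>. LINT t|leb T. h (apply_bcontfun (fst p) t) t)
      = (LINT t|leb T. LINT p|\<eta>. h (apply_bcontfun (fst p) t) t)"
    by (rule P.Fubini_integral[OF ik', symmetric])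
  also have "\<dots> = (LINT t|leb T. LINT x|m_eq \<eta> t. h x t)"
    using eq by (intro Bochner_Integration.integral_cong) auto
  finally show "(LINT p|\<eta>. LINT t|leb T. h (apply_bcontfun (fst p) t) t) = (LINT t|leb T. LINT x|m_eq \<eta> t. h x t)" .
qed

text \<open>
  The last equation exhibits the pairing with a bounded function as a continuous linear functional of
  the control, which therefore commutes with Bochner integrals over controls.
\<close>

lemma integrable_bounded_control:
  fixes v :: "'b::euclidean_space L2fun"
  assumes T: "T \<ge> 0" and P[measurable]: "P \<in> borel_measurable borel" and B: "\<And>t. norm (P t) \<le> B"
  shows "integrable (leb T) (\<lambda>t. P t \<bullet> L2_apply v t)"
    and "\<bar>LINT t|leb T. P t \<bullet> L2_apply v t\<bar> \<le> B * sqrt T * norm v"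
    and "(LINT t|leb T. P t \<bullet> L2_apply v t) = abs_L2fun (\<lambda>t. indicator {0<..<T} t *\<^sub>R P t) \<bullet> v"
proof -
  have B0: "B \<ge> 0" using order_trans[OF norm_ge_zero B] .
  have fin: "emeasure lborel {0<..<T} < \<infinity>" using T by simp
  note s = L2_set_integral(1,2)[OF _ fin, of v]
  have "set_integrable lborel {0<..<T} (\<lambda>t. norm (L2_apply v t))"
    using s(1) by (intro set_integrable_norm) auto
  then have nv: "integrable (leb T) (\<lambda>t. norm (L2_apply v t))"
    by (simp add: integrable_restrict_space set_integrable_def mult.commute)
  have le: "\<bar>P t \<bullet> L2_apply v t\<bar> \<le> B * norm (L2_apply v t)" for t
    by (rule order_trans[OF Cauchy_Schwarz_ineq2]) (intro mult_right_mono B norm_ge_zero)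
  have [measurable]: "(\<lambda>t. P t \<bullet> L2_apply v t) \<in> borel_measurable (leb T)"
    by (rule measurable_restrict_space1) simp
  show i: "integrable (leb T) (\<lambda>t. P t \<bullet> L2_apply v t)"
    by (rule Bochner_Integration.integrable_bound[OF integrable_mult_right[OF nv, of B]])
      (use le B0 in auto)
  have "\<bar>LINT t|leb T. P t \<bullet> L2_apply v t\<bar> \<le> (LINT t|leb T. \<bar>P t \<bullet> L2_apply v t\<bar>)"
    by (rule integral_abs_bound)
  also have "\<dots> \<le> (LINT t|leb T. B * norm (L2_apply v t))"
    using i nv le by (intro integral_mono) auto
  also have "\<dots> = B * (LINT t:{0<..<T}|lborel. norm (L2_apply v t))"
    by (simp add: integral_restrict_space set_lebesgue_integral_def)
  also have "\<dots> \<le> B * (sqrt (measure lborel {0<..<T}) * norm v)"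
    using s(2) B0 by (intro mult_left_mono) auto
  finally show "\<bar>LINT t|leb T. P t \<bullet> L2_apply v t\<bar> \<le> B * sqrt T * norm v" using T by (simp add: mult_ac)
  have sq: "sq_integrable (\<lambda>t. indicator {0<..<T} t *\<^sub>R P t)"
  proof (rule sq_integrable_bound)
    show "integrable lborel (\<lambda>t. B\<^sup>2 * indicator {0<..<T} t)"
      using T by (intro integrable_mult_right integrable_real_indicator) auto
    show "AE t in lborel. (norm (indicator {0<..<T} t *\<^sub>R P t))\<^sup>2 \<le> B\<^sup>2 * indicator {0<..<T} t"
      using B by (auto simp: indicator_def intro!: power_mono)
  qed measurable
  have "(LINT t|leb T. P t \<bullet> L2_apply v t) = (LINT t|lborel. (indicator {0<..<T} t *\<^sub>R P t) \<bullet> L2_apply v t)"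
    by (simp add: integral_restrict_space)
  also have "\<dots> = abs_L2fun (\<lambda>t. indicator {0<..<T} t *\<^sub>R P t) \<bullet> abs_L2fun (L2_apply v)"
    by (subst inner_L2fun.abs_eq) (auto simp: L2_rel_def sq)
  finally show "(LINT t|leb T. P t \<bullet> L2_apply v t) = abs_L2fun (\<lambda>t. indicator {0<..<T} t *\<^sub>R P t) \<bullet> v" by simp
qed

section \<open>Optimal pairs\<close>

abbreviation traj :: "('n::finite, 'm::finite) pair \<Rightarrow> real \<Rightarrow> real^'n" where
  "traj p \<equiv> apply_bcontfun (fst p)"

abbreviation ctrl :: "('n::finite, 'm::finite) pair \<Rightarrow> real \<Rightarrow> real^'m" where
  "ctrl p \<equiv> L2_apply (snd p)"

text \<open>
  The consequences of the standing assumptions that enter the proof, with the constants made explicit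
  so that the bounds below are the same for all equilibria.
\<close>

locale control_bounds =
  fixes T :: real
    and a :: "real^'n::finite \<Rightarrow> real^'n"
    and b :: "real^'n \<Rightarrow> real^'m::finite^'n"
    and c :: "(real^'n) \<times> (real^'m) \<Rightarrow> real^'nc::finite"
    and g1 :: "real^'n \<Rightarrow> real^'g1::finite"
    and g2 :: "real^'n \<Rightarrow> real^'g2::finite"
    and L :: "(real^'n) \<times> (real^'m) \<Rightarrow> real"
    and f g0 :: "real^'n \<Rightarrow> (real^'n) measure \<Rightarrow> real"
    and \<psi> :: "real^'m \<Rightarrow> real^'m"
    and m0 :: "(real^'n) measure"
    and CL Ca R0 Cf B CJ :: real
  assumes T: "T \<ge> 0"
    and L_cont: "continuous_on UNIV L"
    and CL: "CL > 0"
    and L_coercive: "\<And>x v. L (x, v) \<ge> (1 / CL) * (norm v)\<^sup>2 - CL"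
    and a_cont: "continuous_on UNIV a" and b_cont: "continuous_on UNIV b"
    and a_growth: "\<And>x. norm (a x) \<le> Ca * (1 + norm x)"
    and b_growth: "\<And>x. norm (b x) \<le> Ca * (1 + norm x)"
    and R0: "\<And>x. x \<in> supp m0 \<Longrightarrow> norm x \<le> R0"
    and f_cont: "continuous_map (prod_topology euclidean narrow) euclidean (\<lambda>(x, \<mu>). f x \<mu>)"
    and g0_cont: "continuous_map (prod_topology euclidean narrow) euclidean (\<lambda>(x, \<mu>). g0 x \<mu>)"
    and couplings_lower: "\<And>x0 m p. x0 \<in> supp m0 \<Longrightarrow> m \<in> curves T \<Longrightarrow> p \<in> admissible T a b c g1 g2 x0 \<Longrightarrow>
        (LINT t|leb T. f (traj p t) (m t)) + g0 (traj p T) (m T) \<ge> - Cf"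
    and \<psi>_cont: "continuous_on UNIV \<psi>" and \<psi>_bound: "\<And>\<theta>. norm (\<psi> \<theta>) \<le> B"
    and feasible: "\<And>x0 m P. x0 \<in> supp m0 \<Longrightarrow> m \<in> curves T \<Longrightarrow> P \<in> Linf T \<Longrightarrow> m 0 = m0 \<Longrightarrow>
        Linf_norm T P \<le> ereal (SUP \<theta>. norm (\<psi> \<theta>)) \<Longrightarrow>
        \<exists>p\<in>admissible T a b c g1 g2 x0. cost T L f g0 m P p \<le> ereal CJ"
begin

abbreviation admiss where "admiss \<equiv> admissible T a b c g1 g2"

lemma B_nonneg: "B \<ge> 0" using order_trans[OF norm_ge_zero \<psi>_bound] .

definition bounded_price :: "(real \<Rightarrow> real^'m) \<Rightarrow> bool" where
  "bounded_price P \<longleftrightarrow> P \<in> borel_measurable borel \<and> (\<forall>t. norm (P t) \<le> B)"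

definition lagr :: "('n, 'm) pair \<Rightarrow> real \<Rightarrow> real" where
  "lagr p t = L (traj p t, ctrl p t)"

definition running_cost :: "(real \<Rightarrow> (real^'n) measure) \<Rightarrow> (real \<Rightarrow> real^'m) \<Rightarrow> ('n, 'm) pair \<Rightarrow> real \<Rightarrow> real" where
  "running_cost m P p t = lagr p t + P t \<bullet> ctrl p t + f (traj p t) (m t)"

definition real_cost :: "(real \<Rightarrow> (real^'n) measure) \<Rightarrow> (real \<Rightarrow> real^'m) \<Rightarrow> ('n, 'm) pair \<Rightarrow> real" where
  "real_cost m P p = (LINT t|leb T. running_cost m P p t) + g0 (traj p T) (m T)"

lemma cost_eq: "cost T L f g0 m P p = ereal_integral (leb T) (running_cost m P p) + ereal (g0 (traj p T) (m T))"
  by (cases p) (simp add: cost_def running_cost_def[abs_def] lagr_def)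

lemma measurable_lagr[measurable]: "lagr p \<in> borel_measurable borel"
proof -
  have [measurable]: "traj p \<in> borel_measurable borel"
    by (rule borel_measurable_continuous_onI) simp
  have [measurable]: "L \<in> borel_measurable borel" by (rule borel_measurable_continuous_onI[OF L_cont])
  have "(\<lambda>t. L (traj p t, ctrl p t)) \<in> borel_measurable borel"
    by (rule measurable_compose[OF _ \<open>L \<in> _\<close>]) measurable
  then show ?thesis by (simp add: lagr_def[abs_def])
qed

lemma f_strip:
  assumes "m \<in> curves T"
  shows "continuous_on (UNIV \<times> {0..T}) (\<lambda>(x, t). f x (m t))"
  by (rule continuous_on_along_curve[OF f_cont assms])

lemma g0_strip:
  assumes "m \<in> curves T"
  shows "continuous_on (UNIV \<times> {0..T}) (\<lambda>(x, t). g0 x (m t))"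
  by (rule continuous_on_along_curve[OF g0_cont assms])

lemma g0_continuous:
  assumes "m \<in> curves T"
  shows "continuous_on UNIV (\<lambda>x. g0 x (m T))"
  using continuous_slice[OF g0_strip[OF assms], of T] T by simp

lemma integrable_f:
  assumes "m \<in> curves T" shows "integrable (leb T) (\<lambda>t. f (traj p t) (m t))"
  by (rule integrable_along_trajectory[OF T f_strip[OF assms]])

lemma integrable_P:
  assumes "bounded_price P" shows "integrable (leb T) (\<lambda>t. P t \<bullet> ctrl p t)"
  using assms by (intro integrable_bounded_control(1)[OF T, where B=B]) (auto simp: bounded_price_def)

lemma
  assumes m: "m \<in> curves T" and P: "bounded_price P" and i: "integrable (leb T) (lagr p)"
  shows integrable_run: "integrable (leb T) (running_cost m P p)"
    and integral_run: "(LINT t|leb T. running_cost m P p t)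
      = (LINT t|leb T. lagr p t) + (LINT t|leb T. P t \<bullet> ctrl p t) + (LINT t|leb T. f (traj p t) (m t))"
    and cost_eq_real_cost: "cost T L f g0 m P p = ereal (real_cost m P p)"
proof -
  show r: "integrable (leb T) (running_cost m P p)"
    unfolding running_cost_def[abs_def]
    by (intro Bochner_Integration.integrable_add i integrable_P P integrable_f m)
  show "(LINT t|leb T. running_cost m P p t)
      = (LINT t|leb T. lagr p t) + (LINT t|leb T. P t \<bullet> ctrl p t) + (LINT t|leb T. f (traj p t) (m t))"
    unfolding running_cost_def by (simp add: i integrable_P[OF P] integrable_f[OF m])
  show "cost T L f g0 m P p = ereal (real_cost m P p)"
    by (simp add: cost_eq ereal_integral_integrable[OF r] real_cost_def)
qed

lemma lagr_lower: "lagr p t \<ge> - CL"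
proof -
  have "(1 / CL) * (norm (ctrl p t))\<^sup>2 \<ge> 0" using CL by simp
  then show ?thesis using L_coercive[of "ctrl p t" "traj p t"] by (simp add: lagr_def)
qed

lemma integrable_lagr_if_finite_cost:
  assumes m: "m \<in> curves T" and P: "bounded_price P" and fin: "cost T L f g0 m P p < \<infinity>"
  shows "integrable (leb T) (lagr p)"
proof -
  interpret finite_measure "leb T" by (rule finite_measure_leb[OF T])
  have [measurable]: "lagr p \<in> borel_measurable (leb T)" by (rule measurable_restrict_space1) simp
  note iP = integrable_P[OF P, of p] and iF = integrable_f[OF m, of p]
  have "integrable (leb T) (running_cost m P p)"
  proof (rule integrable_if_ereal_integral_less_top)
    show "running_cost m P p \<in> borel_measurable (leb T)"
      unfolding running_cost_def[abs_def] using iP iF by (intro borel_measurable_add) auto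
    show "integrable (leb T) (\<lambda>t. - CL + P t \<bullet> ctrl p t + f (traj p t) (m t))"
      using iP iF by (intro Bochner_Integration.integrable_add) auto
    show "AE t in leb T. - CL + P t \<bullet> ctrl p t + f (traj p t) (m t) \<le> running_cost m P p t"
      using lagr_lower by (simp add: running_cost_def)
    show "ereal_integral (leb T) (running_cost m P p) < \<infinity>"
      using fin by (auto simp: cost_eq)
  qed
  from Bochner_Integration.integrable_diff[OF Bochner_Integration.integrable_diff[OF this iP] iF]
  show ?thesis by (simp add: running_cost_def[abs_def])
qed

text \<open>
  The bounds for trajectory, control and accumulated Lagrangian of a pair whose cost is at most \<open>CJ\<close>.
  They depend on the data only, not on the crowd \<open>m\<close> or the price \<open>P\<close>; hence all pairs in the
  supports of two equilibria have finite cost with respect to either of them.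
\<close>

definition control_radius :: real where
  "control_radius = sqrt (2 * CL * (CJ + Cf + T * (CL + CL * B\<^sup>2 / 2)))"

definition state_radius :: real where
  "state_radius = 2 * (1 + R0) * exp ((2 * (2 * Ca\<^sup>2 * (T + control_radius\<^sup>2)) + 1) * T)"

definition action_bound :: real where
  "action_bound = CJ + Cf + B * sqrt T * control_radius"

text \<open>
  The price term is at most \<open>B |v|\<close> in modulus, and by Young's inequality half of the coercivity of the
  Lagrangian absorbs it.
\<close>

lemma lagr_price_lower:
  assumes "norm q \<le> B"
  shows "(norm v)\<^sup>2 / (2 * CL) - (CL + CL * B\<^sup>2 / 2) \<le> L (x, v) + q \<bullet> v"
proof -
  have "- (q \<bullet> v) \<le> norm q * norm v" using norm_cauchy_schwarz[of "- q" v] by simp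
  also have "\<dots> \<le> B * norm v" using assms by (intro mult_right_mono) auto
  also have "\<dots> \<le> (norm v)\<^sup>2 / (2 * CL) + CL * B\<^sup>2 / 2"
  proof -
    have "0 \<le> (norm v - CL * B)\<^sup>2 / (2 * CL)" using CL by simp
    also have "\<dots> = (norm v)\<^sup>2 / (2 * CL) + CL * B\<^sup>2 / 2 - B * norm v"
      using CL by (simp add: power2_diff field_simps power2_eq_square)
    finally show ?thesis by simp
  qed
  finally have "- (q \<bullet> v) \<le> (norm v)\<^sup>2 / (2 * CL) + CL * B\<^sup>2 / 2" .
  moreover have "(1 / CL) * (norm v)\<^sup>2 = (norm v)\<^sup>2 / (2 * CL) + (norm v)\<^sup>2 / (2 * CL)"
    using CL by (simp add: field_simps)
  ultimately show ?thesis using L_coercive[of v x] by simp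
qed

lemma norm_control_leb:
  assumes "v \<in> L2_on T"
  shows "(norm v)\<^sup>2 = (LINT t|leb T. (norm (L2_apply v t))\<^sup>2)"
    and "integrable (leb T) (\<lambda>t. (norm (L2_apply v t))\<^sup>2)"
proof -
  have "integrable lborel (\<lambda>t. (norm (L2_apply v t))\<^sup>2)"
    using sq_integrable_L2_apply[of v] by (simp add: sq_integrable_def)
  then show "integrable (leb T) (\<lambda>t. (norm (L2_apply v t))\<^sup>2)"
    using integrable_mult_indicator[of "{0<..<T}" lborel "\<lambda>t. (norm (L2_apply v t))\<^sup>2"]
    by (subst integrable_restrict_space) auto
  have "(LINT t|lborel. (norm (L2_apply v t))\<^sup>2)
      = (LINT t|lborel. indicator {0<..<T} t *\<^sub>R (norm (L2_apply v t))\<^sup>2)"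
    using assms unfolding L2_on_def
    by (intro integral_cong_AE) (auto elim!: eventually_mono simp: indicator_def)
  then show "(norm v)\<^sup>2 = (LINT t|leb T. (norm (L2_apply v t))\<^sup>2)"
    by (simp add: norm_L2fun_eq integral_restrict_space)
qed

definition tame :: "('n, 'm) pair set" where
  "tame = {p. norm (fst p) \<le> state_radius \<and> norm (snd p) \<le> control_radius \<and>
    integrable (leb T) (lagr p) \<and> (LINT t|leb T. lagr p t) \<le> action_bound}"

text \<open>
  The coupling terms are bounded below, so a bound on the cost bounds the integral of the Lagrangian and
  price terms, hence the \<open>L\<^sup>2\<close> norm of the control, hence by Gronwall's inequality the trajectory.
\<close>

lemma tame_if_cost_le:
  assumes x0: "x0 \<in> supp m0" and m: "m \<in> curves T" and P: "bounded_price P"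
    and p: "p \<in> admiss x0" and le: "cost T L f g0 m P p \<le> ereal CJ"
  shows "p \<in> tame"
proof -
  interpret finite_measure "leb T" by (rule finite_measure_leb[OF T])
  have i: "integrable (leb T) (lagr p)"
    using le by (intro integrable_lagr_if_finite_cost[OF m P]) auto
  have v: "snd p \<in> L2_on T" and start: "traj p 0 = x0"
    using p by (auto simp: admissible_def)
  have PB: "norm (P t) \<le> B" for t using P by (simp add: bounded_price_def)
  have Pm: "P \<in> borel_measurable borel" using P by (simp add: bounded_price_def)
  have "real_cost m P p \<le> CJ" using le by (simp add: cost_eq_real_cost[OF m P i])
  then have sum: "(LINT t|leb T. lagr p t) + (LINT t|leb T. P t \<bullet> ctrl p t) \<le> CJ + Cf"
    using couplings_lower[OF x0 m p] by (simp add: real_cost_def integral_run[OF m P i])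
  have "(LINT t|leb T. (norm (ctrl p t))\<^sup>2 / (2 * CL) - (CL + CL * B\<^sup>2 / 2))
      \<le> (LINT t|leb T. lagr p t + P t \<bullet> ctrl p t)"
  proof (rule integral_mono)
    show "(norm (ctrl p t))\<^sup>2 / (2 * CL) - (CL + CL * B\<^sup>2 / 2) \<le> lagr p t + P t \<bullet> ctrl p t" for t
      unfolding lagr_def by (rule lagr_price_lower[OF PB])
  qed (use norm_control_leb(2)[OF v] i integrable_P[OF P, of p] in auto)
  also have "\<dots> \<le> CJ + Cf" using sum i integrable_P[OF P, of p] by simp
  also have "(LINT t|leb T. (norm (ctrl p t))\<^sup>2 / (2 * CL) - (CL + CL * B\<^sup>2 / 2))
      = (norm (snd p))\<^sup>2 / (2 * CL) - T * (CL + CL * B\<^sup>2 / 2)"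
    using norm_control_leb[OF v] by (simp add: measure_leb[OF T] space_restrict_space)
  finally have "(norm (snd p))\<^sup>2 \<le> 2 * CL * (CJ + Cf + T * (CL + CL * B\<^sup>2 / 2))"
    using CL by (simp add: field_simps)
  from real_sqrt_le_mono[OF this] have vM: "norm (snd p) \<le> control_radius"
    by (simp add: control_radius_def)
  obtain \<gamma>' where "H1_deriv T (fst p) \<gamma>'"
    "AE t in leb T. L2_apply \<gamma>' t = a (traj p t) + b (traj p t) *v ctrl p t"
    using p by (auto simp: admissible_def)
  from trajectory_bound[OF T this a_growth b_growth vM, of R0]
  have "norm (fst p) \<le> state_radius" using R0[OF x0] start by (simp add: state_radius_def)
  moreover have "\<bar>LINT t|leb T. P t \<bullet> ctrl p t\<bar> \<le> B * sqrt T * norm (snd p)"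
    by (rule integrable_bounded_control(2)[OF T Pm PB])
  moreover have "B * sqrt T * norm (snd p) \<le> B * sqrt T * control_radius"
    using vM B_nonneg T by (intro mult_left_mono) auto
  ultimately show ?thesis using sum i vM by (auto simp: tame_def action_bound_def)
qed

lemma real_cost_bounded:
  assumes m: "m \<in> curves T" and P: "bounded_price P"
  obtains D where "D \<ge> 0" "\<And>p. p \<in> tame \<Longrightarrow> \<bar>real_cost m P p\<bar> \<le> D"
proof -
  interpret finite_measure "leb T" by (rule finite_measure_leb[OF T])
  obtain Df where Df: "Df \<ge> 0" "\<And>x t. norm x \<le> state_radius \<Longrightarrow> t \<in> {0..T} \<Longrightarrow> \<bar>f x (m t)\<bar> \<le> Df"
    using continuous_bounded_on_strip[OF f_strip[OF m]] by metis
  obtain Dg where Dg: "\<And>x t. norm x \<le> state_radius \<Longrightarrow> t \<in> {0..T} \<Longrightarrow> \<bar>g0 x (m t)\<bar> \<le> Dg"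
    using continuous_bounded_on_strip[OF g0_strip[OF m]] by metis
  define D where "D = (\<bar>action_bound\<bar> + CL * T) + B * sqrt T * control_radius + Df * T + Dg"
  have "\<bar>real_cost m P p\<bar> \<le> D" if p: "p \<in> tame" for p
  proof -
    have i: "integrable (leb T) (lagr p)" and tr: "norm (traj p t) \<le> state_radius" for t
      using p norm_bounded[of "fst p" t] by (auto simp: tame_def intro: order_trans)
    have "(LINT t|leb T. - CL) \<le> (LINT t|leb T. lagr p t)"
      using i lagr_lower by (intro integral_mono) auto
    then have "- (CL * T) \<le> (LINT t|leb T. lagr p t)"
      by (simp add: measure_leb[OF T] space_restrict_space mult.commute)
    moreover have "0 \<le> CL * T" "(LINT t|leb T. lagr p t) \<le> action_bound"
      using p CL T by (auto simp: tame_def)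
    ultimately have 1: "\<bar>LINT t|leb T. lagr p t\<bar> \<le> \<bar>action_bound\<bar> + CL * T" by linarith
    have "\<bar>LINT t|leb T. P t \<bullet> ctrl p t\<bar> \<le> B * sqrt T * norm (snd p)"
      using P by (intro integrable_bounded_control(2)[OF T]) (auto simp: bounded_price_def)
    also have "\<dots> \<le> B * sqrt T * control_radius"
      using p B_nonneg T by (intro mult_left_mono) (auto simp: tame_def)
    finally have 2: "\<bar>LINT t|leb T. P t \<bullet> ctrl p t\<bar> \<le> B * sqrt T * control_radius" .
    have "\<bar>LINT t|leb T. f (traj p t) (m t)\<bar> \<le> (LINT t|leb T. \<bar>f (traj p t) (m t)\<bar>)"
      by (rule integral_abs_bound)
    also have "\<dots> \<le> (LINT t|leb T. Df)"
      using integrable_f[OF m] Df(2)[OF tr] by (intro integral_mono) (auto simp: space_restrict_space)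
    finally have 3: "\<bar>LINT t|leb T. f (traj p t) (m t)\<bar> \<le> Df * T"
      by (simp add: measure_leb[OF T] space_restrict_space mult.commute)
    have 4: "\<bar>g0 (traj p T) (m T)\<bar> \<le> Dg" using Dg[OF tr] T by simp
    show ?thesis using 1 2 3 4 unfolding real_cost_def integral_run[OF m P i] D_def by linarith
  qed
  from that[of "max D 0"] this show thesis by (auto simp: le_max_iff_disj)
qed

text \<open>
  Lower semicontinuity of the cost, in the form in which it is used: sublevel sets are closed relative to
  the pairs of trajectories and controls.
\<close>

lemma closed_sublevel:
  assumes m: "m \<in> curves T" and P: "bounded_price P"
    and C: "closed C" and sub: "pairs T \<inter> C \<subseteq> tame"
  obtains C' where "closed C'" "{p \<in> pairs T \<inter> C. real_cost m P p \<le> \<beta>} = pairs T \<inter> C'"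
proof
  let ?A = "{p \<in> pairs T \<inter> C. real_cost m P p \<le> \<beta>}"
  show "closed (C \<inter> closure ?A)" using C by auto
  show "?A = pairs T \<inter> (C \<inter> closure ?A)"
  proof
    show "?A \<subseteq> pairs T \<inter> (C \<inter> closure ?A)" using closure_subset[of ?A] by blast
    show "pairs T \<inter> (C \<inter> closure ?A) \<subseteq> ?A"
    proof
      fix p assume p: "p \<in> pairs T \<inter> (C \<inter> closure ?A)"
      then have pt: "p \<in> tame" using sub by auto
      have "p \<in> closure ?A" using p by blast
      then obtain q where q: "\<And>k. q k \<in> ?A" and lim: "q \<longlonglongrightarrow> p"
        unfolding closure_sequential by blast
      have qt: "q k \<in> tame" for k using q sub by auto
      obtain Df where Df: "\<And>x t. norm x \<le> state_radius \<Longrightarrow> t \<in> {0..T} \<Longrightarrow> \<bar>f x (m t)\<bar> \<le> Df"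
        using continuous_bounded_on_strip[OF f_strip[OF m]] by metis
      let ?j = "\<lambda>x v t. L (x, v) + P t \<bullet> v + f x (m t)"
      have running_cost: "running_cost m P p' = (\<lambda>t. ?j (traj p' t) (ctrl p' t) t)" for p'
        by (simp add: running_cost_def[abs_def] lagr_def)
      have PB: "norm (P t) \<le> B" for t using P by (simp add: bounded_price_def)
      have cost: "(LINT t|leb T. running_cost m P (q k) t) \<le> \<beta> - g0 (traj (q k) T) (m T)" for k
        using q[of k] by (simp add: real_cost_def)
      have "(LINT t|leb T. running_cost m P p t) \<le> \<beta> - g0 (traj p T) (m T)"
        unfolding running_cost
      proof (rule running_cost_lsc[OF T, where j="?j"])
        fix t assume t: "t \<in> {0<..<T}"
        have "continuous_on UNIV (\<lambda>z. L z + P t \<bullet> snd z + f (fst z) (m t))"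
          using t by (intro continuous_intros L_cont continuous_on_compose2[OF continuous_slice[OF f_strip[OF m]]]) auto
        then show "continuous_on UNIV (\<lambda>(x, v). ?j x v t)" by (simp add: split_beta)
      next
        fix x :: "real^'n" and v :: "real^'m" and t
        assume t: "t \<in> {0<..<T}" and x: "norm x \<le> state_radius"
        have "0 \<le> (norm v)\<^sup>2 / (2 * CL)" using CL by simp
        then show "- (CL + CL * B\<^sup>2 / 2 + Df) \<le> ?j x v t"
          using lagr_price_lower[OF PB[of t], of v x] Df[OF x, of t] t by (simp add: abs_le_iff)
      next
        show "(\<lambda>k. fst (q k)) \<longlonglongrightarrow> fst p" "(\<lambda>k. snd (q k)) \<longlonglongrightarrow> snd p"
          using lim by (auto intro: tendsto_fst tendsto_snd)
        show "norm (fst (q k)) \<le> state_radius" for k using qt by (simp add: tame_def)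
        show "integrable (leb T) (\<lambda>t. ?j (traj (q k) t) (ctrl (q k) t) t)" for k
          using integrable_run[OF m P, of "q k"] qt[of k] unfolding running_cost by (simp add: tame_def)
        show "integrable (leb T) (\<lambda>t. ?j (traj p t) (ctrl p t) t)"
          using integrable_run[OF m P, of p] pt unfolding running_cost by (simp add: tame_def)
        show "(LINT t|leb T. ?j (traj (q k) t) (ctrl (q k) t) t) \<le> \<beta> - g0 (traj (q k) T) (m T)" for k
          using cost[of k] unfolding running_cost .
        have "(\<lambda>k. traj (q k) T) \<longlonglongrightarrow> traj p T"
          by (rule continuous_on_tendsto_compose[OF continuous_eval lim]) auto
        from continuous_on_tendsto_compose[OF g0_continuous[OF m] this]
        show "(\<lambda>k. \<beta> - g0 (traj (q k) T) (m T)) \<longlonglongrightarrow> \<beta> - g0 (traj p T) (m T)"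
          by (intro tendsto_diff tendsto_const) auto
      qed
      then show "p \<in> ?A" using p by (simp add: real_cost_def)
    qed
  qed
qed

lemma integrable_real_cost:
  assumes \<eta>: "\<eta> \<in> P1 (pairs T)" and m: "m \<in> curves T" and P: "bounded_price P"
    and C: "closed C" and sub: "pairs T \<inter> C \<subseteq> tame"
  shows "integrable \<eta> (\<lambda>p. if p \<in> pairs T \<inter> C then real_cost m P p else 0)" (is "integrable \<eta> ?J")
proof -
  interpret prob_space \<eta> using \<eta> by (simp add: P1_def)
  obtain D where D: "D \<ge> 0" "\<And>p. p \<in> tame \<Longrightarrow> \<bar>real_cost m P p\<bar> \<le> D"
    using real_cost_bounded[OF m P] by metis
  have sets: "sets \<eta> = sets (restrict_space borel (pairs T))" using \<eta> by (simp add: P1_def)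
  have sp: "space \<eta> = pairs T" using sets_eq_imp_space_eq[OF sets] by (simp add: space_restrict_space)
  have cl: "pairs T \<inter> C' \<in> sets \<eta>" if "closed C'" for C'
    unfolding sets sets_restrict_space using that by (intro image_eqI[of _ _ C']) auto
  have "?J \<in> borel_measurable \<eta>"
  proof (rule borel_measurable_iff_le[THEN iffD2, rule_format])
    fix \<beta>
    obtain C' where C': "closed C'" "{p \<in> pairs T \<inter> C. real_cost m P p \<le> \<beta>} = pairs T \<inter> C'"
      using closed_sublevel[OF m P C sub] by blast
    have "{p \<in> space \<eta>. ?J p \<le> \<beta>} = (pairs T \<inter> C') \<union> (if 0 \<le> \<beta> then space \<eta> - (pairs T \<inter> C) else {})"
      unfolding C'(2)[symmetric] sp by auto
    also have "\<dots> \<in> sets \<eta>" using cl[OF C] cl[OF C'(1)] by auto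
    finally show "{p \<in> space \<eta>. ?J p \<le> \<beta>} \<in> sets \<eta>" .
  qed
  moreover have "norm (?J p) \<le> D" for p using D(1) D(2)[of p] subsetD[OF sub, of p] by simp
  then have "AE p in \<eta>. norm (?J p) \<le> D" by simp
  ultimately show ?thesis by (intro integrable_const_bound)
qed

section \<open>Equilibria\<close>

abbreviation equil :: "('n, 'm) pair measure \<Rightarrow> bool" where
  "equil \<equiv> equilibrium T a b c g1 g2 L f g0 \<psi> m0"

lemma equilD:
  assumes "equil \<eta>"
  shows equil_P1: "\<eta> \<in> P1 (pairs T)" and equil_marginal: "m_eq \<eta> 0 = m0"
    and equil_supp: "p \<in> supp \<eta> \<Longrightarrow> \<exists>x\<in>supp m0. p \<in> minimizers T a b c g1 g2 L f g0 \<psi> \<eta> x"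
  using assms by (auto simp: equilibrium_def P_init_def m_eq_def)

lemma price_P_eq: "bounded_price (P_eq \<psi> \<eta>)"
proof -
  have [measurable]: "\<psi> \<in> borel_measurable borel" by (rule borel_measurable_continuous_onI[OF \<psi>_cont])
  have "P_eq \<psi> \<eta> \<in> borel_measurable borel" unfolding P_eq_def[abs_def] by measurable
  then show ?thesis using \<psi>_bound by (simp add: bounded_price_def P_eq_def)
qed

lemma Linf_norm_P_eq: "Linf_norm T (P_eq \<psi> \<eta>) \<le> ereal (SUP \<theta>. norm (\<psi> \<theta>))"
  unfolding Linf_norm_def
proof (rule esssup_I)
  have "P_eq \<psi> \<eta> \<in> borel_measurable borel" using price_P_eq[of \<eta>] by (simp add: bounded_price_def)
  then show "(\<lambda>t. ereal (norm (P_eq \<psi> \<eta> t))) \<in> borel_measurable (leb T)"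
    by (intro measurable_restrict_space1) simp
  have "norm (\<psi> \<theta>) \<le> (SUP \<theta>. norm (\<psi> \<theta>))" for \<theta>
    by (rule cSUP_upper) (auto intro!: bdd_aboveI2[of _ _ B] \<psi>_bound)
  then show "AE t in leb T. ereal (norm (P_eq \<psi> \<eta> t)) \<le> ereal (SUP \<theta>. norm (\<psi> \<theta>))"
    by (simp add: P_eq_def)
qed

lemma P_eq_in_Linf: "P_eq \<psi> \<eta> \<in> Linf T"
proof -
  have "P_eq \<psi> \<eta> \<in> borel_measurable (leb T)"
    using price_P_eq[of \<eta>] by (intro measurable_restrict_space1) (simp add: bounded_price_def)
  then show ?thesis using Linf_norm_P_eq[of \<eta>] by (auto simp: Linf_def)
qed

text \<open>
  By feasibility a competitor of cost at most \<open>CJ\<close> exists from every initial position, so the optimal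
  pairs in the support of an equilibrium are bounded as well.
\<close>

lemma supp_equil:
  assumes \<eta>: "equil \<eta>" and p: "p \<in> supp \<eta>"
  shows "traj p 0 \<in> supp m0" "p \<in> admiss (traj p 0)" "p \<in> tame"
    and "q \<in> admiss (traj p 0) \<Longrightarrow> J_eq T L f g0 \<psi> \<eta> p \<le> J_eq T L f g0 \<psi> \<eta> q"
proof -
  obtain x where x: "x \<in> supp m0" and px: "p \<in> minimizers T a b c g1 g2 L f g0 \<psi> \<eta> x"
    using equil_supp[OF \<eta> p] by blast
  then have adm: "p \<in> admiss x" by (simp add: minimizers_def)
  then have start: "traj p 0 = x" by (auto simp: admissible_def)
  show "traj p 0 \<in> supp m0" "p \<in> admiss (traj p 0)" using x adm start by auto
  show "J_eq T L f g0 \<psi> \<eta> p \<le> J_eq T L f g0 \<psi> \<eta> q" if "q \<in> admiss (traj p 0)"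
    using px that start by (simp add: minimizers_def)
  note m = m_eq_in_curves[OF equil_P1[OF \<eta>], of T]
  obtain q where q: "q \<in> admiss x" "cost T L f g0 (m_eq \<eta>) (P_eq \<psi> \<eta>) q \<le> ereal CJ"
    using feasible[OF x m P_eq_in_Linf equil_marginal[OF \<eta>] Linf_norm_P_eq] by blast
  then have "J_eq T L f g0 \<psi> \<eta> p \<le> J_eq T L f g0 \<psi> \<eta> q" using px by (simp add: minimizers_def)
  then have "cost T L f g0 (m_eq \<eta>) (P_eq \<psi> \<eta>) p \<le> ereal CJ"
    using q(2) by (simp add: J_eq_def)
  then show "p \<in> tame" by (rule tame_if_cost_le[OF x m price_P_eq adm])
qed

lemma J_eq_tame:
  assumes "equil \<eta>" and "p \<in> tame"
  shows "J_eq T L f g0 \<psi> \<eta> p = ereal (real_cost (m_eq \<eta>) (P_eq \<psi> \<eta>) p)"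
  using assms(2) unfolding J_eq_def
  by (intro cost_eq_real_cost m_eq_in_curves[OF equil_P1[OF assms(1)]] price_P_eq) (simp add: tame_def)

lemma AE_supp_equil:
  assumes \<eta>: "equil \<eta>" shows "AE p in \<eta>. p \<in> supp \<eta>"
proof (rule AE_in_supp)
  show "sets \<eta> = sets (restrict_space borel (pairs T))" using equil_P1[OF \<eta>] by (simp add: P1_def)
  show "continuous_on UNIV (pair_of_data T :: _ \<Rightarrow> ('n, 'm) pair)" by (rule continuous_pair_of_data[OF T])
  show "pairs T \<subseteq> range (pair_of_data T :: _ \<Rightarrow> ('n, 'm) pair)" using range_pair_of_data[OF T] by blast
qed

lemma supp_equil_closed:
  assumes \<eta>: "equil \<eta>"
  obtains C where "closed C" "supp \<eta> = pairs T \<inter> C"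
proof -
  have "sets \<eta> = sets (restrict_space borel (pairs T))" using equil_P1[OF \<eta>] by (simp add: P1_def)
  from sets_eq_imp_space_eq[OF this] have "space \<eta> = pairs T" by (simp add: space_restrict_space)
  then show thesis using supp_eq_Int_closed[of \<eta>] that by metis
qed

text \<open>
  The cost \<open>J_eq \<eta>\<close>, cut off outside the two supports: there it might be infinite, and its measurability
  is known on the supports only.
\<close>

definition supp_cost :: "('n, 'm) pair measure \<Rightarrow> ('n, 'm) pair measure \<Rightarrow> ('n, 'm) pair measure \<Rightarrow> ('n, 'm) pair \<Rightarrow> real"
  where "supp_cost \<eta>1 \<eta>2 \<eta> p =
    (if p \<in> supp \<eta>1 \<union> supp \<eta>2 then real_cost (m_eq \<eta>) (P_eq \<psi> \<eta>) p else 0)"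

lemma supp_Un_closed:
  assumes "equil \<eta>1" "equil \<eta>2"
  obtains C where "closed C" "supp \<eta>1 \<union> supp \<eta>2 = pairs T \<inter> C" "pairs T \<inter> C \<subseteq> tame"
proof -
  obtain C1 where "closed C1" "supp \<eta>1 = pairs T \<inter> C1" using supp_equil_closed[OF assms(1)] by metis
  moreover obtain C2 where "closed C2" "supp \<eta>2 = pairs T \<inter> C2" using supp_equil_closed[OF assms(2)] by metis
  ultimately have "closed (C1 \<union> C2)" and eq: "supp \<eta>1 \<union> supp \<eta>2 = pairs T \<inter> (C1 \<union> C2)" by auto
  moreover have "pairs T \<inter> (C1 \<union> C2) \<subseteq> tame"
    unfolding eq[symmetric] using supp_equil(3) assms by auto
  ultimately show thesis using that by blast
qed

lemma integrable_supp_cost: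
  assumes "equil \<eta>1" "equil \<eta>2" and \<eta>: "equil \<eta>" and \<mu>: "equil \<mu>"
  shows "integrable \<mu> (supp_cost \<eta>1 \<eta>2 \<eta>)"
proof -
  obtain C where C: "closed C" "supp \<eta>1 \<union> supp \<eta>2 = pairs T \<inter> C" "pairs T \<inter> C \<subseteq> tame"
    using supp_Un_closed[OF assms(1,2)] by metis
  show ?thesis unfolding supp_cost_def[abs_def] C(2)
    by (rule integrable_real_cost[OF equil_P1[OF \<mu>] m_eq_in_curves[OF equil_P1[OF \<eta>]] price_P_eq C(1,3)])
qed

text \<open>
  The pairs in the support of \<open>\<eta>\<close> minimise the cost \<open>J_eq \<eta>\<close> among all admissible pairs with the same
  initial position, in particular among those in the support of \<open>\<mu>\<close>, and both measures have the same
  distribution of initial positions.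
\<close>

lemma expected_cost_le:
  assumes "equil \<eta>1" "equil \<eta>2" and \<eta>: "\<eta> \<in> {\<eta>1, \<eta>2}" and \<mu>: "\<mu> \<in> {\<eta>1, \<eta>2}"
  shows "(LINT p|\<eta>. supp_cost \<eta>1 \<eta>2 \<eta> p) \<le> (LINT p|\<mu>. supp_cost \<eta>1 \<eta>2 \<eta> p)"
proof -
  have eq\<eta>: "equil \<eta>" and eq\<mu>: "equil \<mu>" using assms by auto
  note P1\<eta> = equil_P1[OF eq\<eta>] and P1\<mu> = equil_P1[OF eq\<mu>]
  note m = m_eq_in_curves[OF P1\<eta>, of T]
  obtain C where C: "closed C" "supp \<eta>1 \<union> supp \<eta>2 = pairs T \<inter> C" "pairs T \<inter> C \<subseteq> tame"
    using supp_Un_closed[OF assms(1,2)] by metis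
  obtain C\<eta> where C\<eta>: "closed C\<eta>" "supp \<eta> = pairs T \<inter> C\<eta>"
    using supp_equil_closed[OF eq\<eta>] by metis
  have sub: "supp \<eta> \<subseteq> supp \<eta>1 \<union> supp \<eta>2" "supp \<mu> \<subseteq> supp \<eta>1 \<union> supp \<eta>2" using \<eta> \<mu> by auto
  let ?\<Theta> = "\<lambda>p::('n, 'm) pair. ((traj p 0, velocity T a b p), snd p)"
  have id: "AE p in \<eta>. pair_of_data T (?\<Theta> p) = p"
    using AE_supp_equil[OF eq\<eta>]
    by eventually_elim (rule pair_of_data_velocity[OF T a_cont b_cont supp_equil(2)[OF eq\<eta>]])
  have "continuous_on UNIV ?\<Theta>"
    by (intro continuous_intros continuous_eval continuous_velocity[OF a_cont b_cont])
  then have meas: "?\<Theta> \<in> borel_measurable \<eta>"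
    by (intro measurable_on_pairs[OF P1\<eta>] borel_measurable_continuous_onI)
  have ps: "prob_space \<eta>" using P1\<eta> by (simp add: P1_def)
  obtain K :: "nat \<Rightarrow> ('n, 'm) pair set" where K: "\<And>n. compact (K n)" "\<And>n. K n \<subseteq> range (pair_of_data T)"
    and AEK: "AE p in \<eta>. p \<in> (\<Union>n. K n)"
    by (rule tight_if_AE_retraction[OF ps meas continuous_pair_of_data[OF T] id]) blast
  have Kp: "K n \<subseteq> pairs T" for n using K(2)[of n] range_pair_of_data[OF T] by blast
  show ?thesis
  proof (rule integral_le_if_fibrewise_le[where e="\<lambda>p. traj p 0" and K="\<lambda>n. K n \<inter> supp \<eta>" and B="supp \<mu>"])
    show "distr \<eta> borel (\<lambda>p. traj p 0) = distr \<mu> borel (\<lambda>p. traj p 0)"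
      using equil_marginal[OF eq\<eta>] equil_marginal[OF eq\<mu>] by (simp add: m_eq_eval)
    show "compact {p \<in> K n \<inter> supp \<eta>. supp_cost \<eta>1 \<eta>2 \<eta> p \<le> \<beta>}" for n \<beta>
    proof -
      obtain C' where C': "closed C'"
        "{p \<in> pairs T \<inter> C. real_cost (m_eq \<eta>) (P_eq \<psi> \<eta>) p \<le> \<beta>} = pairs T \<inter> C'"
        using closed_sublevel[OF m price_P_eq C(1,3)] by blast
      have "p \<in> K n \<inter> supp \<eta> \<and> supp_cost \<eta>1 \<eta>2 \<eta> p \<le> \<beta> \<longleftrightarrow> p \<in> K n \<inter> (C\<eta> \<inter> C')" for p
      proof -
        have "p \<in> pairs T \<inter> C \<and> real_cost (m_eq \<eta>) (P_eq \<psi> \<eta>) p \<le> \<beta> \<longleftrightarrow> p \<in> pairs T \<inter> C'"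
          using C'(2) by blast
        then show ?thesis using Kp[of n] sub(1) unfolding supp_cost_def C(2) C\<eta>(2) by auto
      qed
      then have "{p \<in> K n \<inter> supp \<eta>. supp_cost \<eta>1 \<eta>2 \<eta> p \<le> \<beta>} = K n \<inter> (C\<eta> \<inter> C')" by blast
      then show ?thesis using K(1) C\<eta>(1) C'(1) by (auto intro!: compact_Int_closed)
    qed
    show "AE p in \<eta>. p \<in> (\<Union>n. K n \<inter> supp \<eta>)"
      using AEK AE_supp_equil[OF eq\<eta>] by eventually_elim auto
    show "AE q in \<mu>. q \<in> supp \<mu>" by (rule AE_supp_equil[OF eq\<mu>])
    fix p q
    assume "p \<in> (\<Union>n. K n \<inter> supp \<eta>)" and "q \<in> (\<Union>n. K n \<inter> supp \<eta>) \<union> supp \<mu>"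
      and start: "traj p 0 = traj q 0"
    then have p: "p \<in> supp \<eta>" and q: "q \<in> supp \<eta> \<or> q \<in> supp \<mu>" by auto
    then have "q \<in> admiss (traj p 0)" "q \<in> tame"
      using supp_equil(2,3)[OF eq\<eta>, of q] supp_equil(2,3)[OF eq\<mu>, of q] start by auto
    from supp_equil(4)[OF eq\<eta> p this(1)] J_eq_tame[OF eq\<eta> this(2)] J_eq_tame[OF eq\<eta> supp_equil(3)[OF eq\<eta> p]]
    have "real_cost (m_eq \<eta>) (P_eq \<psi> \<eta>) p \<le> real_cost (m_eq \<eta>) (P_eq \<psi> \<eta>) q" by simp
    then show "supp_cost \<eta>1 \<eta>2 \<eta> p \<le> supp_cost \<eta>1 \<eta>2 \<eta> q"
      using p q sub by (auto simp: supp_cost_def)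
  qed (use measurable_eval[OF P1\<eta>] measurable_eval[OF P1\<mu>] continuous_eval
      integrable_supp_cost[OF assms(1,2) eq\<eta>] eq\<eta> eq\<mu> in auto)
qed

section \<open>The monotonicity argument\<close>

text \<open>
  The Lagrangian does not depend on the equilibrium and cancels in \<open>J_eq \<eta>1 - J_eq \<eta>2\<close>; the mean of
  what remains involves the law \<open>\<mu>\<close> only through its mean control and its time marginals.
\<close>

lemma expected_cost_difference:
  assumes e1: "equil \<eta>1" and e2: "equil \<eta>2" and \<mu>: "\<mu> \<in> {\<eta>1, \<eta>2}"
  shows "(LINT p|\<mu>. supp_cost \<eta>1 \<eta>2 \<eta>1 p) - (LINT p|\<mu>. supp_cost \<eta>1 \<eta>2 \<eta>2 p)
    = (LINT t|leb T. (P_eq \<psi> \<eta>1 t - P_eq \<psi> \<eta>2 t) \<bullet> L2_apply (LINT p|\<mu>. snd p) t)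
      + (LINT t|leb T. LINT x|m_eq \<mu> t. f x (m_eq \<eta>1 t) - f x (m_eq \<eta>2 t))
      + (LINT x|m_eq \<mu> T. g0 x (m_eq \<eta>1 T) - g0 x (m_eq \<eta>2 T))"
    and "integrable (leb T) (\<lambda>t. LINT x|m_eq \<mu> t. f x (m_eq \<eta>1 t) - f x (m_eq \<eta>2 t))"
    and "\<And>t. t \<in> {0..T} \<Longrightarrow> integrable (m_eq \<mu> t) (\<lambda>x. f x (m_eq \<eta>1 t) - f x (m_eq \<eta>2 t))"
    and "integrable (m_eq \<mu> T) (\<lambda>x. g0 x (m_eq \<eta>1 T) - g0 x (m_eq \<eta>2 T))"
proof -
  have e\<mu>: "equil \<mu>" using assms by auto
  note P1\<mu> = equil_P1[OF e\<mu>]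
  note m1 = m_eq_in_curves[OF equil_P1[OF e1], of T] and m2 = m_eq_in_curves[OF equil_P1[OF e2], of T]
  define Q where "Q t = P_eq \<psi> \<eta>1 t - P_eq \<psi> \<eta>2 t" for t
  define \<Delta>f where "\<Delta>f x t = f x (m_eq \<eta>1 t) - f x (m_eq \<eta>2 t)" for x t
  define \<Delta>g where "\<Delta>g x t = g0 x (m_eq \<eta>1 t) - g0 x (m_eq \<eta>2 t)" for x t
  have Qm: "Q \<in> borel_measurable borel"
    unfolding Q_def[abs_def] using price_P_eq by (intro borel_measurable_diff) (auto simp: bounded_price_def)
  have QB: "norm (Q t) \<le> 2 * B" for t
  proof -
    have "norm (P_eq \<psi> \<eta>1 t) \<le> B" "norm (P_eq \<psi> \<eta>2 t) \<le> B"
      using price_P_eq by (auto simp: bounded_price_def)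
    then show ?thesis unfolding Q_def using norm_triangle_ineq4[of "P_eq \<psi> \<eta>1 t" "P_eq \<psi> \<eta>2 t"] by linarith
  qed
  have \<Delta>f: "continuous_on (UNIV \<times> {0..T}) (\<lambda>(x, t). \<Delta>f x t)"
    using continuous_on_diff[OF f_strip[OF m1] f_strip[OF m2]] by (simp add: \<Delta>f_def split_beta)
  have \<Delta>g: "continuous_on (UNIV \<times> {0..T}) (\<lambda>(x, t). \<Delta>g x t)"
    using continuous_on_diff[OF g0_strip[OF m1] g0_strip[OF m2]] by (simp add: \<Delta>g_def split_beta)
  have AER: "AE p in \<mu>. norm (fst p) \<le> state_radius"
    using AE_supp_equil[OF e\<mu>] by eventually_elim (use supp_equil(3)[OF e\<mu>] in \<open>simp add: tame_def\<close>)
  note Ff = Fubini_along_trajectories[OF T P1\<mu> AER \<Delta>f]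
  note Fg = Fubini_along_trajectories[OF T P1\<mu> AER \<Delta>g]
  show "integrable (leb T) (\<lambda>t. LINT x|m_eq \<mu> t. f x (m_eq \<eta>1 t) - f x (m_eq \<eta>2 t))"
    using Ff(3) by (simp add: \<Delta>f_def)
  show "integrable (m_eq \<mu> t) (\<lambda>x. f x (m_eq \<eta>1 t) - f x (m_eq \<eta>2 t))" if "t \<in> {0..T}" for t
    using Ff(1)[OF that] by (simp add: \<Delta>f_def)
  have ig: "integrable (m_eq \<mu> T) (\<lambda>x. \<Delta>g x T)" using Fg(1)[of T] T by simp
  then show "integrable (m_eq \<mu> T) (\<lambda>x. g0 x (m_eq \<eta>1 T) - g0 x (m_eq \<eta>2 T))"
    by (simp add: \<Delta>g_def)
  have gm: "(\<lambda>x. \<Delta>g x T) \<in> borel_measurable borel"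
    using T by (intro borel_measurable_continuous_onI continuous_slice[OF \<Delta>g]) auto
  have igp: "integrable \<mu> (\<lambda>p. \<Delta>g (traj p T) T)"
    using ig by (simp add: m_eq_eval integrable_distr_eq measurable_eval[OF P1\<mu>] gm)
  define q where "q = abs_L2fun (\<lambda>t. indicator {0<..<T} t *\<^sub>R Q t)"
  have isnd: "integrable \<mu> snd"
  proof (rule Bochner_Integration.integrable_bound)
    show "integrable \<mu> norm" using P1\<mu> by (simp add: P1_def)
    show "snd \<in> borel_measurable \<mu>"
      by (intro measurable_on_pairs[OF P1\<mu>] borel_measurable_continuous_onI continuous_on_snd continuous_on_id)
    have "norm (snd p) \<le> norm p" for p :: "('n, 'm) pair" using norm_snd_le[of "snd p" "fst p"] by simp
    then show "AE p in \<mu>. norm (snd p) \<le> norm (norm p)" by simp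
  qed
  have diff: "real_cost (m_eq \<eta>1) (P_eq \<psi> \<eta>1) p - real_cost (m_eq \<eta>2) (P_eq \<psi> \<eta>2) p
      = q \<bullet> snd p + (LINT t|leb T. \<Delta>f (traj p t) t) + \<Delta>g (traj p T) T" if p: "p \<in> tame" for p
  proof -
    have i: "integrable (leb T) (lagr p)" using p by (simp add: tame_def)
    have "(LINT t|leb T. Q t \<bullet> ctrl p t)
        = (LINT t|leb T. P_eq \<psi> \<eta>1 t \<bullet> ctrl p t) - (LINT t|leb T. P_eq \<psi> \<eta>2 t \<bullet> ctrl p t)"
      unfolding Q_def inner_diff_left
      by (rule Bochner_Integration.integral_diff) (rule integrable_P[OF price_P_eq])+
    moreover have "(LINT t|leb T. Q t \<bullet> ctrl p t) = q \<bullet> snd p"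
      unfolding q_def by (rule integrable_bounded_control(3)[OF T Qm QB])
    moreover have "(LINT t|leb T. \<Delta>f (traj p t) t)
        = (LINT t|leb T. f (traj p t) (m_eq \<eta>1 t)) - (LINT t|leb T. f (traj p t) (m_eq \<eta>2 t))"
      unfolding \<Delta>f_def
      by (rule Bochner_Integration.integral_diff) (rule integrable_f[OF m1] integrable_f[OF m2])+
    ultimately show ?thesis
      unfolding real_cost_def integral_run[OF m1 price_P_eq i] integral_run[OF m2 price_P_eq i] \<Delta>g_def by simp
  qed
  have iq: "integrable \<mu> (\<lambda>p. q \<bullet> snd p)" using isnd by simp
  have "(LINT p|\<mu>. supp_cost \<eta>1 \<eta>2 \<eta>1 p) - (LINT p|\<mu>. supp_cost \<eta>1 \<eta>2 \<eta>2 p)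
      = (LINT p|\<mu>. supp_cost \<eta>1 \<eta>2 \<eta>1 p - supp_cost \<eta>1 \<eta>2 \<eta>2 p)"
    by (intro Bochner_Integration.integral_diff[symmetric] integrable_supp_cost e1 e2 e\<mu>)
  also have "\<dots> = (LINT p|\<mu>. q \<bullet> snd p + (LINT t|leb T. \<Delta>f (traj p t) t) + \<Delta>g (traj p T) T)"
  proof (rule integral_cong_AE)
    show "AE p in \<mu>. supp_cost \<eta>1 \<eta>2 \<eta>1 p - supp_cost \<eta>1 \<eta>2 \<eta>2 p
        = q \<bullet> snd p + (LINT t|leb T. \<Delta>f (traj p t) t) + \<Delta>g (traj p T) T"
      using AE_supp_equil[OF e\<mu>]
    proof eventually_elim
      case (elim p)
      then have "p \<in> supp \<eta>1 \<union> supp \<eta>2" using \<mu> by auto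
      then show ?case using diff[OF supp_equil(3)[OF e\<mu> elim]] by (simp add: supp_cost_def)
    qed
    show "(\<lambda>p. supp_cost \<eta>1 \<eta>2 \<eta>1 p - supp_cost \<eta>1 \<eta>2 \<eta>2 p) \<in> borel_measurable \<mu>"
      using integrable_supp_cost[OF e1 e2 e1 e\<mu>] integrable_supp_cost[OF e1 e2 e2 e\<mu>]
      by (intro borel_measurable_diff) auto
    show "(\<lambda>p. q \<bullet> snd p + (LINT t|leb T. \<Delta>f (traj p t) t) + \<Delta>g (traj p T) T) \<in> borel_measurable \<mu>"
      using iq Ff(2) igp by (intro borel_measurable_add) auto
  qed
  also have "\<dots> = (LINT p|\<mu>. q \<bullet> snd p) + (LINT p|\<mu>. LINT t|leb T. \<Delta>f (traj p t) t) + (LINT p|\<mu>. \<Delta>g (traj p T) T)"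
    using iq Ff(2) igp by simp
  also have "(LINT p|\<mu>. q \<bullet> snd p) = q \<bullet> (LINT p|\<mu>. snd p)"
    using isnd by simp
  also have "\<dots> = (LINT t|leb T. Q t \<bullet> L2_apply (LINT p|\<mu>. snd p) t)"
    unfolding q_def by (rule integrable_bounded_control(3)[OF T Qm QB, symmetric])
  also have "(LINT p|\<mu>. LINT t|leb T. \<Delta>f (traj p t) t) = (LINT t|leb T. LINT x|m_eq \<mu> t. \<Delta>f x t)"
    by (rule Ff(4))
  also have "(LINT p|\<mu>. \<Delta>g (traj p T) T) = (LINT x|m_eq \<mu> T. \<Delta>g x T)"
    by (rule integral_m_eq[OF P1\<mu> gm, symmetric])
  finally show "(LINT p|\<mu>. supp_cost \<eta>1 \<eta>2 \<eta>1 p) - (LINT p|\<mu>. supp_cost \<eta>1 \<eta>2 \<eta>2 p)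
    = (LINT t|leb T. (P_eq \<psi> \<eta>1 t - P_eq \<psi> \<eta>2 t) \<bullet> L2_apply (LINT p|\<mu>. snd p) t)
      + (LINT t|leb T. LINT x|m_eq \<mu> t. f x (m_eq \<eta>1 t) - f x (m_eq \<eta>2 t))
      + (LINT x|m_eq \<mu> T. g0 x (m_eq \<eta>1 T) - g0 x (m_eq \<eta>2 T))"
    by (simp add: Q_def \<Delta>f_def \<Delta>g_def)
qed

text \<open>
  Adding the two optimality inequalities gives a nonpositive number, which the preceding lemma writes as
  the sum of three monotonicity pairings. Each of these is nonnegative, so all vanish, and strict
  monotonicity turns this into equality.
\<close>

lemma equilibria_agree:
  assumes e1: "equil \<eta>1" and e2: "equil \<eta>2"
    and f_mono: "strict_mono_meas f" and g0_mono: "strict_mono_meas g0"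
    and \<psi>_mono: "\<And>x y. x \<noteq> y \<Longrightarrow> (\<psi> y - \<psi> x) \<bullet> (y - x) > 0"
  shows "AE t in leb T. P_eq \<psi> \<eta>1 t = P_eq \<psi> \<eta>2 t"
    and "AE t in leb T. \<forall>x. f x (m_eq \<eta>1 t) = f x (m_eq \<eta>2 t)"
    and "\<forall>x. g0 x (m_eq \<eta>1 T) = g0 x (m_eq \<eta>2 T)"
proof -
  let ?\<theta> = "\<lambda>\<eta>. L2_apply (LINT p|\<eta>. snd p :: (real^'m) L2fun)"
  define DP where "DP \<eta> t = (P_eq \<psi> \<eta>1 t - P_eq \<psi> \<eta>2 t) \<bullet> ?\<theta> \<eta> t" for \<eta> :: "('n, 'm) pair measure" and t
  define Df where "Df \<eta> t = (LINT x|m_eq \<eta> t. f x (m_eq \<eta>1 t) - f x (m_eq \<eta>2 t))"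
    for \<eta> :: "('n, 'm) pair measure" and t
  define Dg where "Dg \<eta> = (LINT x|m_eq \<eta> T. g0 x (m_eq \<eta>1 T) - g0 x (m_eq \<eta>2 T))"
    for \<eta> :: "('n, 'm) pair measure"
  note d1 = expected_cost_difference[OF e1 e2, of \<eta>1, simplified]
  note d2 = expected_cost_difference[OF e1 e2, of \<eta>2, simplified]
  have iDP: "integrable (leb T) (DP \<eta>)" for \<eta>
    unfolding DP_def[abs_def] inner_diff_left
    by (intro Bochner_Integration.integrable_diff integrable_P[OF price_P_eq, where p="(undefined, LINT p|\<eta>. snd p)", simplified])
  have iDf: "integrable (leb T) (Df \<eta>1)" "integrable (leb T) (Df \<eta>2)"
    using d1(2) d2(2) by (simp_all add: Df_def[abs_def])
  have "(LINT p|\<eta>1. supp_cost \<eta>1 \<eta>2 \<eta>1 p) \<le> (LINT p|\<eta>2. supp_cost \<eta>1 \<eta>2 \<eta>1 p)"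
    "(LINT p|\<eta>2. supp_cost \<eta>1 \<eta>2 \<eta>2 p) \<le> (LINT p|\<eta>1. supp_cost \<eta>1 \<eta>2 \<eta>2 p)"
    by (rule expected_cost_le[OF e1 e2]; simp)+
  \<comment> \<open>Each population does no better by adopting the behaviour of the other; add the two inequalities.\<close>
  then have "((LINT t|leb T. DP \<eta>1 t) + (LINT t|leb T. Df \<eta>1 t) + Dg \<eta>1)
      - ((LINT t|leb T. DP \<eta>2 t) + (LINT t|leb T. Df \<eta>2 t) + Dg \<eta>2) \<le> 0"
    using d1(1) d2(1) by (simp add: DP_def Df_def Dg_def)
  then have sum: "(LINT t|leb T. DP \<eta>1 t - DP \<eta>2 t) + (LINT t|leb T. Df \<eta>1 t - Df \<eta>2 t) + (Dg \<eta>1 - Dg \<eta>2) \<le> 0"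
    using iDP iDf by simp
  have DP: "DP \<eta>1 t - DP \<eta>2 t = (\<psi> (?\<theta> \<eta>1 t) - \<psi> (?\<theta> \<eta>2 t)) \<bullet> (?\<theta> \<eta>1 t - ?\<theta> \<eta>2 t)" for t
    by (simp add: DP_def P_eq_def inner_diff_right)
  have DP0: "0 \<le> DP \<eta>1 t - DP \<eta>2 t" for t
    unfolding DP using \<psi>_mono[of "?\<theta> \<eta>2 t" "?\<theta> \<eta>1 t"] 
    by (cases "?\<theta> \<eta>2 t = ?\<theta> \<eta>1 t") (auto intro: less_imp_le)
  have P1m: "m_eq \<eta>1 t \<in> P1 UNIV" "m_eq \<eta>2 t \<in> P1 UNIV" for t
    using m_eq_in_P1 equil_P1 e1 e2 by blast+
  have f_iff: "0 \<le> Df \<eta>1 t - Df \<eta>2 t"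
    "Df \<eta>1 t - Df \<eta>2 t = 0 \<longleftrightarrow> (\<forall>x. f x (m_eq \<eta>1 t) = f x (m_eq \<eta>2 t))" if "t \<in> {0..T}" for t
    using f_mono P1m[of t] d1(3)[of t] d2(3)[of t] that
    by (simp_all add: strict_mono_meas_def mono_meas_def Df_def)
  have g_iff: "0 \<le> Dg \<eta>1 - Dg \<eta>2"
    "Dg \<eta>1 - Dg \<eta>2 = 0 \<longleftrightarrow> (\<forall>x. g0 x (m_eq \<eta>1 T) = g0 x (m_eq \<eta>2 T))"
    using g0_mono P1m[of T] d1(4) d2(4)
    by (simp_all add: strict_mono_meas_def mono_meas_def Dg_def)
  have AEf: "AE t in leb T. 0 \<le> Df \<eta>1 t - Df \<eta>2 t"
    using f_iff(1) by (intro AE_I2) (simp add: space_restrict_space)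
  have IP: "0 \<le> (LINT t|leb T. DP \<eta>1 t - DP \<eta>2 t)" by (rule Bochner_Integration.integral_nonneg) (rule DP0)
  have If: "0 \<le> (LINT t|leb T. Df \<eta>1 t - Df \<eta>2 t)" using AEf by (rule integral_nonneg_AE)
  have "(LINT t|leb T. DP \<eta>1 t - DP \<eta>2 t) = 0" using sum IP If g_iff(1) by linarith
  then have "AE t in leb T. DP \<eta>1 t - DP \<eta>2 t = 0"
    using DP0 iDP by (subst (asm) integral_nonneg_eq_0_iff_AE) auto
  then show "AE t in leb T. P_eq \<psi> \<eta>1 t = P_eq \<psi> \<eta>2 t"
  proof eventually_elim
    case (elim t)
    then have "?\<theta> \<eta>1 t = ?\<theta> \<eta>2 t"
      unfolding DP using \<psi>_mono[of "?\<theta> \<eta>2 t" "?\<theta> \<eta>1 t"] by fastforce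
    then show ?case by (simp add: P_eq_def)
  qed
  have "(LINT t|leb T. Df \<eta>1 t - Df \<eta>2 t) = 0" using sum IP If g_iff(1) by linarith
  then have "AE t in leb T. Df \<eta>1 t - Df \<eta>2 t = 0"
    using AEf iDf by (subst (asm) integral_nonneg_eq_0_iff_AE) auto
  moreover have "AE t in leb T. t \<in> {0..T}" by (intro AE_I2) (simp add: space_restrict_space)
  ultimately show "AE t in leb T. \<forall>x. f x (m_eq \<eta>1 t) = f x (m_eq \<eta>2 t)"
    by eventually_elim (use f_iff(2) in blast)
  show "\<forall>x. g0 x (m_eq \<eta>1 T) = g0 x (m_eq \<eta>2 T)"
  proof -
    have "Dg \<eta>1 - Dg \<eta>2 = 0" using sum IP If g_iff(1) by linarith
    then show ?thesis using g_iff(2) by blast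
  qed
qed

end

lemma cost_cong_AE:
  assumes "AE t in leb T. Q1 t = Q2 t" and "AE t in leb T. \<forall>x. f x (m1 t) = f x (m2 t)"
    and "\<forall>x. g0 x (m1 T) = g0 x (m2 T)"
  shows "cost T L f g0 m1 Q1 p = cost T L f g0 m2 Q2 p"
proof -
  let ?h = "\<lambda>m P t. L (traj p t, ctrl p t) + P t \<bullet> ctrl p t + f (traj p t) (m t)"
  have eq: "AE t in leb T. ?h m1 Q1 t = ?h m2 Q2 t"
    using assms(1,2) by eventually_elim simp
  have "ereal_integral (leb T) (?h m1 Q1) = ereal_integral (leb T) (?h m2 Q2)"
  proof -
    have "(\<integral>\<^sup>+t. ennreal (?h m1 Q1 t) \<partial>leb T) = (\<integral>\<^sup>+t. ennreal (?h m2 Q2 t) \<partial>leb T)"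
      by (rule nn_integral_cong_AE) (rule eventually_mono[OF eq], rule arg_cong[where f=ennreal])
    moreover have "(\<integral>\<^sup>+t. ennreal (- ?h m1 Q1 t) \<partial>leb T) = (\<integral>\<^sup>+t. ennreal (- ?h m2 Q2 t) \<partial>leb T)"
      by (rule nn_integral_cong_AE) (rule eventually_mono[OF eq], rule arg_cong[where f="\<lambda>y. ennreal (- y)"])
    ultimately show ?thesis by (simp only: ereal_integral_def)
  qed
  then show ?thesis using assms(3) by (cases p) (simp add: cost_def)
qed

lemma C1_imp_continuous: "C1 h \<Longrightarrow> continuous_on UNIV h"
  unfolding C1_def by (meson differentiable_imp_continuous_within continuous_at_imp_continuous_on)

theorem theorem5p2:
  fixes T :: real
    and a :: "real^'n::finite \<Rightarrow> real^'n"
    and b :: "real^'n \<Rightarrow> real^'m::finite^'n"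
    and c :: "(real^'n) \<times> (real^'m) \<Rightarrow> real^'nc::finite"
    and g1 :: "real^'n \<Rightarrow> real^'g1::finite"
    and g2 :: "real^'n \<Rightarrow> real^'g2::finite"
    and L :: "(real^'n) \<times> (real^'m) \<Rightarrow> real"
    and f g0 :: "real^'n \<Rightarrow> (real^'n) measure \<Rightarrow> real"
    and \<psi> :: "real^'m \<Rightarrow> real^'m"
    and m0 :: "(real^'n) measure"
    and \<eta>1 \<eta>2 :: "('n, 'm) pair measure"
  assumes "T > 0"
    and "m0 \<in> P1 UNIV"
    and "convexity L c \<psi>"
    and "regularity a b c g1 g2 L f g0 \<psi>"
    and "growth T a b c g1 g2 L f g0 \<psi> m0"
    and "feasibility T a b c g1 g2 L f g0 \<psi> m0"
    and "qualification T a b c g1 g2 m0"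
    and "strict_mono_meas f"
    and "strict_mono_meas g0"
    and "\<And>x y. x \<noteq> y \<Longrightarrow> (\<psi> y - \<psi> x) \<bullet> (y - x) > 0"
    and "equilibrium T a b c g1 g2 L f g0 \<psi> m0 \<eta>1"
    and "equilibrium T a b c g1 g2 L f g0 \<psi> m0 \<eta>2"
  shows "(AE t in leb T. P_eq \<psi> \<eta>1 t = P_eq \<psi> \<eta>2 t) \<and>
    (\<forall>p\<in>pairs T. J_eq T L f g0 \<psi> \<eta>1 p = J_eq T L f g0 \<psi> \<eta>2 p)"
proof -
  obtain CL where CL: "CL > 0" "\<And>x v. L (x, v) \<ge> (1 / CL) * (norm v)\<^sup>2 - CL"
    using assms(3) unfolding convexity_def by blast
  have cont: "continuous_on UNIV L" "continuous_on UNIV a" "continuous_on UNIV b" "continuous_on UNIV \<psi>"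
    "continuous_map (prod_topology euclidean narrow) euclidean (\<lambda>(x, \<mu>). f x \<mu>)"
    "continuous_map (prod_topology euclidean narrow) euclidean (\<lambda>(x, \<mu>). g0 x \<mu>)"
    using assms(4) unfolding regularity_def C2_def by (auto intro: C1_imp_continuous)
  obtain Ca where Ca: "\<And>x. norm (a x) \<le> Ca * (1 + norm x) \<and> norm (b x) \<le> Ca * (1 + norm x)"
    using assms(5) unfolding growth_def by blast
  have bd: "bounded (supp m0)" "bounded (range \<psi>)" using assms(5) by (simp_all add: growth_def)
  obtain R0 where R0: "\<And>x. x \<in> supp m0 \<Longrightarrow> norm x \<le> R0"
    using bd(1) unfolding bounded_iff by blast
  have "\<exists>C>0. \<forall>x0\<in>supp m0. \<forall>m\<in>curves T. \<forall>(\<gamma>, v)\<in>admissible T a b c g1 g2 x0.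
      (LINT t|leb T. f (\<gamma> t) (m t)) + g0 (\<gamma> T) (m T) \<ge> - C \<and>
      Linf_norm T (\<lambda>t. fderiv (\<lambda>x. f x (m t)) (\<gamma> t)) \<le> ereal C"
    using assms(5) unfolding growth_def by (elim conjE)
  then obtain Cf where Cf: "\<forall>x0\<in>supp m0. \<forall>m\<in>curves T. \<forall>(\<gamma>, v)\<in>admissible T a b c g1 g2 x0.
      (LINT t|leb T. f (\<gamma> t) (m t)) + g0 (\<gamma> T) (m T) \<ge> - Cf \<and>
      Linf_norm T (\<lambda>t. fderiv (\<lambda>x. f x (m t)) (\<gamma> t)) \<le> ereal Cf"
    by (elim exE conjE)
  obtain B where B: "\<And>\<theta>. norm (\<psi> \<theta>) \<le> B"
    using bd(2) unfolding bounded_iff by blast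
  obtain CJ where CJ: "\<And>x0 m P. x0 \<in> supp m0 \<Longrightarrow> m \<in> curves T \<Longrightarrow> P \<in> Linf T \<Longrightarrow>
      m 0 = m0 \<and> Linf_norm T P \<le> ereal (SUP \<theta>. norm (\<psi> \<theta>)) \<Longrightarrow>
      \<exists>p\<in>admissible T a b c g1 g2 x0. cost T L f g0 m P p \<le> ereal CJ"
    using assms(6) unfolding feasibility_def by blast
  interpret control_bounds T a b c g1 g2 L f g0 \<psi> m0 CL Ca R0 Cf B CJ
  proof
    fix x0 and m :: "real \<Rightarrow> (real^'n) measure" and p :: "('n, 'm) pair"
    assume "x0 \<in> supp m0" "m \<in> curves T" "p \<in> admissible T a b c g1 g2 x0"
    then show "- Cf \<le> (LINT t|leb T. f (traj p t) (m t)) + g0 (traj p T) (m T)"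
      using Cf by (fastforce simp: split_beta)
  qed (use assms(1) CL cont Ca R0 B CJ in auto)
  note agree = equilibria_agree[OF assms(11,12,8,9,10)]
  have "J_eq T L f g0 \<psi> \<eta>1 p = J_eq T L f g0 \<psi> \<eta>2 p" for p
    unfolding J_eq_def by (rule cost_cong_AE[OF agree])
  with agree(1) show ?thesis by blast
qed

end
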